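(* There is an algorithm that, given a graph $G$ with $n$ vertices, computes a linear decomposition of $G$ of minimum boolean-width in $O(n^3\cdot 2^{n+\operatorname{lbw}(G)})$ time using $O(n\cdot 2^n)$ space.
   Context: Let $G=(V,E)$ be a finite simple undirected graph. For $A\subseteq V$ write $\overline{A}=V\setminus A$ and $N(X)=\bigcup_{x\in X}N(x)$. Define $\mathcal{UN}(A)=\{N(X)\cap\overline{A}: X\subseteq A\}$ and $\operatorname{booldim}(A)=\log_2|\mathcal{UN}(A)|$. A decomposition tree of $G$ is a pair $(T,\delta)$ with $T$ a full binary tree and $\delta$ a bijection from the leaves of $T$ to $V$; for a node $w$, $\delta(w)$ is the set of vertices at leaves below $w$. Its boolean-width is $\max_{w\in T}\operatorname{booldim}(\delta(w))$. A linear decomposition is a decomposition tree in which every internal node has at least one leaf as a child; $\operatorname{lbw}(G)$ is the minimum boolean-width over all linear decompositions of $G$. *)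

theory Defs
  imports Complex_Main
begin

section \<open>Graphs and boolean dimension\<close>

definition simple_graph :: "'a set \<Rightarrow> 'a set set \<Rightarrow> bool" where
  "simple_graph V E \<longleftrightarrow> finite V \<and> E \<subseteq> {{u, v} | u v. u \<in> V \<and> v \<in> V \<and> u \<noteq> v}"

definition nbhd :: "'a set set \<Rightarrow> 'a \<Rightarrow> 'a set" where
  "nbhd E x = {y. {x, y} \<in> E}"

definition nbhd_unions :: "'a set \<Rightarrow> 'a set set \<Rightarrow> 'a set \<Rightarrow> 'a set set" where
  "nbhd_unions V E A = {(\<Union>x\<in>X. nbhd E x) \<inter> (V - A) | X. X \<subseteq> A}"

definition booldim :: "'a set \<Rightarrow> 'a set set \<Rightarrow> 'a set \<Rightarrow> real" where
  "booldim V E A = log 2 (real (card (nbhd_unions V E A)))"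


section \<open>Decomposition trees\<close>

text \<open>
  A pair consisting of a full binary tree and a bijection from its leaves to the vertex set is
  represented by a full binary tree whose leaves carry pairwise distinct labels that exhaust the
  vertex set. Such a tree has at least one leaf, so a graph without vertices has no
  decomposition tree. Below, a node is identified with the subtree rooted at it, and the set
  that the bijection assigns to the node is the set \<^const>\<open>set\<close> of the leaf labels of that subtree.
\<close>

datatype 'a dtree = Leaf 'a | Node "'a dtree" "'a dtree"

fun leaves :: "'a dtree \<Rightarrow> 'a list" where
  "leaves (Leaf v) = [v]"
| "leaves (Node l r) = leaves l @ leaves r"

fun subtrees :: "'a dtree \<Rightarrow> 'a dtree set" where
  "subtrees (Leaf v) = {Leaf v}"
| "subtrees (Node l r) = insert (Node l r) (subtrees l \<union> subtrees r)"

definition decomposition :: "'a set \<Rightarrow> 'a dtree \<Rightarrow> bool" where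
  "decomposition V t \<longleftrightarrow> distinct (leaves t) \<and> set (leaves t) = V"

fun is_leaf :: "'a dtree \<Rightarrow> bool" where
  "is_leaf (Leaf v) \<longleftrightarrow> True"
| "is_leaf (Node l r) \<longleftrightarrow> False"

definition linear_decomposition :: "'a set \<Rightarrow> 'a dtree \<Rightarrow> bool" where
  "linear_decomposition V t \<longleftrightarrow>
     decomposition V t \<and> (\<forall>l r. Node l r \<in> subtrees t \<longrightarrow> is_leaf l \<or> is_leaf r)"

definition boolwidth :: "'a set \<Rightarrow> 'a set set \<Rightarrow> 'a dtree \<Rightarrow> real" where
  "boolwidth V E t = Max ((\<lambda>w. booldim V E (set (leaves w))) ` subtrees t)"

definition lbw :: "'a set \<Rightarrow> 'a set set \<Rightarrow> real" where
  "lbw V E = Min (boolwidth V E ` {t. linear_decomposition V t})"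

text \<open>
  \<^const>\<open>Max\<close> and \<^const>\<open>Min\<close> above are taken over finite sets, which are nonempty when \<open>V\<close> is.
\<close>

lemma subtrees_finite_nonempty: "finite (subtrees t)" "subtrees t \<noteq> {}"
  by (induction t) auto

lemma finite_linear_decompositions:
  assumes "finite V"
  shows "finite {t. linear_decomposition V t}"
proof -
  have nonempty: "length (leaves t) > 0" for t :: "'a dtree"
    by (induction t) auto
  have bounded: "finite {t. set (leaves t) \<subseteq> V \<and> length (leaves t) \<le> m}" (is "finite (?S m)") for m
  proof (induction m)
    case 0
    have "?S 0 = {}"
      using nonempty by force
    then show ?case
      by (metis finite.emptyI)
  next
    case (Suc m)
    have "t \<in> Leaf ` V \<union> case_prod Node ` (?S m \<times> ?S m)" if "t \<in> ?S (Suc m)" for t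
    proof (cases t)
      case (Leaf v)
      then show ?thesis using that by auto
    next
      case (Node l r)
      have "length (leaves l) + length (leaves r) \<le> Suc m"
        using that Node by simp
      then have "length (leaves l) \<le> m" "length (leaves r) \<le> m"
        using nonempty[of l] nonempty[of r] by linarith+
      then have "(l, r) \<in> ?S m \<times> ?S m"
        using that Node by simp
      then show ?thesis
        using Node by force
    qed
    then have "?S (Suc m) \<subseteq> Leaf ` V \<union> case_prod Node ` (?S m \<times> ?S m)"
      by blast
    then show ?case
      using Suc assms by (meson finite_SigmaI finite_UnI finite_imageI finite_subset)
  qed
  have "{t. linear_decomposition V t} \<subseteq> ?S (card V)"
    by (auto simp: linear_decomposition_def decomposition_def distinct_card)
  then show ?thesis
    using bounded finite_subset by blast
qed

lemma linear_decomposition_exists: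
  assumes "finite V" "V \<noteq> {}"
  shows "\<exists>t. linear_decomposition V t"
proof -
  have "\<exists>t. distinct (leaves t) \<and> set (leaves t) = V \<and>
          (\<forall>l r. Node l r \<in> subtrees t \<longrightarrow> is_leaf l \<or> is_leaf r)"
    using assms
  proof (induction V rule: finite_ne_induct)
    case (singleton v)
    show ?case by (rule exI[of _ "Leaf v"]) simp
  next
    case (insert v V)
    then obtain t where "distinct (leaves t) \<and> set (leaves t) = V \<and>
          (\<forall>l r. Node l r \<in> subtrees t \<longrightarrow> is_leaf l \<or> is_leaf r)"
      by blast
    then show ?case
      using insert by (intro exI[of _ "Node (Leaf v) t"]) auto
  qed
  then show ?thesis
    by (simp add: linear_decomposition_def decomposition_def)
qed


section \<open>Word RAM\<close>

text \<open>
  The machine is a unit-cost random access machine in the style of Cook and Reckhow, extended by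
  bitwise conjunction and disjunction: a fixed program, registers indexed by natural numbers and
  initially zero, indirect addressing, a read-only input tape and a write-only output tape.
  Registers contain arbitrary natural numbers in the semantics of a single step; the
  restriction to words of \<open>w\<close> bits is part of \<open>computes_within\<close> below.
\<close>

datatype instr =
    Const nat nat
  | Add nat nat nat
  | Sub nat nat nat
  | And nat nat nat
  | Or nat nat nat
  | Load nat nat
  | Store nat nat
  | Jump_pos nat nat
  | Read nat
  | Print nat

type_synonym program = "instr list"

record config =
  pc :: nat
  reg :: "nat \<Rightarrow> nat"
  inp :: "nat list"
  outp :: "nat list"

definition put :: "nat \<Rightarrow> nat \<Rightarrow> config \<Rightarrow> config" where
  "put i x c = c\<lparr>pc := Suc (pc c), reg := (reg c)(i := x)\<rparr>"

text \<open>
  Subtraction is truncated at zero. Reading beyond the end of the input yields zero.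
\<close>

fun exec_instr :: "instr \<Rightarrow> config \<Rightarrow> config" where
  "exec_instr (Const i x) c = put i x c"
| "exec_instr (Add i j k) c = put i (reg c j + reg c k) c"
| "exec_instr (Sub i j k) c = put i (reg c j - reg c k) c"
| "exec_instr (And i j k) c = put i (Bit_Operations.and (reg c j) (reg c k)) c"
| "exec_instr (Or i j k) c = put i (Bit_Operations.or (reg c j) (reg c k)) c"
| "exec_instr (Load i j) c = put i (reg c (reg c j)) c"
| "exec_instr (Store i j) c = put (reg c i) (reg c j) c"
| "exec_instr (Jump_pos i l) c = c\<lparr>pc := (if reg c i > 0 then l else Suc (pc c))\<rparr>"
| "exec_instr (Read i) c = (case inp c of
      [] \<Rightarrow> put i 0 c
    | x # xs \<Rightarrow> (put i x c)\<lparr>inp := xs\<rparr>)"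
| "exec_instr (Print i) c = c\<lparr>pc := Suc (pc c), outp := outp c @ [reg c i]\<rparr>"

fun accessed :: "instr \<Rightarrow> config \<Rightarrow> nat set" where
  "accessed (Const i x) c = {i}"
| "accessed (Add i j k) c = {i, j, k}"
| "accessed (Sub i j k) c = {i, j, k}"
| "accessed (And i j k) c = {i, j, k}"
| "accessed (Or i j k) c = {i, j, k}"
| "accessed (Load i j) c = {i, j, reg c j}"
| "accessed (Store i j) c = {i, j, reg c i}"
| "accessed (Jump_pos i l) c = {i}"
| "accessed (Read i) c = {i}"
| "accessed (Print i) c = {i}"

definition halted :: "program \<Rightarrow> config \<Rightarrow> bool" where
  "halted P c \<longleftrightarrow> length P \<le> pc c"

definition step :: "program \<Rightarrow> config \<Rightarrow> config" where
  "step P c = (if halted P c then c else exec_instr (P ! pc c) c)"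

definition start :: "nat list \<Rightarrow> config" where
  "start xs = \<lparr>pc = 0, reg = (\<lambda>_. 0), inp = xs, outp = []\<rparr>"

definition config_after :: "program \<Rightarrow> nat list \<Rightarrow> nat \<Rightarrow> config" where
  "config_after P xs k = (step P ^^ k) (start xs)"

text \<open>
  On input \<open>xs\<close> the program halts with output \<open>ys\<close> after at most \<open>T\<close> steps, while using only the
  registers \<open>0, \<dots>, s - 1\<close> and storing in them only words of \<open>w\<close> bits. Since register indices
  occurring in an indirect access are themselves words, all of memory is addressable by words.
  The space consumed is \<open>s * w\<close> bits; the two tapes are not counted.
\<close>

definition computes_within ::
    "program \<Rightarrow> nat \<Rightarrow> nat \<Rightarrow> nat \<Rightarrow> nat list \<Rightarrow> nat list \<Rightarrow> bool" where
  "computes_within P w s T xs ys \<longleftrightarrow>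
     halted P (config_after P xs T) \<and>
     outp (config_after P xs T) = ys \<and>
     (\<forall>k \<le> T. \<not> halted P (config_after P xs k) \<longrightarrow>
        accessed (P ! pc (config_after P xs k)) (config_after P xs k) \<subseteq> {..<s}) \<and>
     (\<forall>k \<le> T. \<forall>i. reg (config_after P xs k) i < 2 ^ w)"


section \<open>Encodings\<close>

text \<open>
  The vertices of an input graph are numbered \<open>0, \<dots>, n - 1\<close>. The input consists of the number of
  vertices followed by the adjacency matrix in row-major order, one entry per word.
\<close>

definition encode_graph :: "nat \<Rightarrow> nat set set \<Rightarrow> nat list" where
  "encode_graph n E = n # [(if {i, j} \<in> E then 1 else 0). i \<leftarrow> [0..<n], j \<leftarrow> [0..<n]]"

text \<open>Trees are written in preorder; \<open>0\<close> marks an internal node.\<close>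

fun encode_dtree :: "nat dtree \<Rightarrow> nat list" where
  "encode_dtree (Leaf v) = [Suc v]"
| "encode_dtree (Node l r) = 0 # encode_dtree l @ encode_dtree r"

lemma encode_dtree_append_inject:
  "encode_dtree t @ xs = encode_dtree t' @ ys \<Longrightarrow> t = t' \<and> xs = ys"
proof (induction t arbitrary: t' xs ys)
  case (Leaf v)
  then show ?case by (cases t') auto
next
  case (Node l r)
  show ?case
  proof (cases t')
    case (Leaf v)
    then show ?thesis using Node.prems by simp
  next
    case (Node l' r')
    then have "encode_dtree l @ (encode_dtree r @ xs) = encode_dtree l' @ (encode_dtree r' @ ys)"
      using Node.prems by simp
    then show ?thesis
      using Node Node.IH by blast
  qed
qed

lemma inj_encode_dtree: "inj encode_dtree"
  using encode_dtree_append_inject[of _ "[]" _ "[]"] by (auto simp: inj_def)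

end

theory Submission
  imports Defs
begin

text \<open>
  A linear decomposition is a caterpillar, so apart from its leaves, whose cuts occur in every
  decomposition, it amounts to a chain of vertex sets growing one vertex at a time, and the width
  is governed by the largest number of neighbourhood unions along the chain. Write \<open>c A\<close> for the
  number of unions at the cut \<open>A\<close>. The program evaluates the recursion
  \<open>val A = max (c A) (min\<^sub>v val (A - {v}))\<close> over all bit-encoded sets \<open>A\<close> in numerical order, with
  all values truncated at \<open>K + 1\<close>, for \<open>K = 1, 2, 4, \<dots>\<close> until \<open>val V \<le> K\<close>. The number \<open>c A\<close> is found
  by listing the unions, adding the vertices of \<open>A\<close> one at a time, with a table of marks indexed by
  all words detecting repetitions; the listing stops at \<open>K + 1\<close> entries and therefore costs
  \<open>O(n K)\<close> steps and no more than \<open>O(2^n)\<close> words, which are reused for every \<open>A\<close>. Since the last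
  \<open>K\<close> is at most twice the optimum, the geometric sum over \<open>K\<close> gives \<open>O(n 2^(n + lbw))\<close> steps besides
  the \<open>O(n^2)\<close> for input and output.
\<close>

section \<open>Linear decompositions and chains of cuts\<close>

text \<open>The running time is to be bounded in terms of the optimum, which is unknown in advance,
  while a vertex set off the optimal chain may have far more neighbourhood unions than the optimum.
  Counting to the end at every set could therefore exceed the bound; truncation makes such sets
  cheap, and doubling replaces the unknown threshold. For the same reason the marks are erased along
  the list of unions found: wiping all \<open>2 ^ n\<close> cells for each of the
  \<open>2 ^ n\<close> sets would square the exponential. Correctness never speaks of exact minima:
  a truncated value is described by the thresholds \<open>M \<le> K\<close> that it meets, and these
  are matched with the predicate \<open>reach\<close>. To obtain time, space and word length from
  one argument, the program is written in a small structured language whose triples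
  \<open>ok\<close> carry a step bound, and whose primitives have side conditions that keep
  addresses and values within range.\<close>

definition cut_unions :: "'a set set \<Rightarrow> 'a set \<Rightarrow> 'a set \<Rightarrow> 'a set set" where
  "cut_unions E C Y = {(\<Union>x\<in>X. nbhd E x) \<inter> C | X. X \<subseteq> Y}"

definition cut_card :: "'a set \<Rightarrow> 'a set set \<Rightarrow> 'a set \<Rightarrow> nat" where
  "cut_card V E A = card (nbhd_unions V E A)"

text \<open>\<open>cut_unions\<close> keeps the far side \<open>C\<close> fixed while the vertex set
  \<open>Y\<close> grows. In \<open>nbhd_unions\<close> the far side would shrink along with it,
  which does not fit a listing that adds vertices one at a time.\<close>

lemma nbhd_unions_eq: "nbhd_unions V E A = cut_unions E (V - A) A"
  by (simp add: nbhd_unions_def cut_unions_def)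

lemma cut_unions_empty [simp]: "cut_unions E C {} = {{}}"
  by (auto simp: cut_unions_def)

text \<open>A selection either omits \<open>v\<close> or arises from one omitting \<open>v\<close>
  by joining the neighbours of \<open>v\<close>. This recurrence is what one merge pass over the
  list computes.\<close>

lemma cut_unions_insert:
  "cut_unions E C (insert v Y) =
    cut_unions E C Y \<union> (\<lambda>S. S \<union> (nbhd E v \<inter> C)) ` cut_unions E C Y"
proof (intro equalityI subsetI)
  fix S
  assume "S \<in> cut_unions E C (insert v Y)"
  then obtain X where X: "X \<subseteq> insert v Y" "S = (\<Union>x\<in>X. nbhd E x) \<inter> C"
    by (auto simp: cut_unions_def)
  show "S \<in> cut_unions E C Y \<union> (\<lambda>S. S \<union> (nbhd E v \<inter> C)) ` cut_unions E C Y"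
  proof (cases "v \<in> X")
    case True
    have "(\<Union>x\<in>X - {v}. nbhd E x) \<inter> C \<in> cut_unions E C Y"
      unfolding cut_unions_def using X(1) by blast
    moreover have "S = (\<Union>x\<in>X - {v}. nbhd E x) \<inter> C \<union> (nbhd E v \<inter> C)"
      using X(2) True by auto
    ultimately show ?thesis by blast
  next
    case False
    then show ?thesis
      using X by (auto simp: cut_unions_def)
  qed
next
  fix S
  assume "S \<in> cut_unions E C Y \<union> (\<lambda>S. S \<union> (nbhd E v \<inter> C)) ` cut_unions E C Y"
  then obtain X where X: "X \<subseteq> Y"
    and "S = (\<Union>x\<in>X. nbhd E x) \<inter> C \<or> S = (\<Union>x\<in>insert v X. nbhd E x) \<inter> C"
    by (auto simp: cut_unions_def)
  then show "S \<in> cut_unions E C (insert v Y)"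
    unfolding cut_unions_def by (blast intro: order_trans)
qed

lemma cut_unions_subset_Pow: "cut_unions E C Y \<subseteq> Pow C"
  by (auto simp: cut_unions_def)

lemma finite_nbhd_unions: "finite V \<Longrightarrow> finite (nbhd_unions V E A)"
  unfolding nbhd_unions_eq
  by (rule finite_subset[OF cut_unions_subset_Pow]) simp

lemma cut_card_pos: "finite V \<Longrightarrow> 0 < cut_card V E A"
  using finite_nbhd_unions[of V E A]
  by (auto simp: cut_card_def card_gt_0_iff nbhd_unions_def)

lemma cut_card_le: "finite V \<Longrightarrow> cut_card V E A \<le> 2 ^ card V"
  unfolding cut_card_def nbhd_unions_eq
  by (rule order_trans[OF card_mono[OF _ cut_unions_subset_Pow]])
    (simp_all add: card_Pow card_mono)

section \<open>Chains of vertex sets with bounded cuts\<close>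

inductive reach :: "'a set \<Rightarrow> 'a set set \<Rightarrow> nat \<Rightarrow> 'a set \<Rightarrow> bool" for V E M where
  reach_empty: "reach V E M {}"
| reach_insert: "reach V E M S \<Longrightarrow> v \<in> V - S \<Longrightarrow> cut_card V E (insert v S) \<le> M \<Longrightarrow>
    reach V E M (insert v S)"

text \<open>At threshold \<open>M\<close> this is the recursion for \<open>val\<close>: the vertex
  removed is the last one of the chain. The empty set is reached at every \<open>M\<close>, as no
  node of a tree carries it.\<close>

lemma reach_iff:
  assumes "S \<noteq> {}" "S \<subseteq> V"
  shows "reach V E M S \<longleftrightarrow> cut_card V E S \<le> M \<and> (\<exists>v\<in>S. reach V E M (S - {v}))"
proof
  assume "reach V E M S"
  then show "cut_card V E S \<le> M \<and> (\<exists>v\<in>S. reach V E M (S - {v}))"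
    using assms(1) by cases auto
next
  assume *: "cut_card V E S \<le> M \<and> (\<exists>v\<in>S. reach V E M (S - {v}))"
  then obtain v where "v \<in> S" "reach V E M (S - {v})" by blast
  moreover have "insert v (S - {v}) = S"
    using \<open>v \<in> S\<close> by blast
  ultimately show "reach V E M S"
    using reach_insert[of V E M "S - {v}" v] * assms(2) by auto
qed

lemma reach_mono: "reach V E M S \<Longrightarrow> M \<le> M' \<Longrightarrow> reach V E M' S"
  by (induction rule: reach.induct) (auto intro: reach.intros)

text \<open>Vertices may be added in any order, since no cut has more than \<open>2 ^ card V\<close>
  unions. This makes the doubling terminate.\<close>

lemma reach_max:
  assumes "finite V"
  shows "reach V E (2 ^ card V) V"
proof -
  have "finite S \<Longrightarrow> S \<subseteq> V \<Longrightarrow> reach V E (2 ^ card V) S" for S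
  proof (induction S rule: finite_induct)
    case (insert v S)
    then show ?case
      using cut_card_le[OF assms] by (intro reach_insert) auto
  qed (simp add: reach_empty)
  then show ?thesis
    using assms by blast
qed

text \<open>At each internal node one child is a leaf, so the node's set is that of the other child
  plus one vertex: the spine of the tree is a chain.\<close>

lemma reach_linear_decomposition:
  assumes "\<forall>l r. Node l r \<in> subtrees t \<longrightarrow> is_leaf l \<or> is_leaf r"
    and "distinct (leaves t)" "set (leaves t) \<subseteq> V"
    and "\<And>u. u \<in> subtrees t \<Longrightarrow> cut_card V E (set (leaves u)) \<le> M"
  shows "reach V E M (set (leaves t))"
  using assms
proof (induction t)
  case (Leaf v)
  then show ?case
    using reach_insert[OF reach_empty, of v V E M] by auto
next
  case (Node l r)
  have top: "cut_card V E (set (leaves (Node l r))) \<le> M"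
    by (rule Node.prems) simp
  have "is_leaf l \<or> is_leaf r"
    using Node.prems(1) by simp
  then show ?case
  proof
    assume "is_leaf l"
    then obtain v where l: "l = Leaf v"
      by (cases l) auto
    have "reach V E M (set (leaves r))"
      by (rule Node.IH(2)) (use Node.prems in auto)
    then show ?thesis
      using reach_insert[of V E M "set (leaves r)" v] top Node.prems l by auto
  next
    assume "is_leaf r"
    then obtain v where r: "r = Leaf v"
      by (cases r) auto
    have "reach V E M (set (leaves l))"
      by (rule Node.IH(1)) (use Node.prems in auto)
    then show ?thesis
      using reach_insert[of V E M "set (leaves l)" v] top Node.prems r by auto
  qed
qed

section \<open>Caterpillars: from a chain back to a decomposition\<close>

fun caterpillar :: "'a list \<Rightarrow> 'a dtree" where
  "caterpillar [] = undefined"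
| "caterpillar [v] = Leaf v"
| "caterpillar (v # w # vs) = Node (Leaf v) (caterpillar (w # vs))"

lemma leaves_caterpillar: "vs \<noteq> [] \<Longrightarrow> leaves (caterpillar vs) = vs"
  by (induction vs rule: caterpillar.induct) auto

lemma caterpillar_linear:
  "vs \<noteq> [] \<Longrightarrow> Node l r \<in> subtrees (caterpillar vs) \<Longrightarrow> is_leaf l"
  by (induction vs rule: caterpillar.induct) auto

text \<open>The sets at the nodes are thus singletons and the sets of suffixes of \<open>vs\<close>;
  only the suffixes form the chain.\<close>

lemma subtrees_caterpillar:
  "vs \<noteq> [] \<Longrightarrow> u \<in> subtrees (caterpillar vs) \<Longrightarrow>
    (\<exists>v\<in>set vs. u = Leaf v) \<or> (\<exists>k<length vs. u = caterpillar (drop k vs))"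
proof (induction vs rule: caterpillar.induct)
  case (3 v w vs)
  then consider "u = caterpillar (drop 0 (v # w # vs))" | "u = Leaf v" | "u \<in> subtrees (caterpillar (w # vs))"
    by auto
  then show ?case
  proof cases
    case 3
    then consider "\<exists>v\<in>set (w # vs). u = Leaf v"
      | k where "k < length (w # vs)" "u = caterpillar (drop k (w # vs))"
      using "3.IH" by blast
    then show ?thesis
    proof cases
      case 2
      then have "Suc k < length (v # w # vs) \<and> u = caterpillar (drop (Suc k) (v # w # vs))"
        by simp
      then show ?thesis by blast
    qed auto
  qed force+
qed auto

text \<open>Every vertex but the last contributes the marker of an internal node and a leaf. The
  encoding can therefore be printed while the order is still being found, without storing a
  tree.\<close>

lemma encode_caterpillar:
  "encode_dtree (caterpillar (vs @ [v])) = concat (map (\<lambda>u. [0, Suc u]) vs) @ [Suc v]"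
proof (induction vs)
  case (Cons u us)
  then show ?case by (cases us) auto
qed simp

lemma leaf_in_subtrees: "v \<in> set (leaves t) \<Longrightarrow> Leaf v \<in> subtrees t"
  by (induction t) auto

lemma booldim_le_boolwidth: "u \<in> subtrees t \<Longrightarrow> booldim V E (set (leaves u)) \<le> boolwidth V E t"
  unfolding boolwidth_def by (intro Max_ge) (simp_all add: subtrees_finite_nonempty)

text \<open>\<open>W\<close> separates the two sides: it bounds every suffix cut of the caterpillar,
  and as the least reachable threshold it is at most the largest cut of any linear decomposition.
  The last claim passes the integer \<open>W\<close> on to the time bound.\<close>

lemma caterpillar_optimal:
  assumes "finite V" "V \<noteq> {}" and vs: "distinct vs" "set vs = V"
    and cuts: "\<And>k. k < length vs \<Longrightarrow> cut_card V E (set (drop k vs)) \<le> W"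
    and least: "\<And>M. reach V E M V \<Longrightarrow> W \<le> M"
  shows "linear_decomposition V (caterpillar vs)"
    and "boolwidth V E (caterpillar vs) = lbw V E"
    and "real W \<le> 2 powr lbw V E"
proof -
  have ne: "vs \<noteq> []"
    using assms(2) vs by auto
  show lin: "linear_decomposition V (caterpillar vs)"
    using vs ne caterpillar_linear[OF ne]
    by (auto simp: linear_decomposition_def decomposition_def leaves_caterpillar)
  have "0 < W"
    using cuts[of 0] cut_card_pos[OF assms(1), of E "set (drop 0 vs)"] ne by simp
  \<comment> \<open>The largest cut of \<open>t\<close> is itself a threshold at which
    \<open>V\<close> is reached, so minimality of \<open>W\<close> applies to it.\<close>
  have W: "log 2 (real W) \<le> boolwidth V E t" if t: "linear_decomposition V t" for t
  proof -
    let ?C = "(\<lambda>u. cut_card V E (set (leaves u))) ` subtrees t"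
    have fin: "finite ?C" "?C \<noteq> {}"
      using subtrees_finite_nonempty by auto
    have "reach V E (Max ?C) (set (leaves t))"
      using t fin by (intro reach_linear_decomposition)
        (auto simp: linear_decomposition_def decomposition_def)
    then have "W \<le> Max ?C"
      using t least by (simp add: linear_decomposition_def decomposition_def)
    moreover obtain u where u: "u \<in> subtrees t" "Max ?C = cut_card V E (set (leaves u))"
      using Max_in[OF fin] by auto
    ultimately have "log 2 (real W) \<le> booldim V E (set (leaves u))"
      using \<open>0 < W\<close> by (simp add: booldim_def cut_card_def)
    then show ?thesis
      using booldim_le_boolwidth[OF u(1), of V E] by linarith
  qed
  have opt: "boolwidth V E (caterpillar vs) \<le> boolwidth V E t" if t: "linear_decomposition V t" for t
  proof -
    have "booldim V E (set (leaves u)) \<le> boolwidth V E t" if "u \<in> subtrees (caterpillar vs)" for u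
      using subtrees_caterpillar[OF ne that]
    proof (elim disjE bexE exE conjE)
      \<comment> \<open>A leaf of the caterpillar is also a leaf of \<open>t\<close>, since both
        trees carry all of \<open>V\<close>; its cut is compared with \<open>t\<close> directly
        rather than through \<open>W\<close>.\<close>
      fix v
      assume "v \<in> set vs" "u = Leaf v"
      then show ?thesis
        using t vs by (intro booldim_le_boolwidth)
          (auto simp: linear_decomposition_def decomposition_def intro: leaf_in_subtrees)
    next
      fix k
      assume k: "k < length vs" "u = caterpillar (drop k vs)"
      then have "cut_card V E (set (leaves u)) \<le> W"
        using cuts by (simp add: leaves_caterpillar)
      then have "booldim V E (set (leaves u)) \<le> log 2 (real W)"
        using cut_card_pos[OF assms(1), of E "set (leaves u)"] by (simp add: booldim_def cut_card_def)
      then show ?thesis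
        using W[OF t] by linarith
    qed
    then show ?thesis
      unfolding boolwidth_def[of V E "caterpillar vs"]
      by (intro Max.boundedI) (auto simp: subtrees_finite_nonempty)
  qed
  show eq: "boolwidth V E (caterpillar vs) = lbw V E"
    unfolding lbw_def using lin opt finite_linear_decompositions[OF assms(1)]
    by (intro Min_eqI[symmetric]) auto
  show "real W \<le> 2 powr lbw V E"
    using W[OF lin] \<open>0 < W\<close> eq by (simp add: log_le_iff)
qed

section \<open>Sets of vertices as words\<close>

abbreviation bits :: "nat \<Rightarrow> nat set" where
  "bits a \<equiv> {i. bit a i}"

lemma bits_inject: "bits a = bits b \<longleftrightarrow> a = b"
  by (auto simp: bit_eq_iff)

lemma bits_and: "bits (Bit_Operations.and a b) = bits a \<inter> bits b"
  by (auto simp: bit_and_iff)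

lemma bits_or: "bits (Bit_Operations.or a b) = bits a \<union> bits b"
  by (auto simp: bit_or_iff)

lemma bits_subset_iff: "bits a \<subseteq> {..<n} \<longleftrightarrow> a < 2 ^ n"
proof -
  have "take_bit n a = a \<longleftrightarrow> bits a \<subseteq> {..<n}"
    by (auto simp: bit_eq_iff bit_take_bit_iff)
  then show ?thesis
    by (simp add: take_bit_nat_eq_self_iff)
qed

lemma bits_power: "bits (2 ^ i) = {i}"
  by (auto simp: bit_exp_iff)

lemma bits_full: "bits (2 ^ n - 1) = {..<n}"
  using bit_mask_iff[of n, where 'a = nat] by (auto simp: mask_eq_exp_minus_1)

lemma bits_add:
  assumes "bits a \<inter> bits b = {}"
  shows "bits (a + b) = bits a \<union> bits b"
proof -
  have "Bit_Operations.and a b = 0"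
    using assms bits_inject[of "Bit_Operations.and a b" 0] by (simp add: bits_and)
  then show ?thesis
    by (simp add: disjunctive_add_eq_or bits_or)
qed

text \<open>When \<open>b\<close> encodes a subset of \<open>a\<close> no borrow occurs, because
  adding the exclusive or of both to \<open>b\<close> is a disjoint sum that gives back
  \<open>a\<close>. The machine has neither exclusive or nor complement, so subtraction supplies
  both the removal of a vertex and the complement \<open>N - 1 - a\<close>.\<close>

lemma bits_diff:
  assumes "bits b \<subseteq> bits a"
  shows "bits (a - b) = bits a - bits b"
proof -
  define c where "c = Bit_Operations.xor a b"
  have c: "bits c = bits a - bits b"
    using assms by (auto simp: c_def bit_xor_iff)
  then have "bits (b + c) = bits a"
    using assms by (subst bits_add) auto
  then have "a - b = c"
    using bits_inject[of "b + c" a] by simp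
  then show ?thesis
    using c by simp
qed

lemma and_power_eq_0_iff: "Bit_Operations.and (2 ^ i) (a :: nat) = 0 \<longleftrightarrow> \<not> bit a i"
  using bits_inject[of "Bit_Operations.and (2 ^ i) a" 0] by (auto simp: bits_and bits_power)

lemma bits_remove: "bit a i \<Longrightarrow> bits (a - 2 ^ i) = bits a - {i}"
  by (subst bits_diff) (auto simp: bits_power)

section \<open>A structured language for the word RAM\<close>

inductive run :: "program \<Rightarrow> nat \<Rightarrow> nat \<Rightarrow> config \<Rightarrow> nat \<Rightarrow> config \<Rightarrow> bool"
  for P w s where
  run_0: "(\<And>i. reg c i < 2 ^ w) \<Longrightarrow> run P w s c 0 c"
| run_Suc: "(\<And>i. reg c i < 2 ^ w) \<Longrightarrow> pc c < length P \<Longrightarrow>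
    accessed (P ! pc c) c \<subseteq> {..<s} \<Longrightarrow>
    run P w s (exec_instr (P ! pc c) c) k c' \<Longrightarrow> run P w s c (Suc k) c'"

lemma run_trans:
  "run P w s c k c' \<Longrightarrow> run P w s c' l c'' \<Longrightarrow> run P w s c (k + l) c''"
  by (induction rule: run.induct) (auto intro: run_Suc)

text \<open>The final configuration is halted, so nothing is accessed there; every earlier one is
  covered by the rule for a genuine step.\<close>

lemma run_safe:
  assumes "run P w s c k c'" "halted P c'"
  shows "(step P ^^ k) c = c' \<and> (\<forall>j\<le>k. (\<forall>i. reg ((step P ^^ j) c) i < 2 ^ w) \<and>
    (\<not> halted P ((step P ^^ j) c) \<longrightarrow>
      accessed (P ! pc ((step P ^^ j) c)) ((step P ^^ j) c) \<subseteq> {..<s}))"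
  using assms
proof (induction rule: run.induct)
  case (run_0 c)
  then show ?case by simp
next
  case (run_Suc c k c')
  have st: "step P c = exec_instr (P ! pc c) c"
    using run_Suc by (simp add: step_def halted_def)
  show ?case
  proof (intro conjI allI impI)
    show "(step P ^^ Suc k) c = c'"
      using run_Suc st by (simp add: funpow_Suc_right del: funpow.simps)
  next
    fix j i
    assume "j \<le> Suc k"
    then show "reg ((step P ^^ j) c) i < 2 ^ w"
      using run_Suc st by (cases j) (simp_all add: funpow_Suc_right del: funpow.simps(2))
  next
    fix j
    assume "j \<le> Suc k" "\<not> halted P ((step P ^^ j) c)"
    then show "accessed (P ! pc ((step P ^^ j) c)) ((step P ^^ j) c) \<subseteq> {..<s}"
      using run_Suc st by (cases j) (simp_all add: funpow_Suc_right del: funpow.simps(2))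
  qed
qed

lemma run_computes_within:
  assumes "run P w s (start xs) T c" "halted P c"
  shows "computes_within P w s T xs (outp c)"
  using run_safe[OF assms] assms(2) unfolding computes_within_def config_after_def by blast

fun code_at :: "program \<Rightarrow> nat \<Rightarrow> program \<Rightarrow> bool" where
  "code_at P p [] \<longleftrightarrow> True"
| "code_at P p (x # xs) \<longleftrightarrow> p < length P \<and> P ! p = x \<and> code_at P (Suc p) xs"

lemma code_at_append:
  "code_at P p (xs @ ys) \<longleftrightarrow> code_at P p xs \<and> code_at P (p + length xs) ys"
  by (induction xs arbitrary: p) auto

lemma code_at_self: "code_at (xs @ ys) (length xs) ys"
proof (induction ys arbitrary: xs)
  case (Cons y ys)
  then show ?case using Cons.IH[of "xs @ [y]"] by simp
qed simp

section \<open>Primitive operations on variables and arrays\<close>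

datatype prim =
    PSet nat nat
  | PAdd nat nat nat
  | PSub nat nat nat
  | PAnd nat nat nat
  | POr nat nat nat
  | PGet nat nat nat
  | PUpd nat nat nat
  | PIn nat
  | POut nat

record state =
  vr :: "nat \<Rightarrow> nat"
  ar :: "nat \<Rightarrow> nat \<Rightarrow> nat"
  inq :: "nat list"
  outq :: "nat list"

text \<open>
  Memory layout: registers 0 and 1 are scratch, variable \<open>x\<close> lives in register \<open>x + 2\<close>, and four
  arrays are interleaved with stride 4 from register 30 on, so that all addresses are known
  statically and no base address depends on \<open>n\<close>.
\<close>

abbreviation (input) num_vars :: nat where "num_vars \<equiv> 28"

definition cell :: "nat \<Rightarrow> nat \<Rightarrow> nat" where
  "cell a i = 30 + a + 4 * i"

fun prim_exec :: "prim \<Rightarrow> state \<Rightarrow> state" where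
  "prim_exec (PSet x k) \<sigma> = \<sigma>\<lparr>vr := (vr \<sigma>)(x := k)\<rparr>"
| "prim_exec (PAdd x y z) \<sigma> = \<sigma>\<lparr>vr := (vr \<sigma>)(x := vr \<sigma> y + vr \<sigma> z)\<rparr>"
| "prim_exec (PSub x y z) \<sigma> = \<sigma>\<lparr>vr := (vr \<sigma>)(x := vr \<sigma> y - vr \<sigma> z)\<rparr>"
| "prim_exec (PAnd x y z) \<sigma> = \<sigma>\<lparr>vr := (vr \<sigma>)(x := Bit_Operations.and (vr \<sigma> y) (vr \<sigma> z))\<rparr>"
| "prim_exec (POr x y z) \<sigma> = \<sigma>\<lparr>vr := (vr \<sigma>)(x := Bit_Operations.or (vr \<sigma> y) (vr \<sigma> z))\<rparr>"
| "prim_exec (PGet x a y) \<sigma> = \<sigma>\<lparr>vr := (vr \<sigma>)(x := ar \<sigma> a (vr \<sigma> y))\<rparr>"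
| "prim_exec (PUpd a y x) \<sigma> = \<sigma>\<lparr>ar := (ar \<sigma>)(a := (ar \<sigma> a)(vr \<sigma> y := vr \<sigma> x))\<rparr>"
| "prim_exec (PIn x) \<sigma> = \<sigma>\<lparr>vr := (vr \<sigma>)(x := hd (inq \<sigma>)), inq := tl (inq \<sigma>)\<rparr>"
| "prim_exec (POut x) \<sigma> = \<sigma>\<lparr>outq := outq \<sigma> @ [vr \<sigma> x]\<rparr>"

text \<open>The default case covers subtraction, the bitwise operations and output, which lead from
  words to words. An empty input is excluded because the machine then reads zero, while
  \<open>hd []\<close> is unspecified.\<close>

fun prim_ok :: "nat \<Rightarrow> nat \<Rightarrow> prim \<Rightarrow> state \<Rightarrow> bool" where
  "prim_ok w N (PSet x k) \<sigma> \<longleftrightarrow> k < 2 ^ w"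
| "prim_ok w N (PAdd x y z) \<sigma> \<longleftrightarrow> vr \<sigma> y + vr \<sigma> z < 2 ^ w"
| "prim_ok w N (PGet x a y) \<sigma> \<longleftrightarrow> vr \<sigma> y < N"
| "prim_ok w N (PUpd a y x) \<sigma> \<longleftrightarrow> vr \<sigma> y < N"
| "prim_ok w N (PIn x) \<sigma> \<longleftrightarrow> inq \<sigma> \<noteq> [] \<and> hd (inq \<sigma>) < 2 ^ w"
| "prim_ok w N _ \<sigma> \<longleftrightarrow> True"

fun prim_wf :: "prim \<Rightarrow> bool" where
  "prim_wf (PSet x k) \<longleftrightarrow> x < num_vars"
| "prim_wf (PAdd x y z) \<longleftrightarrow> x < num_vars \<and> y < num_vars \<and> z < num_vars"
| "prim_wf (PSub x y z) \<longleftrightarrow> x < num_vars \<and> y < num_vars \<and> z < num_vars"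
| "prim_wf (PAnd x y z) \<longleftrightarrow> x < num_vars \<and> y < num_vars \<and> z < num_vars"
| "prim_wf (POr x y z) \<longleftrightarrow> x < num_vars \<and> y < num_vars \<and> z < num_vars"
| "prim_wf (PGet x a y) \<longleftrightarrow> x < num_vars \<and> a < 4 \<and> y < num_vars"
| "prim_wf (PUpd a y x) \<longleftrightarrow> x < num_vars \<and> a < 4 \<and> y < num_vars"
| "prim_wf (PIn x) \<longleftrightarrow> x < num_vars"
| "prim_wf (POut x) \<longleftrightarrow> x < num_vars"

fun prim_code :: "prim \<Rightarrow> program" where
  "prim_code (PSet x k) = [Const (x + 2) k]"
| "prim_code (PAdd x y z) = [Add (x + 2) (y + 2) (z + 2)]"
| "prim_code (PSub x y z) = [Sub (x + 2) (y + 2) (z + 2)]"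
| "prim_code (PAnd x y z) = [And (x + 2) (y + 2) (z + 2)]"
| "prim_code (POr x y z) = [Or (x + 2) (y + 2) (z + 2)]"
| "prim_code (PGet x a y) =
    [Add 0 (y + 2) (y + 2), Add 0 0 0, Const 1 (30 + a), Add 0 1 0, Load (x + 2) 0]"
| "prim_code (PUpd a y x) =
    [Add 0 (y + 2) (y + 2), Add 0 0 0, Const 1 (30 + a), Add 0 1 0, Store 0 (x + 2)]"
| "prim_code (PIn x) = [Read (x + 2)]"
| "prim_code (POut x) = [Print (x + 2)]"

text \<open>Registers 0 and 1 are constrained only in size, which makes them scratch. Cells are
  related at every index; it is \<open>prim_ok\<close> that confines accesses to indices below
  \<open>N\<close>.\<close>

definition represents :: "nat \<Rightarrow> state \<Rightarrow> config \<Rightarrow> bool" where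
  "represents w \<sigma> c \<longleftrightarrow> (\<forall>x<num_vars. reg c (x + 2) = vr \<sigma> x) \<and> (\<forall>a<4. \<forall>i. reg c (cell a i) = ar \<sigma> a i) \<and>
     inp c = inq \<sigma> \<and> outp c = outq \<sigma> \<and> (\<forall>i. reg c i < 2 ^ w)"

lemma cell_inject: "a < 4 \<Longrightarrow> b < 4 \<Longrightarrow> cell a i = cell b j \<longleftrightarrow> a = b \<and> i = j"
  unfolding cell_def by presburger

lemma cell_neq_var: "x < num_vars \<Longrightarrow> cell a i \<noteq> x + 2" "cell a i \<noteq> 0" "cell a i \<noteq> Suc 0"
   "x < num_vars \<Longrightarrow> cell a i \<noteq> Suc (Suc x)"
  by (auto simp: cell_def)

lemma or_nat_less: "(a::nat) < 2 ^ w \<Longrightarrow> b < 2 ^ w \<Longrightarrow> Bit_Operations.or a b < 2 ^ w"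
  by (metis take_bit_nat_eq_self_iff take_bit_or)

lemma and_nat_less: "(a::nat) < 2 ^ w \<Longrightarrow> Bit_Operations.and a b < 2 ^ w"
  by (metis and.commute and.left_commute take_bit_eq_mask take_bit_nat_eq_self_iff)

text \<open>An array access computes \<open>30 + a + 4 * i\<close> by two doublings and one
  addition, and \<open>fits\<close> makes this address a word. All other primitives are single
  instructions and are settled by the local fact \<open>one\<close>.\<close>

lemma prim_correct:
  assumes fits: "30 + 4 * N \<le> 2 ^ w"
    and at: "code_at P p (prim_code q)" and "prim_wf q" and "prim_ok w N q \<sigma>"
    and "pc c = p" and rel: "represents w \<sigma> c"
  shows "\<exists>c'. run P w (30 + 4 * N) c (length (prim_code q)) c' \<and>
    pc c' = p + length (prim_code q) \<and> represents w (prim_exec q \<sigma>) c'"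
proof -
  let ?s = "30 + 4 * N"
  have words: "reg c i < 2 ^ w" for i
    using rel by (simp add: represents_def)
  have vars: "reg c (Suc (Suc x)) = vr \<sigma> x" if "x < num_vars" for x
    using rel that by (simp add: represents_def)
  have vwords: "vr \<sigma> x < 2 ^ w" if "x < num_vars" for x
    using vars[OF that] words[of "Suc (Suc x)"] by simp
  have cells: "reg c (cell a i) = ar \<sigma> a i" if "a < 4" for a i
    using rel that by (simp add: represents_def)
  have io: "inp c = inq \<sigma>" "outp c = outq \<sigma>"
    using rel by (simp_all add: represents_def)
  have small: "Suc (Suc x) < ?s" if "x < num_vars" for x
    using that by simp
  have one: ?thesis
    if "prim_code q = [ins]" "accessed ins c \<subseteq> {..<?s}" "pc (exec_instr ins c) = Suc p"
      "represents w (prim_exec q \<sigma>) (exec_instr ins c)" for ins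
    using that assms(5) at words by (intro exI[of _ "exec_instr ins c"])
      (auto intro!: run.intros simp: represents_def)
  show ?thesis
  proof (cases q)
    case (PSet x k)
    then show ?thesis
      using assms io words vwords small by (intro one, force) (auto simp: put_def represents_def cell_neq_var)
  next
    case (PAdd x y z)
    then show ?thesis
      using assms io words vwords small by (intro one, force) (auto simp: put_def represents_def cell_neq_var)
  next
    case (PSub x y z)
    then show ?thesis
      using assms io words vwords small
      by (intro one, force) (auto simp: put_def represents_def cell_neq_var less_imp_diff_less)
  next
    case (PAnd x y z)
    then show ?thesis
      using assms io words vwords small
      by (intro one, force) (auto simp: put_def represents_def cell_neq_var intro: and_nat_less)
  next
    case (POr x y z)
    then show ?thesis
      using assms io words vwords small
      by (intro one, force) (auto simp: put_def represents_def cell_neq_var intro: or_nat_less)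
  next
    case (PIn x)
    then show ?thesis
      using assms io words vwords small
      by (intro one, force) (auto simp: put_def represents_def cell_neq_var split: list.splits)
  next
    case (POut x)
    then show ?thesis
      using assms io words vwords small by (intro one, force) (auto simp: put_def represents_def cell_neq_var)
  next
    case (PGet x a y)
    define i where "i = vr \<sigma> y"
    have b: "x < num_vars" "a < 4" "y < num_vars" "i < N"
      using assms PGet by (auto simp: i_def)
    have r: "reg c (Suc (Suc y)) = i"
      using b vars by (simp add: i_def)
    have cell: "30 + a + (i + i + (i + i)) = cell a i"
      by (simp add: cell_def)
    have bounds: "cell a i < ?s" "cell a i < 2 ^ w" "cell a i > 1"
      "i + i < 2 ^ w" "i + i + (i + i) < 2 ^ w" "30 + a < 2 ^ w"
      using b fits by (auto simp: cell_def)
    let ?c = "c\<lparr>pc := Suc (Suc (Suc (Suc (Suc p)))), reg := (reg c)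
      (Suc 0 := 30 + a, 0 := cell a i, Suc (Suc x) := ar \<sigma> a i)\<rparr>"
    have val: "ar \<sigma> a i < 2 ^ w"
      using words[of "cell a i"] cells[OF b(2), of i] by simp
    have "run P w ?s c (Suc (Suc (Suc (Suc (Suc 0))))) ?c"
      using at PGet assms(5) b val words bounds cells[OF b(2), of i]
      by (intro run_Suc) (auto simp: put_def r cell small intro!: run_0)
    moreover have "represents w (prim_exec q \<sigma>) ?c"
      using rel PGet b val words bounds
      by (auto simp: represents_def cell_neq_var i_def)
    ultimately show ?thesis
      using PGet by (auto simp: numeral_eq_Suc)
  next
    case (PUpd a y x)
    define i where "i = vr \<sigma> y"
    have b: "x < num_vars" "a < 4" "y < num_vars" "i < N"
      using assms PUpd by (auto simp: i_def)
    have r: "reg c (Suc (Suc y)) = i" "reg c (Suc (Suc x)) = vr \<sigma> x"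
      using b vars by (simp_all add: i_def)
    have cell: "30 + a + (i + i + (i + i)) = cell a i"
      by (simp add: cell_def)
    have bounds: "cell a i < ?s" "cell a i < 2 ^ w" "cell a i > 1"
      "i + i < 2 ^ w" "i + i + (i + i) < 2 ^ w" "30 + a < 2 ^ w"
      using b fits by (auto simp: cell_def)
    let ?c = "c\<lparr>pc := Suc (Suc (Suc (Suc (Suc p)))), reg := (reg c)
      (Suc 0 := 30 + a, 0 := cell a i, cell a i := vr \<sigma> x)\<rparr>"
    have "run P w ?s c (Suc (Suc (Suc (Suc (Suc 0))))) ?c"
      using at PUpd assms(5) b words vwords bounds
      by (intro run_Suc) (auto simp: put_def r cell small intro!: run_0)
    moreover have "represents w (prim_exec q \<sigma>) ?c"
      using rel PUpd b words vwords bounds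
      by (auto simp: represents_def cell_neq_var i_def cell_inject cell_neq_var[symmetric])
    ultimately show ?thesis
      using PUpd by (auto simp: numeral_eq_Suc)
  qed
qed

section \<open>Commands, their compilation and timed correctness triples\<close>

datatype com = Prim prim | Seq com com (infixr ";;" 60) | Unless nat com | While nat com

text \<open>Register 0 is scratch, so overwriting it by a positive constant gives an unconditional jump.\<close>

fun compile :: "nat \<Rightarrow> com \<Rightarrow> program" where
  "compile p (Prim q) = prim_code q"
| "compile p (c ;; d) = (let xs = compile p c in xs @ compile (p + length xs) d)"
| "compile p (Unless x c) = (let xs = compile (Suc p) c in Jump_pos (x + 2) (Suc p + length xs) # xs)"
| "compile p (While x c) = (let xs = compile (p + 2) c in
     Const 0 1 # Jump_pos 0 (p + 2 + length xs) # xs @ [Jump_pos (x + 2) (p + 2)])"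

fun wf_com :: "com \<Rightarrow> bool" where
  "wf_com (Prim q) \<longleftrightarrow> prim_wf q"
| "wf_com (c ;; d) \<longleftrightarrow> wf_com c \<and> wf_com d"
| "wf_com (Unless x c) \<longleftrightarrow> x < num_vars \<and> wf_com c"
| "wf_com (While x c) \<longleftrightarrow> x < num_vars \<and> wf_com c"

locale layout =
  fixes w N :: nat
  assumes fits: "30 + 4 * N \<le> 2 ^ w"
begin

text \<open>A total-correctness triple with a step bound. It ranges over all programs containing the
  code and all positions, so fragments can be placed anywhere. Well-formedness is a premise inside,
  so that it is discharged only once, for the complete program.\<close>

definition ok :: "com \<Rightarrow> nat \<Rightarrow> (state \<Rightarrow> bool) \<Rightarrow> state \<Rightarrow> bool" where
  "ok c T Q \<sigma> \<longleftrightarrow> (wf_com c \<longrightarrow> (\<forall>P p cf. code_at P p (compile p c) \<longrightarrow> pc cf = p \<longrightarrow> represents w \<sigma> cf \<longrightarrow>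
     (\<exists>t\<le>T. \<exists>cf' \<tau>. run P w (30 + 4 * N) cf t cf' \<and> pc cf' = p + length (compile p c) \<and>
        represents w \<tau> cf' \<and> Q \<tau>)))"

lemma okI:
  assumes "\<And>P p cf. wf_com c \<Longrightarrow> code_at P p (compile p c) \<Longrightarrow> pc cf = p \<Longrightarrow> represents w \<sigma> cf \<Longrightarrow>
    \<exists>t cf' \<tau>. t \<le> T \<and> run P w (30 + 4 * N) cf t cf' \<and> pc cf' = p + length (compile p c) \<and>
        represents w \<tau> cf' \<and> Q \<tau>"
  shows "ok c T Q \<sigma>"
  using assms unfolding ok_def by blast

lemma okE:
  assumes "ok c T Q \<sigma>" "wf_com c" "code_at P p (compile p c)" "pc cf = p" "represents w \<sigma> cf"
  obtains t cf' \<tau> where "t \<le> T" "run P w (30 + 4 * N) cf t cf'"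
    "pc cf' = p + length (compile p c)" "represents w \<tau> cf'" "Q \<tau>"
  using assms unfolding ok_def by blast

lemma ok_mono:
  assumes "ok c T Q \<sigma>" "T \<le> T'" "\<And>\<tau>. Q \<tau> \<Longrightarrow> Q' \<tau>"
  shows "ok c T' Q' \<sigma>"
proof (rule okI)
  fix P p cf
  assume *: "wf_com c" "code_at P p (compile p c)" "pc cf = p" "represents w \<sigma> cf"
  obtain t cf' \<tau> where "t \<le> T" "run P w (30 + 4 * N) cf t cf'"
      "pc cf' = p + length (compile p c)" "represents w \<tau> cf'" "Q \<tau>"
    by (rule okE[OF assms(1) *])
  then show "\<exists>t cf' \<tau>. t \<le> T' \<and> run P w (30 + 4 * N) cf t cf' \<and>
      pc cf' = p + length (compile p c) \<and> represents w \<tau> cf' \<and> Q' \<tau>"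
    using assms(2,3) by (intro exI[of _ t] exI[of _ cf'] exI[of _ \<tau>]) auto
qed

lemma ok_prim:
  assumes "prim_ok w N q \<sigma>" "Q (prim_exec q \<sigma>)"
  shows "ok (Prim q) 5 Q \<sigma>"
proof (rule okI)
  fix P p cf
  assume "wf_com (Prim q)" and *: "code_at P p (compile p (Prim q))" "pc cf = p" "represents w \<sigma> cf"
  then obtain cf' where "run P w (30 + 4 * N) cf (length (prim_code q)) cf'"
    "pc cf' = p + length (prim_code q)" "represents w (prim_exec q \<sigma>) cf'"
    using prim_correct[OF fits, of P p q \<sigma> cf] assms by auto
  moreover have "length (prim_code q) \<le> 5"
    by (cases q) auto
  ultimately show "\<exists>t cf' \<tau>. t \<le> 5 \<and> run P w (30 + 4 * N) cf t cf' \<and>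
      pc cf' = p + length (compile p (Prim q)) \<and> represents w \<tau> cf' \<and> Q \<tau>"
    using assms(2) by auto
qed

lemma ok_seq:
  assumes "ok c T1 R \<sigma>" "\<And>\<tau>. R \<tau> \<Longrightarrow> ok d T2 Q \<tau>"
  shows "ok (c ;; d) (T1 + T2) Q \<sigma>"
proof (rule okI)
  fix P p cf
  assume wf_com: "wf_com (c ;; d)" and at: "code_at P p (compile p (c ;; d))" and "pc cf = p" "represents w \<sigma> cf"
  let ?p = "p + length (compile p c)"
  have at': "code_at P p (compile p c)" "code_at P ?p (compile ?p d)"
    using at by (simp_all add: Let_def code_at_append)
  obtain t1 cf1 \<tau>1 where 1: "t1 \<le> T1" "run P w (30 + 4 * N) cf t1 cf1" "pc cf1 = ?p"
      "represents w \<tau>1 cf1" "R \<tau>1"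
    by (rule okE[OF assms(1) _ at'(1) \<open>pc cf = p\<close> \<open>represents w \<sigma> cf\<close>]) (use wf_com in auto)
  obtain t2 cf2 \<tau>2 where 2: "t2 \<le> T2" "run P w (30 + 4 * N) cf1 t2 cf2"
      "pc cf2 = ?p + length (compile ?p d)" "represents w \<tau>2 cf2" "Q \<tau>2"
    by (rule okE[OF assms(2)[OF 1(5)] _ at'(2) 1(3,4)]) (use wf_com in auto)
  show "\<exists>t cf' \<tau>. t \<le> T1 + T2 \<and> run P w (30 + 4 * N) cf t cf' \<and>
      pc cf' = p + length (compile p (c ;; d)) \<and> represents w \<tau> cf' \<and> Q \<tau>"
    using 1(1) 2 run_trans[OF 1(2) 2(2)]
    by (intro exI[of _ "t1 + t2"] exI[of _ cf2] exI[of _ \<tau>2]) (simp add: Let_def)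
qed

lemma represents_var: "represents w \<sigma> cf \<Longrightarrow> x < num_vars \<Longrightarrow> reg cf (Suc (Suc x)) = vr \<sigma> x"
  by (simp add: represents_def)

lemma run_1:
  assumes "represents w \<sigma> cf" "pc cf < length P" "P ! pc cf = Jump_pos i l" "i < 30"
  shows "run P w (30 + 4 * N) cf 1 (cf\<lparr>pc := if reg cf i > 0 then l else Suc (pc cf)\<rparr>)"
  using assms unfolding One_nat_def by (intro run_Suc run_0) (auto simp: represents_def intro!: run_0)

text \<open>The only jump of the machine is on a positive value, hence a conditional that skips its
  body then. Programs arrange for the tested variable to vanish exactly when the body should
  run.\<close>

lemma ok_unless:
  assumes "vr \<sigma> x > 0 \<Longrightarrow> Q \<sigma>" "vr \<sigma> x = 0 \<Longrightarrow> ok c T Q \<sigma>"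
  shows "ok (Unless x c) (1 + T) Q \<sigma>"
proof (rule okI)
  fix P p cf
  assume wf_com: "wf_com (Unless x c)" and at: "code_at P p (compile p (Unless x c))"
    and pc: "pc cf = p" and rel: "represents w \<sigma> cf"
  let ?l = "Suc p + length (compile (Suc p) c)"
  let ?cf = "cf\<lparr>pc := if reg cf (x + 2) > 0 then ?l else Suc p\<rparr>"
  have r: "run P w (30 + 4 * N) cf 1 ?cf"
    using run_1[OF rel, of P "x + 2" ?l] at pc wf_com by (auto simp: Let_def)
  have x: "reg cf (x + 2) = vr \<sigma> x"
    using represents_var[OF rel] wf_com by simp
  have rel': "represents w \<sigma> ?cf"
    using rel by (simp add: represents_def)
  show "\<exists>t cf' \<tau>. t \<le> 1 + T \<and> run P w (30 + 4 * N) cf t cf' \<and>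
      pc cf' = p + length (compile p (Unless x c)) \<and> represents w \<tau> cf' \<and> Q \<tau>"
  proof (cases "vr \<sigma> x > 0")
    case True
    then show ?thesis
      using r rel' x assms(1) by (intro exI[of _ 1] exI[of _ ?cf] exI[of _ \<sigma>]) (auto simp: Let_def)
  next
    case False
    obtain t cf' \<tau> where "t \<le> T" "run P w (30 + 4 * N) ?cf t cf'"
      "pc cf' = ?l" "represents w \<tau> cf'" "Q \<tau>"
      by (rule okE[OF assms(2) _ _ _ rel', of P "Suc p"]) (use False x wf_com at in \<open>auto simp: Let_def\<close>)
    then show ?thesis
      using run_trans[OF r] by (intro exI[of _ "1 + t"] exI[of _ cf'] exI[of _ \<tau>]) (auto simp: Let_def)
  qed
qed

text \<open>The invariant is indexed by the number of rounds still to come, and the cost of a round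
  may depend on this index, as the geometric sum over the doublings requires. The 3 pays for the
  jump to the test (two instructions) and for the final test; each round adds one test.\<close>

lemma ok_while:
  assumes "I m \<sigma>"
    and "\<And>k \<sigma>. I (Suc k) \<sigma> \<Longrightarrow> k < m \<Longrightarrow> vr \<sigma> x > 0 \<and> ok c (T k) (I k) \<sigma>"
    and "\<And>\<sigma>. I 0 \<sigma> \<Longrightarrow> vr \<sigma> x = 0"
  shows "ok (While x c) (3 + (\<Sum>k<m. T k + 1)) (I 0) \<sigma>"
proof (rule okI)
  fix P p cf
  assume wf_com: "wf_com (While x c)" and at: "code_at P p (compile p (While x c))"
    and pc: "pc cf = p" and rel: "represents w \<sigma> cf"
  define l where "l = p + 2 + length (compile (p + 2) c)"
  have at': "code_at P (p + 2) (compile (p + 2) c)" "l < length P" "P ! l = Jump_pos (x + 2) (p + 2)"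
    and at0: "p < length P" "P ! p = Const 0 1" "Suc p < length P" "P ! Suc p = Jump_pos 0 l"
    using at by (auto simp: Let_def code_at_append l_def)
  \<comment> \<open>Execution is followed from the test, which stands behind the body at position
    \<open>l\<close>.\<close>
  have loop: "\<exists>t cf' \<tau>. t \<le> 1 + (\<Sum>k<j. T k + 1) \<and> run P w (30 + 4 * N) cf t cf' \<and>
      pc cf' = Suc l \<and> represents w \<tau> cf' \<and> I 0 \<tau>"
    if "j \<le> m" "I j \<sigma>" "pc cf = l" "represents w \<sigma> cf" for j \<sigma> cf
    using that
  proof (induction j arbitrary: \<sigma> cf)
    case 0
    have "reg cf (x + 2) = 0"
      using assms(3) 0 represents_var wf_com by simp
    then have "run P w (30 + 4 * N) cf 1 (cf\<lparr>pc := Suc l\<rparr>)"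
      using run_1[of \<sigma> cf P "x + 2" "p + 2"] 0 at' wf_com by simp
    moreover have "represents w \<sigma> (cf\<lparr>pc := Suc l\<rparr>)"
      using 0 by (simp add: represents_def)
    ultimately show ?case
      using 0 by (intro exI[of _ 1] exI[of _ "cf\<lparr>pc := Suc l\<rparr>"] exI[of _ \<sigma>]) simp
  next
    case (Suc j)
    have body: "vr \<sigma> x > 0" "ok c (T j) (I j) \<sigma>"
      using assms(2)[of j \<sigma>] Suc.prems by auto
    let ?cf = "cf\<lparr>pc := p + 2\<rparr>"
    have "reg cf (x + 2) > 0"
      using body Suc.prems represents_var wf_com by simp
    then have r1: "run P w (30 + 4 * N) cf 1 ?cf"
      using run_1[of \<sigma> cf P "x + 2" "p + 2"] Suc.prems at' wf_com by simp
    have rel': "represents w \<sigma> ?cf"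
      using Suc.prems by (simp add: represents_def)
    obtain t1 cf1 \<tau>1 where 1: "t1 \<le> T j" "run P w (30 + 4 * N) ?cf t1 cf1"
      "pc cf1 = l" "represents w \<tau>1 cf1" "I j \<tau>1"
      by (rule okE[OF body(2) _ at'(1) _ rel']) (use wf_com l_def in auto)
    obtain t2 cf2 \<tau>2 where 2: "t2 \<le> 1 + (\<Sum>k<j. T k + 1)" "run P w (30 + 4 * N) cf1 t2 cf2"
      "pc cf2 = Suc l" "represents w \<tau>2 cf2" "I 0 \<tau>2"
      using Suc.IH[OF _ 1(5,3,4)] Suc.prems by auto
    show ?case
      using 1(1) 2 run_trans[OF r1 run_trans[OF 1(2) 2(2)]]
      by (intro exI[of _ "1 + (t1 + t2)"] exI[of _ cf2] exI[of _ \<tau>2]) simp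
  qed
  let ?cf = "cf\<lparr>reg := (reg cf)(0 := 1), pc := l\<rparr>"
  have w: "(1::nat) < 2 ^ w"
    using fits by linarith
  have r: "run P w (30 + 4 * N) cf (Suc (Suc 0)) ?cf"
    using at0 pc rel w by (intro run_Suc) (auto simp: put_def represents_def intro!: run_0)
  have "represents w \<sigma> ?cf"
    using rel w by (auto simp: represents_def cell_neq_var)
  then obtain t cf' \<tau> where "t \<le> 1 + (\<Sum>k<m. T k + 1)" "run P w (30 + 4 * N) ?cf t cf'"
      "pc cf' = Suc l" "represents w \<tau> cf'" "I 0 \<tau>"
    using loop[of m \<sigma> ?cf] assms(1) by auto
  then show "\<exists>t cf' \<tau>. t \<le> 3 + (\<Sum>k<m. T k + 1) \<and> run P w (30 + 4 * N) cf t cf' \<and>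
      pc cf' = p + length (compile p (While x c)) \<and> represents w \<tau> cf' \<and> I 0 \<tau>"
    using run_trans[OF r] by (intro exI[of _ "2 + t"] exI[of _ cf'] exI[of _ \<tau>])
      (auto simp: Let_def l_def)
qed

lemma ok_for:
  assumes "I m \<sigma>"
    and "\<And>k \<sigma>. I (Suc k) \<sigma> \<Longrightarrow> k < m \<Longrightarrow> vr \<sigma> x > 0 \<and> ok c T (I k) \<sigma>"
    and "\<And>\<sigma>. I 0 \<sigma> \<Longrightarrow> vr \<sigma> x = 0"
  shows "ok (While x c) (3 + m * (T + 1)) (I 0) \<sigma>"
  using ok_while[of I m \<sigma> x c "\<lambda>_. T", OF assms] by simp

text \<open>Loops get \<open>False\<close> because they go through \<open>ok_while\<close>, so their
  zero in \<open>cost\<close> is a dummy value. A primitive is charged 5 steps, the length of an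
  array access.\<close>

fun wp :: "com \<Rightarrow> (state \<Rightarrow> bool) \<Rightarrow> state \<Rightarrow> bool" where
  "wp (Prim q) Q \<sigma> \<longleftrightarrow> prim_ok w N q \<sigma> \<and> Q (prim_exec q \<sigma>)"
| "wp (c ;; d) Q \<sigma> \<longleftrightarrow> wp c (wp d Q) \<sigma>"
| "wp (Unless x c) Q \<sigma> \<longleftrightarrow> (if vr \<sigma> x > 0 then Q \<sigma> else wp c Q \<sigma>)"
| "wp (While x c) Q \<sigma> \<longleftrightarrow> False"

fun cost :: "com \<Rightarrow> nat" where
  "cost (Prim q) = 5"
| "cost (c ;; d) = cost c + cost d"
| "cost (Unless x c) = 1 + cost c"
| "cost (While x c) = 0"

lemma ok_wp: "wp c Q \<sigma> \<Longrightarrow> ok c (cost c) Q \<sigma>"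
proof (induction c arbitrary: Q \<sigma>)
  case (Seq c d)
  show ?case
    using Seq.prems by (auto intro!: ok_seq[where R = "wp d Q"] Seq.IH)
next
  case (Unless x c)
  show ?case
    using Unless.prems by (auto intro!: ok_unless[of \<sigma> x Q c "cost c", simplified] Unless.IH)
qed (auto intro: ok_prim)

lemma ok_wp_seq:
  assumes "wp c R \<sigma>" "\<And>\<tau>. R \<tau> \<Longrightarrow> ok d T Q \<tau>"
  shows "ok (c ;; d) (cost c + T) Q \<sigma>"
  using ok_seq[OF ok_wp[OF assms(1)] assms(2)] .

lemma ok_computes_within:
  assumes "ok c T Q \<lparr>vr = \<lambda>_. 0, ar = \<lambda>_ _. 0, inq = xs, outq = []\<rparr>" "wf_com c"
  shows "\<exists>t\<le>T. \<exists>\<tau>. computes_within (compile 0 c) w (30 + 4 * N) t xs (outq \<tau>) \<and> Q \<tau>"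
proof -
  have "represents w \<lparr>vr = \<lambda>_. 0, ar = \<lambda>_ _. 0, inq = xs, outq = []\<rparr> (start xs)"
    by (simp add: represents_def start_def)
  from okE[OF assms(1,2) _ _ this, of "compile 0 c" 0]
  obtain t cf \<tau> where "t \<le> T" "run (compile 0 c) w (30 + 4 * N) (start xs) t cf"
      "pc cf = length (compile 0 c)" "represents w \<tau> cf" "Q \<tau>"
    using code_at_self[of "[]"] by (auto simp: start_def)
  then show ?thesis
    using run_computes_within[of "compile 0 c" w "30 + 4 * N" xs t cf]
    by (auto simp: halted_def represents_def)
qed

end

section \<open>Counting the neighbourhood unions of a cut\<close>

abbreviation (input) v_n :: nat where "v_n \<equiv> 2"
abbreviation (input) v_one :: nat where "v_one \<equiv> 3"
abbreviation (input) v_full :: nat where "v_full \<equiv> 4"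
abbreviation (input) v_K :: nat where "v_K \<equiv> 5"
abbreviation (input) v_A :: nat where "v_A \<equiv> 6"
abbreviation (input) v_left :: nat where "v_left \<equiv> 7"
abbreviation (input) v_go :: nat where "v_go \<equiv> 8"
abbreviation (input) v_compl :: nat where "v_compl \<equiv> 9"
abbreviation (input) v_mask :: nat where "v_mask \<equiv> 10"
abbreviation (input) v_i :: nat where "v_i \<equiv> 11"
abbreviation (input) v_rem :: nat where "v_rem \<equiv> 12"
abbreviation (input) v_len :: nat where "v_len \<equiv> 13"
abbreviation (input) v_nb :: nat where "v_nb \<equiv> 14"
abbreviation (input) v_j :: nat where "v_j \<equiv> 15"
abbreviation (input) v_rem2 :: nat where "v_rem2 \<equiv> 16"
abbreviation (input) v_u :: nat where "v_u \<equiv> 17"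
abbreviation (input) v_m :: nat where "v_m \<equiv> 18"
abbreviation (input) v_g :: nat where "v_g \<equiv> 19"
abbreviation (input) v_best :: nat where "v_best \<equiv> 20"
abbreviation (input) v_t :: nat where "v_t \<equiv> 21"
abbreviation (input) v_W :: nat where "v_W \<equiv> 22"
abbreviation (input) v_bit :: nat where "v_bit \<equiv> 23"
abbreviation (input) v_label :: nat where "v_label \<equiv> 24"
abbreviation (input) v_zero :: nat where "v_zero \<equiv> 25"
abbreviation (input) v_out :: nat where "v_out \<equiv> 26"

abbreviation (input) a_nbhd :: nat where "a_nbhd \<equiv> 0"
abbreviation (input) a_val :: nat where "a_val \<equiv> 1"
abbreviation (input) a_mark :: nat where "a_mark \<equiv> 2"
abbreviation (input) a_list :: nat where "a_list \<equiv> 3"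

text \<open>\<open>v_g\<close> is the truncated difference \<open>len - K\<close> plus the mark of
  the new union, hence positive exactly if the list is full or already contains the union.\<close>

definition merge_step :: com where
  "merge_step =
    Prim (PGet v_u a_list v_j) ;;
    Prim (POr v_u v_u v_nb) ;;
    Prim (PGet v_m a_mark v_u) ;;
    Prim (PSub v_g v_len v_K) ;;
    Prim (PAdd v_g v_g v_m) ;;
    Unless v_g
      (Prim (PUpd a_list v_len v_u) ;;
       Prim (PUpd a_mark v_u v_one) ;;
       Prim (PAdd v_len v_len v_one)) ;;
    Prim (PAdd v_j v_j v_one) ;;
    Prim (PSub v_rem2 v_rem2 v_one)"

definition frame :: "nat set \<Rightarrow> nat set \<Rightarrow> state \<Rightarrow> state \<Rightarrow> bool" where
  "frame X A \<sigma> \<tau> \<longleftrightarrow> (\<forall>x. x \<notin> X \<longrightarrow> vr \<tau> x = vr \<sigma> x) \<and> (\<forall>a. a \<notin> A \<longrightarrow> ar \<tau> a = ar \<sigma> a) \<and>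
     inq \<tau> = inq \<sigma> \<and> outq \<tau> = outq \<sigma>"

lemma frame_trans:
  "frame X A \<sigma> \<tau> \<Longrightarrow> frame X A \<tau> \<upsilon> \<Longrightarrow> frame X A \<sigma> \<upsilon>"
  by (simp add: frame_def)

lemma frame_mono: "frame X A \<sigma> \<tau> \<Longrightarrow> X \<subseteq> Y \<Longrightarrow> A \<subseteq> B \<Longrightarrow> frame Y B \<sigma> \<tau>"
  unfolding frame_def by blast

definition listed :: "nat \<Rightarrow> nat \<Rightarrow> state \<Rightarrow> nat set \<Rightarrow> bool" where
  "listed N K \<sigma> S \<longleftrightarrow> inj_on (ar \<sigma> a_list) {..<vr \<sigma> v_len} \<and> ar \<sigma> a_list ` {..<vr \<sigma> v_len} = S \<and>
     S \<subseteq> {..<N} \<and> (\<forall>u. ar \<sigma> a_mark u = (if u \<in> S then 1 else 0)) \<and> vr \<sigma> v_len \<le> Suc K"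

lemma listed_card: "listed N K \<sigma> S \<Longrightarrow> card S = vr \<sigma> v_len \<and> vr \<sigma> v_len \<le> N"
  unfolding listed_def using card_image[of "ar \<sigma> a_list" "{..<vr \<sigma> v_len}"]
    card_mono[of "{..<N}" S] by auto

text \<open>That the written index is in bounds is read off afterwards: the enlarged list still
  consists of distinct numbers below \<open>N\<close>, so its length is at most \<open>N\<close>.
  The bound \<open>K\<close> alone would not do, since \<open>K\<close> may be as large as
  \<open>N\<close>.\<close>

lemma listed_append:
  assumes "listed N K \<sigma> S" "u \<notin> S" "u < N" "vr \<sigma> v_len \<le> K"
    and \<tau>: "ar \<tau> a_list = (ar \<sigma> a_list)(vr \<sigma> v_len := u)" "ar \<tau> a_mark = (ar \<sigma> a_mark)(u := 1)"
      "vr \<tau> v_len = Suc (vr \<sigma> v_len)"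
  shows "listed N K \<tau> (insert u S)" "vr \<sigma> v_len < N"
proof -
  let ?l = "vr \<sigma> v_len"
  have im: "ar \<tau> a_list ` {..<?l} = S" and inj: "inj_on (ar \<tau> a_list) {..<?l}"
    using assms by (auto simp: listed_def inj_on_def)
  have "inj_on (ar \<tau> a_list) {..<Suc ?l}"
    unfolding lessThan_Suc using im inj assms(2) \<tau> by (subst inj_on_insert) auto
  moreover have "ar \<tau> a_list ` {..<Suc ?l} = insert u S"
    unfolding lessThan_Suc image_insert im using \<tau> by simp
  ultimately show *: "listed N K \<tau> (insert u S)"
    using assms unfolding listed_def by auto
  show "?l < N"
    using listed_card[OF *] \<tau> by simp
qed

locale alg =
  fixes n N w :: nat and E :: "nat set set"
  assumes n: "n \<ge> 1" and graph: "simple_graph {..<n} E" and N: "N = 2 ^ n"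
    and big: "30 + 4 * N \<le> 2 ^ w"
begin

sublocale layout w N
  using big by unfold_locales

lemma less_N_iff: "a < N \<longleftrightarrow> bits a \<subseteq> {..<n}"
  by (simp add: bits_subset_iff N)

lemma or_less_N: "a < N \<Longrightarrow> b < N \<Longrightarrow> Bit_Operations.or a b < N"
  by (simp add: less_N_iff bits_or)

definition base :: "state \<Rightarrow> bool" where
  "base \<sigma> \<longleftrightarrow> vr \<sigma> v_n = n \<and> vr \<sigma> v_one = 1 \<and> vr \<sigma> v_zero = 0 \<and> vr \<sigma> v_full = N - 1 \<and>
     (\<forall>i<n. bits (ar \<sigma> a_nbhd i) = nbhd E i)"

text \<open>Only the first \<open>vr \<sigma>0 v_len\<close> entries are scanned, while new unions
  are appended behind them. A full list drops unions, so completeness is claimed only for length at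
  most \<open>K\<close>.\<close>

definition merge_inv :: "nat \<Rightarrow> state \<Rightarrow> nat set \<Rightarrow> nat \<Rightarrow> state \<Rightarrow> bool" where
  "merge_inv K \<sigma>0 S0 k \<sigma> \<longleftrightarrow> frame {v_u, v_m, v_g, v_len, v_j, v_rem2} {a_mark, a_list} \<sigma>0 \<sigma> \<and>
     vr \<sigma> v_rem2 = k \<and> vr \<sigma> v_j + k = vr \<sigma>0 v_len \<and> vr \<sigma>0 v_len \<le> vr \<sigma> v_len \<and>
     (\<forall>j < vr \<sigma>0 v_len. ar \<sigma> a_list j = ar \<sigma>0 a_list j) \<and>
     (\<exists>S. listed N K \<sigma> S \<and> S0 \<subseteq> S \<and> S \<subseteq> S0 \<union> (\<lambda>u. Bit_Operations.or u (vr \<sigma>0 v_nb)) ` S0 \<and>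
       (vr \<sigma> v_len \<le> K \<longrightarrow>
          (\<lambda>u. Bit_Operations.or u (vr \<sigma>0 v_nb)) ` ar \<sigma>0 a_list ` {..<vr \<sigma> v_j} \<subseteq> S))"

lemma merge_step:
  assumes base: "base \<sigma>0" and K: "vr \<sigma>0 v_K = K" and S0: "listed N K \<sigma>0 S0" and nb: "vr \<sigma>0 v_nb < N"
    and inv: "merge_inv K \<sigma>0 S0 (Suc k) \<sigma>"
  shows "ok merge_step 51 (merge_inv K \<sigma>0 S0 k) \<sigma>"
proof -
  let ?f = "\<lambda>u. Bit_Operations.or u (vr \<sigma>0 v_nb)"
  let ?j = "vr \<sigma> v_j"
  obtain S where S: "listed N K \<sigma> S" "S0 \<subseteq> S" "S \<subseteq> S0 \<union> ?f ` S0"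
    "vr \<sigma> v_len \<le> K \<longrightarrow> ?f ` ar \<sigma>0 a_list ` {..<?j} \<subseteq> S"
    using inv by (auto simp: merge_inv_def)
  have fr: "\<forall>x. x \<notin> {v_u, v_m, v_g, v_len, v_j, v_rem2} \<longrightarrow> vr \<sigma> x = vr \<sigma>0 x"
    "\<forall>a. a \<notin> {a_mark, a_list} \<longrightarrow> ar \<sigma> a = ar \<sigma>0 a" "inq \<sigma> = inq \<sigma>0" "outq \<sigma> = outq \<sigma>0"
    using inv by (simp_all add: merge_inv_def frame_def)
  have j: "?j < vr \<sigma>0 v_len" "vr \<sigma>0 v_len \<le> vr \<sigma> v_len" "vr \<sigma> v_rem2 = Suc k"
    "?j + Suc k = vr \<sigma>0 v_len" "\<forall>j < vr \<sigma>0 v_len. ar \<sigma> a_list j = ar \<sigma>0 a_list j"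
    using inv by (simp_all add: merge_inv_def)
  define u where "u = ?f (ar \<sigma>0 a_list ?j)"
  have "ar \<sigma>0 a_list ?j \<in> S0"
    using S0 j by (auto simp: listed_def)
  then have u: "u \<in> ?f ` S0" "u < N"
    using S0 nb or_less_N by (auto simp: u_def listed_def)
  have len: "vr \<sigma> v_len \<le> N" "?j < N"
    using listed_card[OF S(1)] j by auto
  have mark: "ar \<sigma> a_mark u = (if u \<in> S then 1 else 0)"
    using S(1) by (simp add: listed_def)
  have vars: "vr \<sigma> v_K = K" "vr \<sigma> v_one = 1" "vr \<sigma> v_nb = vr \<sigma>0 v_nb"
    using fr base K by (auto simp: base_def)
  have uj: "Bit_Operations.or (ar \<sigma> a_list ?j) (vr \<sigma>0 v_nb) = u"
    using j by (simp add: u_def)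
  have step: "?f ` ar \<sigma>0 a_list ` {..<Suc ?j} = insert u (?f ` ar \<sigma>0 a_list ` {..<?j})"
    by (simp add: lessThan_Suc u_def)
  \<comment> \<open>Common end of both branches: the list is unchanged, with \<open>S' = S\<close>,
    or \<open>u\<close> has been appended.\<close>
  have keep: "merge_inv K \<sigma>0 S0 k \<tau>"
    if "frame {v_u, v_m, v_g, v_len, v_j, v_rem2} {a_mark, a_list} \<sigma> \<tau>"
      "vr \<tau> v_rem2 = k" "vr \<tau> v_j = Suc ?j" "vr \<sigma> v_len \<le> vr \<tau> v_len"
      "\<forall>j < vr \<sigma> v_len. ar \<tau> a_list j = ar \<sigma> a_list j"
      "listed N K \<tau> S'" "S \<subseteq> S'" "S' \<subseteq> insert u S" "vr \<tau> v_len \<le> K \<longrightarrow> u \<in> S'" for \<tau> S'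
  proof -
    have "frame {v_u, v_m, v_g, v_len, v_j, v_rem2} {a_mark, a_list} \<sigma>0 \<tau>"
      by (rule frame_trans[OF _ that(1)]) (use inv in \<open>simp add: merge_inv_def\<close>)
    moreover have "S0 \<subseteq> S'"
      using that(7) S(2) by (rule order_trans[rotated])
    moreover have "S' \<subseteq> S0 \<union> ?f ` S0"
      using that(8) S(3) u(1) by auto
    moreover have "?f ` ar \<sigma>0 a_list ` {..<vr \<tau> v_j} \<subseteq> S'" if "vr \<tau> v_len \<le> K"
    proof -
      have "?f ` ar \<sigma>0 a_list ` {..<?j} \<subseteq> S'"
        using S(4) \<open>S \<subseteq> S'\<close> \<open>vr \<sigma> v_len \<le> vr \<tau> v_len\<close> that by (meson order_trans)
      then show ?thesis
        unfolding \<open>vr \<tau> v_j = Suc ?j\<close> step using \<open>vr \<tau> v_len \<le> K \<longrightarrow> u \<in> S'\<close> that by simp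
    qed
    ultimately show ?thesis
      unfolding merge_inv_def using that j by auto
  qed
  have small: "vr \<sigma> v_len - K + 1 < 2 ^ w" "vr \<sigma> v_len - K < 2 ^ w" "vr \<sigma> v_len + 1 < 2 ^ w" "?j + 1 < 2 ^ w"
    using len big by auto
  have "wp merge_step (merge_inv K \<sigma>0 S0 k) \<sigma>"
  \<comment> \<open>Skipping is harmless: \<open>u\<close> is already listed, or the length exceeds
    \<open>K\<close> and completeness is no longer claimed.\<close>
  proof (cases "u \<in> S \<or> vr \<sigma> v_len > K")
    case True
    have "merge_inv K \<sigma>0 S0 k \<tau>"
      if "\<tau> = \<sigma>\<lparr>vr := (vr \<sigma>)(v_u := u, v_m := x, v_g := y, v_j := Suc ?j, v_rem2 := k)\<rparr>" for x y \<tau>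
      by (rule keep[where S' = S]) (use that S(1) True in \<open>auto simp: frame_def listed_def\<close>)
    then show ?thesis
      using True small by (auto simp: merge_step_def vars uj u len mark j(3))
  next
    case False
    let ?\<tau> = "\<sigma>\<lparr>
       ar := (ar \<sigma>)(a_list := (ar \<sigma> a_list)(vr \<sigma> v_len := u), a_mark := (ar \<sigma> a_mark)(u := 1)),
       vr := (vr \<sigma>)(v_u := u, v_m := 0, v_g := 0, v_len := Suc (vr \<sigma> v_len),
         v_j := Suc ?j, v_rem2 := k)\<rparr>"
    have app: "listed N K ?\<tau> (insert u S)" "vr \<sigma> v_len < N"
      using listed_append[OF S(1), of u ?\<tau>] False u by auto
    have "merge_inv K \<sigma>0 S0 k ?\<tau>"
      by (rule keep[where S' = "insert u S"]) (use app in \<open>auto simp: frame_def\<close>)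
    then show ?thesis
      using False app small by (simp add: merge_step_def vars uj u len mark j(3))
  qed
  then show ?thesis
    by (rule ok_mono[OF ok_wp]) (simp_all add: merge_step_def)
qed

lemma merge_loop:
  assumes base: "base \<sigma>" and K: "vr \<sigma> v_K = K" and S: "listed N K \<sigma> S" and nb: "vr \<sigma> v_nb < N"
    and j: "vr \<sigma> v_j = 0" "vr \<sigma> v_rem2 = vr \<sigma> v_len"
  shows "ok (While v_rem2 merge_step) (3 + Suc K * 52)
    (\<lambda>\<tau>. frame {v_u, v_m, v_g, v_len, v_j, v_rem2} {a_mark, a_list} \<sigma> \<tau> \<and>
      (\<exists>S'. listed N K \<tau> S' \<and> S' \<subseteq> S \<union> (\<lambda>u. Bit_Operations.or u (vr \<sigma> v_nb)) ` S \<and>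
        (vr \<tau> v_len \<le> K \<longrightarrow> S' = S \<union> (\<lambda>u. Bit_Operations.or u (vr \<sigma> v_nb)) ` S))) \<sigma>"
proof (rule ok_mono[OF ok_for[where I = "merge_inv K \<sigma> S" and m = "vr \<sigma> v_len" and T = 51]])
  show "merge_inv K \<sigma> S (vr \<sigma> v_len) \<sigma>"
    using assms by (auto simp: merge_inv_def frame_def)
  show "3 + vr \<sigma> v_len * (51 + 1) \<le> 3 + Suc K * 52"
    using S by (simp add: listed_def)
next
  fix \<tau>
  let ?f = "\<lambda>u. Bit_Operations.or u (vr \<sigma> v_nb)"
  assume inv: "merge_inv K \<sigma> S 0 \<tau>"
  then obtain S' where S': "listed N K \<tau> S'" "S \<subseteq> S'" "S' \<subseteq> S \<union> ?f ` S"
      "vr \<tau> v_len \<le> K \<longrightarrow> ?f ` ar \<sigma> a_list ` {..<vr \<tau> v_j} \<subseteq> S'"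
    by (auto simp: merge_inv_def)
  have "ar \<sigma> a_list ` {..<vr \<tau> v_j} = S"
    using S inv by (simp add: listed_def merge_inv_def)
  then have "S \<union> ?f ` S \<subseteq> S'" if "vr \<tau> v_len \<le> K"
    using S'(2,4) that by simp
  then have "vr \<tau> v_len \<le> K \<longrightarrow> S' = S \<union> ?f ` S"
    using S'(3) by (intro impI equalityI)
  then show "frame {v_u, v_m, v_g, v_len, v_j, v_rem2} {a_mark, a_list} \<sigma> \<tau> \<and>
      (\<exists>S'. listed N K \<tau> S' \<and> S' \<subseteq> S \<union> ?f ` S \<and> (vr \<tau> v_len \<le> K \<longrightarrow> S' = S \<union> ?f ` S))"
    using inv S' by (intro conjI exI[of _ S']) (simp_all only: merge_inv_def)
next
  fix k \<tau>
  assume "merge_inv K \<sigma> S (Suc k) \<tau>"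
  then show "vr \<tau> v_rem2 > 0 \<and> ok merge_step 51 (merge_inv K \<sigma> S k) \<tau>"
    using merge_step[OF base K S nb, of k \<tau>] by (simp add: merge_inv_def)
qed (simp add: merge_inv_def)

end

section \<open>Listing all unions of one cut\<close>

definition vertex_init :: com where
  "vertex_init =
    Prim (PGet v_nb a_nbhd v_i) ;;
    Prim (PAnd v_nb v_nb v_compl) ;;
    Prim (PSet v_j 0) ;;
    Prim (PAdd v_rem2 v_len v_zero)"

definition advance :: com where
  "advance =
    Prim (PAdd v_mask v_mask v_mask) ;;
    Prim (PAdd v_i v_i v_one) ;;
    Prim (PSub v_rem v_rem v_one)"

text \<open>The mask is tested against the complement because \<open>Unless\<close> runs its body on
  zero, which is then the case of a vertex in \<open>a\<close>.\<close>

definition vertex_step :: com where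
  "vertex_step =
    Prim (PAnd v_u v_mask v_compl) ;;
    Unless v_u (vertex_init ;; While v_rem2 merge_step) ;;
    advance"

text \<open>The list starts with the word 0, the union over no vertices.\<close>

definition count_init :: com where
  "count_init =
    Prim (PSub v_compl v_full v_A) ;;
    Prim (PUpd a_list v_zero v_zero) ;;
    Prim (PUpd a_mark v_zero v_one) ;;
    Prim (PSet v_len 1) ;;
    Prim (PSet v_mask 1) ;;
    Prim (PSet v_i 0) ;;
    Prim (PAdd v_rem v_n v_zero)"

definition unmark_init :: com where
  "unmark_init =
    Prim (PSet v_i 0) ;;
    Prim (PAdd v_rem v_len v_zero)"

definition unmark_step :: com where
  "unmark_step =
    Prim (PGet v_u a_list v_i) ;;
    Prim (PUpd a_mark v_u v_zero) ;;
    Prim (PAdd v_i v_i v_one) ;;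
    Prim (PSub v_rem v_rem v_one)"

definition count :: com where
  "count =
    count_init ;; While v_rem vertex_step ;;
    unmark_init ;; While v_rem unmark_step"

context alg
begin

abbreviation loop_vars :: "nat set" where
  "loop_vars \<equiv> {v_u, v_m, v_g, v_len, v_j, v_rem2, v_nb, v_mask, v_i, v_rem}"

lemma n_less_N: "n < N" "i < n \<Longrightarrow> 2 ^ i < N" "i \<le> n \<Longrightarrow> 2 ^ i \<le> N" "i < n \<Longrightarrow> i < N"
  using less_exp[of n] by (auto simp: N intro: power_strict_increasing power_increasing less_trans)

lemma bits_compl:
  assumes "a < N"
  shows "bits (N - 1 - a) = {..<n} - bits a" "bits (N - Suc a) = {..<n} - bits a"
proof -
  have "bits (N - 1 - a) = bits (N - 1) - bits a"
    using assms unfolding N less_N_iff[unfolded N] bits_full[symmetric] by (intro bits_diff)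
  then show "bits (N - 1 - a) = {..<n} - bits a"
    by (simp only: N bits_full)
  then show "bits (N - Suc a) = {..<n} - bits a"
    by simp
qed

lemma bit_compl: "a < N \<Longrightarrow> bit (N - 1 - a) i \<longleftrightarrow> i < n \<and> \<not> bit a i"
  using bits_compl(1)[of a] unfolding set_eq_iff by simp

lemma nbhd_subset: "nbhd E i \<subseteq> {..<n}"
  using graph by (auto simp: simple_graph_def nbhd_def doubleton_eq_iff)

text \<open>On overflow only the inclusion survives; it still shows that the cut has at least as
  many unions as the list has entries.\<close>

definition count_inv :: "nat \<Rightarrow> nat \<Rightarrow> state \<Rightarrow> nat \<Rightarrow> state \<Rightarrow> bool" where
  "count_inv K a \<sigma>0 k \<sigma> \<longleftrightarrow> frame loop_vars {a_mark, a_list} \<sigma>0 \<sigma> \<and>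
     vr \<sigma> v_rem = k \<and> vr \<sigma> v_i + k = n \<and> vr \<sigma> v_mask = 2 ^ vr \<sigma> v_i \<and>
     (\<exists>S. listed N K \<sigma> S \<and>
       bits ` S \<subseteq> cut_unions E ({..<n} - bits a) (bits a \<inter> {..<vr \<sigma> v_i}) \<and>
       (vr \<sigma> v_len \<le> K \<longrightarrow>
         bits ` S = cut_unions E ({..<n} - bits a) (bits a \<inter> {..<vr \<sigma> v_i})))"

lemma vertex_step:
  assumes base: "base \<sigma>0" and K: "vr \<sigma>0 v_K = K"
    and a: "a < N" "vr \<sigma>0 v_compl = N - 1 - a"
    and inv: "count_inv K a \<sigma>0 (Suc k) \<sigma>"
  shows "ok vertex_step (44 + Suc K * 52) (count_inv K a \<sigma>0 k) \<sigma>"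
proof -
  let ?i = "vr \<sigma> v_i"
  let ?C = "{..<n} - bits a"
  have fr: "\<forall>x. x \<notin> loop_vars \<longrightarrow> vr \<sigma> x = vr \<sigma>0 x"
    "\<forall>a. a \<notin> {a_mark, a_list} \<longrightarrow> ar \<sigma> a = ar \<sigma>0 a" "inq \<sigma> = inq \<sigma>0" "outq \<sigma> = outq \<sigma>0"
    using inv by (simp_all add: count_inv_def frame_def)
  have i: "?i + Suc k = n" "vr \<sigma> v_rem = Suc k" "vr \<sigma> v_mask = 2 ^ ?i" "?i < n"
    using inv by (auto simp: count_inv_def)
  have base': "base \<sigma>"
    using base fr by (simp add: base_def)
  have vars: "vr \<sigma> v_K = K" "vr \<sigma> v_compl = N - 1 - a" "vr \<sigma> v_one = 1" "vr \<sigma> v_zero = 0"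
    using base' fr K a by (simp_all add: base_def)
  obtain S where S: "listed N K \<sigma> S"
    "bits ` S \<subseteq> cut_unions E ?C (bits a \<inter> {..<?i})"
    "vr \<sigma> v_len \<le> K \<longrightarrow> bits ` S = cut_unions E ?C (bits a \<inter> {..<?i})"
    using inv unfolding count_inv_def by blast
  \<comment> \<open>The effect of the conditional alone, before index and mask advance.\<close>
  define R where "R \<tau> \<longleftrightarrow> frame (loop_vars - {v_mask, v_i, v_rem}) {a_mark, a_list} \<sigma> \<tau> \<and>
     (\<exists>S. listed N K \<tau> S \<and> bits ` S \<subseteq> cut_unions E ?C (bits a \<inter> {..<Suc ?i}) \<and>
       (vr \<tau> v_len \<le> K \<longrightarrow> bits ` S = cut_unions E ?C (bits a \<inter> {..<Suc ?i})))" for \<tau>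
  define u where "u = Bit_Operations.and (2 ^ ?i) (N - 1 - a)"
  have u: "u = 0 \<longleftrightarrow> bit a ?i"
    using bit_compl[OF a(1)] i(4) by (simp add: u_def and_power_eq_0_iff)
  define \<sigma>1 where "\<sigma>1 = \<sigma>\<lparr>vr := (vr \<sigma>)(v_u := u)\<rparr>"
  have fr1: "frame (loop_vars - {v_mask, v_i, v_rem}) {a_mark, a_list} \<sigma> \<sigma>1"
    by (simp add: frame_def \<sigma>1_def)
  have S1: "listed N K \<sigma>1 S"
    using S(1) by (simp add: listed_def \<sigma>1_def)
  have 1: "ok (Prim (PAnd v_u v_mask v_compl)) 5 (\<lambda>\<tau>. \<tau> = \<sigma>1) \<sigma>"
    by (rule ok_prim) (simp_all add: \<sigma>1_def vars i u_def)
  have 2: "ok (Unless v_u (vertex_init ;; While v_rem2 merge_step)) (1 + (20 + (3 + Suc K * 52))) R \<sigma>1"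
  proof (rule ok_unless)
    assume "vr \<sigma>1 v_u > 0"
    then have "\<not> bit a ?i"
      using u by (simp add: \<sigma>1_def)
    then have "bits a \<inter> {..<Suc ?i} = bits a \<inter> {..<?i}"
      by (auto simp: less_Suc_eq)
    then show "R \<sigma>1"
      unfolding R_def using fr1 S S1 by (intro conjI exI[of _ S]) (simp_all add: \<sigma>1_def)
  next
    assume "vr \<sigma>1 v_u = 0"
    then have "bit a ?i"
      using u by (simp add: \<sigma>1_def)
    then have ins: "bits a \<inter> {..<Suc ?i} = insert ?i (bits a \<inter> {..<?i})"
      by (auto simp: less_Suc_eq)
    define nb where "nb = Bit_Operations.and (ar \<sigma> a_nbhd ?i) (N - 1 - a)"
    have nb: "bits nb = nbhd E ?i \<inter> ?C" "nb < N"
      using base' i bits_compl(1)[OF a(1)] unfolding less_N_iff by (auto simp: nb_def bits_and base_def)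
    define \<sigma>2 where "\<sigma>2 = \<sigma>1\<lparr>vr := (vr \<sigma>1)(v_nb := nb, v_j := 0, v_rem2 := vr \<sigma>1 v_len)\<rparr>"
    have S2: "listed N K \<sigma>2 S"
      using S1 by (simp add: listed_def \<sigma>2_def)
    have base2: "base \<sigma>2"
      using base' by (simp add: base_def \<sigma>2_def \<sigma>1_def)
    have fr2: "frame (loop_vars - {v_mask, v_i, v_rem}) {a_mark, a_list} \<sigma> \<sigma>2"
      by (simp add: frame_def \<sigma>2_def \<sigma>1_def)
    have wp: "wp vertex_init (\<lambda>\<tau>. \<tau> = \<sigma>2) \<sigma>1"
      using big listed_card[OF S(1)] n_less_N(4)[OF i(4)]
      by (simp add: vertex_init_def \<sigma>2_def \<sigma>1_def nb_def vars)
    have loop: "ok (While v_rem2 merge_step) (3 + Suc K * 52) R \<sigma>2"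
    proof (rule ok_mono[OF merge_loop[OF base2 _ S2]])
      fix \<tau>
      let ?f = "\<lambda>u. Bit_Operations.or u (vr \<sigma>2 v_nb)"
      assume *: "frame {v_u, v_m, v_g, v_len, v_j, v_rem2} {a_mark, a_list} \<sigma>2 \<tau> \<and>
        (\<exists>S'. listed N K \<tau> S' \<and> S' \<subseteq> S \<union> ?f ` S \<and> (vr \<tau> v_len \<le> K \<longrightarrow> S' = S \<union> ?f ` S))"
      then obtain S' where S': "listed N K \<tau> S'" "S' \<subseteq> S \<union> ?f ` S"
        "vr \<tau> v_len \<le> K \<longrightarrow> S' = S \<union> ?f ` S"
        by blast
      have f: "bits (?f u) = bits u \<union> (nbhd E ?i \<inter> ?C)" for u
        using nb by (simp add: bits_or \<sigma>2_def)
      have "bits ` ?f ` S = (\<lambda>X. X \<union> (nbhd E ?i \<inter> ?C)) ` bits ` S"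
        by (simp add: image_image f)
      then have im: "bits ` (S \<union> ?f ` S) = bits ` S \<union> (\<lambda>X. X \<union> (nbhd E ?i \<inter> ?C)) ` bits ` S"
        by (simp add: image_Un)
      have sub: "bits ` (S \<union> ?f ` S) \<subseteq> cut_unions E ?C (bits a \<inter> {..<Suc ?i})"
        unfolding im ins cut_unions_insert using S(2) by blast
      \<comment> \<open>If there is no overflow after the merge, the old entries are all kept, so
        there was none before it either, and the equality for the smaller vertex set is
        available.\<close>
      have "S \<subseteq> S'" if "vr \<tau> v_len \<le> K"
        using S' that by blast
      then have "card S \<le> card S'" if "vr \<tau> v_len \<le> K"
        using that S'(1) by (intro card_mono) (auto simp: listed_def intro: finite_subset)
      then have len: "vr \<sigma> v_len \<le> K" if "vr \<tau> v_len \<le> K"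
        using that listed_card[OF S(1)] listed_card[OF S'(1)] by simp
      have "bits ` S' = cut_unions E ?C (bits a \<inter> {..<Suc ?i})" if "vr \<tau> v_len \<le> K"
        using S'(3) that im S(3) len[OF that] unfolding ins cut_unions_insert by simp
      moreover have "bits ` S' \<subseteq> cut_unions E ?C (bits a \<inter> {..<Suc ?i})"
        using S'(2) sub by (meson image_mono order_trans)
      moreover have "frame (loop_vars - {v_mask, v_i, v_rem}) {a_mark, a_list} \<sigma> \<tau>"
        by (rule frame_trans[OF fr2 frame_mono]) (use * in auto)
      ultimately show "R \<tau>"
        unfolding R_def using S'(1) by blast
    qed (use vars nb in \<open>simp_all add: \<sigma>2_def \<sigma>1_def\<close>)
    have "ok (vertex_init ;; While v_rem2 merge_step) (cost vertex_init + (3 + Suc K * 52)) R \<sigma>1"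
      by (rule ok_wp_seq[OF wp]) (use loop in simp)
    then show "ok (vertex_init ;; While v_rem2 merge_step) (20 + (3 + Suc K * 52)) R \<sigma>1"
      by (simp add: vertex_init_def)
  qed
  have 3: "ok advance 15 (count_inv K a \<sigma>0 k) \<tau>" if "R \<tau>" for \<tau>
  proof -
    obtain S' where S': "listed N K \<tau> S'" "bits ` S' \<subseteq> cut_unions E ?C (bits a \<inter> {..<Suc ?i})"
       "(vr \<tau> v_len \<le> K \<longrightarrow> bits ` S' = cut_unions E ?C (bits a \<inter> {..<Suc ?i}))"
      and fr': "frame (loop_vars - {v_mask, v_i, v_rem}) {a_mark, a_list} \<sigma> \<tau>"
      using \<open>R \<tau>\<close> unfolding R_def by blast
    define \<upsilon> where "\<upsilon> = \<tau>\<lparr>vr := (vr \<tau>)(v_mask := 2 ^ Suc ?i, v_i := Suc ?i, v_rem := k)\<rparr>"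
    have v: "vr \<tau> v_mask = 2 ^ ?i" "vr \<tau> v_i = ?i" "vr \<tau> v_rem = Suc k" "vr \<tau> v_one = 1"
      using fr' i vars by (simp_all add: frame_def)
    have "listed N K \<upsilon> S'"
      using S'(1) by (simp add: listed_def \<upsilon>_def)
    moreover have "frame loop_vars {a_mark, a_list} \<sigma>0 \<upsilon>"
      using fr fr' by (simp add: frame_def \<upsilon>_def)
    ultimately have "count_inv K a \<sigma>0 k \<upsilon>"
      unfolding count_inv_def using S' i by (intro conjI exI[of _ S']) (simp_all add: \<upsilon>_def)
    then have "wp advance (count_inv K a \<sigma>0 k) \<tau>"
      using v big n_less_N(2)[OF i(4)] n_less_N(4)[OF i(4)]
      by (simp add: advance_def \<upsilon>_def mult_2)
    then show ?thesis
      by (rule ok_mono[OF ok_wp]) (simp_all add: advance_def)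
  qed
  have "ok vertex_step (5 + (1 + (20 + (3 + Suc K * 52)) + 15)) (count_inv K a \<sigma>0 k) \<sigma>"
    unfolding vertex_step_def by (rule ok_seq[OF 1], rule ok_seq, use 2 in simp, rule 3)
  then show ?thesis
    by (rule ok_mono) auto
qed

section \<open>Erasing the marks\<close>

definition unmark_inv :: "state \<Rightarrow> nat \<Rightarrow> state \<Rightarrow> bool" where
  "unmark_inv \<sigma>0 k \<sigma> \<longleftrightarrow> frame {v_u, v_i, v_rem} {a_mark} \<sigma>0 \<sigma> \<and>
     vr \<sigma> v_rem = k \<and> vr \<sigma> v_i + k = vr \<sigma>0 v_len \<and>
     (\<forall>u. ar \<sigma> a_mark u = (if u \<in> ar \<sigma>0 a_list ` {vr \<sigma> v_i..<vr \<sigma>0 v_len} then 1 else 0))"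

lemma unmark_step:
  assumes base: "base \<sigma>0" and S: "listed N K \<sigma>0 S" and inv: "unmark_inv \<sigma>0 (Suc k) \<sigma>"
  shows "ok unmark_step 20 (unmark_inv \<sigma>0 k) \<sigma>"
proof -
  let ?i = "vr \<sigma> v_i"
  have fr: "\<forall>x. x \<notin> {v_u, v_i, v_rem} \<longrightarrow> vr \<sigma> x = vr \<sigma>0 x"
    "\<forall>a. a \<notin> {a_mark} \<longrightarrow> ar \<sigma> a = ar \<sigma>0 a" "inq \<sigma> = inq \<sigma>0" "outq \<sigma> = outq \<sigma>0"
    using inv by (simp_all add: unmark_inv_def frame_def)
  have i: "?i + Suc k = vr \<sigma>0 v_len" "vr \<sigma> v_rem = Suc k"
    using inv by (auto simp: unmark_inv_def)
  have vars: "vr \<sigma> v_one = 1" "vr \<sigma> v_zero = 0" "vr \<sigma> v_len = vr \<sigma>0 v_len"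
    using base fr by (simp_all add: base_def)
  define u where "u = ar \<sigma>0 a_list ?i"
  have "u \<in> S"
    using S i by (auto simp: u_def listed_def)
  then have u: "u < N"
    using S by (auto simp: listed_def)
  have inj: "inj_on (ar \<sigma>0 a_list) {..<vr \<sigma>0 v_len}"
    using S by (simp add: listed_def)
  \<comment> \<open>The list has no repetitions, so clearing this mark leaves those of the later
    entries in place.\<close>
  have "u \<notin> ar \<sigma>0 a_list ` {Suc ?i..<vr \<sigma>0 v_len}"
  proof
    assume "u \<in> ar \<sigma>0 a_list ` {Suc ?i..<vr \<sigma>0 v_len}"
    then obtain j where "u = ar \<sigma>0 a_list j" "j \<in> {Suc ?i..<vr \<sigma>0 v_len}" ..
    then show False
      using inj_onD[OF inj, of ?i j] i by (simp add: u_def)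
  qed
  moreover have "{?i..<vr \<sigma>0 v_len} = insert ?i {Suc ?i..<vr \<sigma>0 v_len}"
    using i by auto
  ultimately have mark: "((ar \<sigma> a_mark)(u := 0)) x =
      (if x \<in> ar \<sigma>0 a_list ` {Suc ?i..<vr \<sigma>0 v_len} then 1 else 0)" for x
    using inv unfolding unmark_inv_def by (simp add: u_def)
  define \<upsilon> where "\<upsilon> = \<sigma>\<lparr>ar := (ar \<sigma>)(a_mark := (ar \<sigma> a_mark)(u := 0)),
    vr := (vr \<sigma>)(v_u := u, v_i := Suc ?i, v_rem := k)\<rparr>"
  have "frame {v_u, v_i, v_rem} {a_mark} \<sigma>0 \<upsilon>"
    using fr by (simp add: frame_def \<upsilon>_def)
  then have "unmark_inv \<sigma>0 k \<upsilon>"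
    unfolding unmark_inv_def using mark i by (simp add: \<upsilon>_def)
  moreover have "?i < N" "Suc ?i < 2 ^ w"
    using listed_card[OF S] i big by auto
  ultimately have "wp unmark_step (unmark_inv \<sigma>0 k) \<sigma>"
    using u fr by (simp add: unmark_step_def \<upsilon>_def i vars u_def)
  then show ?thesis
    by (rule ok_mono[OF ok_wp]) (simp_all add: unmark_step_def)
qed

lemma unmark_loop:
  assumes base: "base \<sigma>" and S: "listed N K \<sigma> S" and i: "vr \<sigma> v_i = 0" "vr \<sigma> v_rem = vr \<sigma> v_len"
  shows "ok (While v_rem unmark_step) (3 + Suc K * 21)
    (\<lambda>\<tau>. frame {v_u, v_i, v_rem} {a_mark} \<sigma> \<tau> \<and> (\<forall>u. ar \<tau> a_mark u = 0)) \<sigma>"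
proof (rule ok_mono[OF ok_for[where I = "unmark_inv \<sigma>" and m = "vr \<sigma> v_len" and T = 20]])
  show "unmark_inv \<sigma> (vr \<sigma> v_len) \<sigma>"
    using i S by (auto simp: unmark_inv_def frame_def listed_def atLeast0LessThan)
  show "3 + vr \<sigma> v_len * (20 + 1) \<le> 3 + Suc K * 21"
    using S by (simp add: listed_def)
next
  fix k \<tau>
  assume "unmark_inv \<sigma> (Suc k) \<tau>"
  then show "vr \<tau> v_rem > 0 \<and> ok unmark_step 20 (unmark_inv \<sigma> k) \<tau>"
    using unmark_step[OF base S, of k \<tau>] by (simp add: unmark_inv_def)
qed (simp_all add: unmark_inv_def)

lemma inj_bits: "inj_on bits S"
  using bits_inject by (simp add: inj_on_def)

text \<open>Without overflow the list is complete; with overflow it holds \<open>K + 1\<close>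
  distinct genuine unions. Either way its length is the truncated count, and the marks are clean
  again for the next set.\<close>

lemma count:
  assumes base: "base \<sigma>" and K: "vr \<sigma> v_K = K" "K \<ge> 1" and a: "vr \<sigma> v_A = a" "a < N"
    and mark: "\<forall>u. ar \<sigma> a_mark u = 0"
  shows "ok count (300 * (n * K))
    (\<lambda>\<tau>. frame (insert v_compl loop_vars) {a_mark, a_list} \<sigma> \<tau> \<and> vr \<tau> v_compl = N - 1 - a \<and>
      (\<forall>u. ar \<tau> a_mark u = 0) \<and> vr \<tau> v_len = min (Suc K) (cut_card {..<n} E (bits a))) \<sigma>"
proof -
  let ?C = "{..<n} - bits a"
  let ?X = "insert v_compl loop_vars"
  have vars: "vr \<sigma> v_one = 1" "vr \<sigma> v_zero = 0" "vr \<sigma> v_full = N - 1" "vr \<sigma> v_n = n"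
    using base by (simp_all add: base_def)
  define \<sigma>1 where "\<sigma>1 = \<sigma>\<lparr>
    ar := (ar \<sigma>)(a_list := (ar \<sigma> a_list)(0 := 0), a_mark := (ar \<sigma> a_mark)(0 := 1)),
    vr := (vr \<sigma>)(v_compl := N - 1 - a, v_len := 1, v_mask := 1, v_i := 0, v_rem := n)\<rparr>"
  have NN: "0 < N" "n < N"
    using n_less_N(1) by simp_all
  have 1: "wp count_init (\<lambda>\<tau>. \<tau> = \<sigma>1) \<sigma>"
    using big NN by (simp add: count_init_def \<sigma>1_def vars a)
  have base1: "base \<sigma>1" and K1: "vr \<sigma>1 v_K = K" "vr \<sigma>1 v_compl = N - 1 - a"
    and fr1: "frame ?X {a_mark, a_list} \<sigma> \<sigma>1"
    using base K by (simp_all add: base_def \<sigma>1_def frame_def)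
  have "listed N K \<sigma>1 {0}"
    using NN mark by (auto simp: listed_def \<sigma>1_def inj_on_def)
  then have inv: "count_inv K a \<sigma>1 n \<sigma>1"
    unfolding count_inv_def by (intro conjI exI[of _ "{0}"]) (simp_all add: \<sigma>1_def frame_def)
  have 2: "ok (While v_rem vertex_step) (3 + n * (44 + Suc K * 52 + 1)) (count_inv K a \<sigma>1 0) \<sigma>1"
    using inv
  proof (rule ok_for)
    fix k \<tau>
    assume "count_inv K a \<sigma>1 (Suc k) \<tau>"
    then show "vr \<tau> v_rem > 0 \<and> ok vertex_step (44 + Suc K * 52) (count_inv K a \<sigma>1 k) \<tau>"
      using vertex_step[OF base1 K1(1) a(2) K1(2)] by (simp add: count_inv_def)
  qed (simp add: count_inv_def)
  define Q where "Q \<tau> \<longleftrightarrow> frame ?X {a_mark, a_list} \<sigma> \<tau> \<and> vr \<tau> v_compl = N - 1 - a \<and>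
      (\<forall>u. ar \<tau> a_mark u = 0) \<and> vr \<tau> v_len = min (Suc K) (cut_card {..<n} E (bits a))" for \<tau>
  have 3: "ok (unmark_init ;; While v_rem unmark_step) (10 + (3 + Suc K * 21)) Q \<tau>"
    if inv': "count_inv K a \<sigma>1 0 \<tau>" for \<tau>
  proof -
    have i: "vr \<tau> v_i = n" and fr: "frame loop_vars {a_mark, a_list} \<sigma>1 \<tau>"
      using that by (simp_all add: count_inv_def)
    have "bits a \<inter> {..<n} = bits a"
      using a(2) by (auto simp: less_N_iff)
    then have eq: "cut_unions E ?C (bits a \<inter> {..<vr \<tau> v_i}) = nbhd_unions {..<n} E (bits a)"
      by (simp only: i nbhd_unions_eq)
    obtain S where S: "listed N K \<tau> S" "bits ` S \<subseteq> nbhd_unions {..<n} E (bits a)"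
      "vr \<tau> v_len \<le> K \<longrightarrow> bits ` S = nbhd_unions {..<n} E (bits a)"
      using inv' unfolding count_inv_def eq by blast
    have "card (bits ` S) = vr \<tau> v_len"
      using listed_card[OF S(1)] by (simp add: card_image[OF inj_bits])
    moreover from this have "vr \<tau> v_len \<le> cut_card {..<n} E (bits a)"
      unfolding cut_card_def using card_mono[OF finite_nbhd_unions S(2)] by simp
    moreover have "vr \<tau> v_len \<le> Suc K"
      using S(1) by (simp add: listed_def)
    ultimately have len: "vr \<tau> v_len = min (Suc K) (cut_card {..<n} E (bits a))"
      using S(3) by (cases "vr \<tau> v_len \<le> K") (auto simp: cut_card_def)
    define \<tau>1 where "\<tau>1 = \<tau>\<lparr>vr := (vr \<tau>)(v_i := 0, v_rem := vr \<tau> v_len)\<rparr>"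
    have "vr \<tau> v_zero = 0"
      using fr base1 by (simp add: frame_def base_def)
    then have wp: "wp unmark_init (\<lambda>\<upsilon>. \<upsilon> = \<tau>1) \<tau>"
      using listed_card[OF S(1)] big by (simp add: unmark_init_def \<tau>1_def)
    have S': "listed N K \<tau>1 S"
      using S(1) by (simp add: listed_def \<tau>1_def)
    have fr': "frame ?X {a_mark, a_list} \<sigma> \<tau>1"
      using fr fr1 by (simp add: frame_def \<tau>1_def)
    then have base': "base \<tau>1"
      using base by (simp add: frame_def base_def)
    have compl: "vr \<tau>1 v_compl = N - 1 - a"
      using fr K1 by (simp add: frame_def \<tau>1_def)
    have "ok (While v_rem unmark_step) (3 + Suc K * 21) Q \<tau>1"
    proof (rule ok_mono[OF unmark_loop[OF base' S']])
      fix \<upsilon>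
      assume *: "frame {v_u, v_i, v_rem} {a_mark} \<tau>1 \<upsilon> \<and> (\<forall>u. ar \<upsilon> a_mark u = 0)"
      then have "frame ?X {a_mark, a_list} \<sigma> \<upsilon>"
        by (intro frame_trans[OF fr' frame_mono[of "{v_u, v_i, v_rem}" "{a_mark}"]]) auto
      moreover have "vr \<upsilon> v_compl = N - 1 - a" "vr \<upsilon> v_len = vr \<tau> v_len"
        using * compl by (simp_all add: frame_def \<tau>1_def)
      ultimately show "Q \<upsilon>"
        using * len by (simp add: Q_def)
    qed (simp_all add: \<tau>1_def)
    then have "ok (unmark_init ;; While v_rem unmark_step) (cost unmark_init + (3 + Suc K * 21)) Q \<tau>"
      by (intro ok_wp_seq[OF wp]) simp
    then show ?thesis
      by (simp add: unmark_init_def)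
  qed
  have "ok count (cost count_init + (3 + n * (44 + Suc K * 52 + 1) + (10 + (3 + Suc K * 21)))) Q \<sigma>"
    unfolding count_def by (rule ok_wp_seq[OF 1], rule ok_seq, use 2 in simp, rule 3)
  moreover have "cost count_init + (3 + n * (44 + Suc K * 52 + 1) + (10 + (3 + Suc K * 21))) \<le> 300 * (n * K)"
  proof -
    \<comment> \<open>\<open>1\<close>, \<open>n\<close> and \<open>K\<close> are all at most
      \<open>n * K\<close>, to which every lower-order term is charged.\<close>
    define p where "p = n * K"
    have "n \<le> p" "K \<le> p" "1 \<le> p"
      using K(2) n by (auto simp: p_def)
    moreover have "n * (44 + Suc K * 52 + 1) = 97 * n + 52 * p"
      by (simp add: p_def algebra_simps)
    ultimately show ?thesis
      unfolding p_def[symmetric] by (simp add: count_init_def)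
  qed
  ultimately show ?thesis
    by (rule ok_mono) (simp add: Q_def)
qed

end

section \<open>The recursion over all vertex sets\<close>

text \<open>\<open>K + 1\<close> stands for the minimum over no candidates.\<close>

definition best_init :: com where
  "best_init =
    Prim (PAdd v_best v_K v_one) ;;
    Prim (PSet v_mask 1) ;;
    Prim (PSet v_i 0) ;;
    Prim (PAdd v_rem v_n v_zero)"

text \<open>With truncated subtraction, \<open>a - (a - b)\<close> is the minimum of \<open>a\<close> and \<open>b\<close>, and
  \<open>a + (b - a)\<close> the maximum.\<close>

definition best_step :: com where
  "best_step =
    Prim (PAnd v_u v_mask v_compl) ;;
    Unless v_u
      (Prim (PSub v_t v_A v_mask) ;;
       Prim (PGet v_t a_val v_t) ;;
       Prim (PSub v_t v_best v_t) ;;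
       Prim (PSub v_best v_best v_t)) ;;
    advance"

definition record_value :: com where
  "record_value =
    Prim (PSub v_t v_len v_best) ;;
    Prim (PAdd v_best v_best v_t) ;;
    Prim (PUpd a_val v_A v_best) ;;
    Prim (PAdd v_A v_A v_one) ;;
    Prim (PSub v_left v_left v_one)"

definition subset_step :: com where
  "subset_step = count ;; (best_init ;; While v_rem best_step) ;; record_value"

context alg
begin

abbreviation best_vars :: "nat set" where
  "best_vars \<equiv> {v_u, v_t, v_best, v_mask, v_i, v_rem}"

text \<open>Describing the minimum by the thresholds it meets also covers the case without
  candidates, since \<open>K + 1\<close> exceeds every \<open>M \<le> K\<close>.\<close>

definition best_inv :: "nat \<Rightarrow> nat \<Rightarrow> state \<Rightarrow> nat \<Rightarrow> state \<Rightarrow> bool" where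
  "best_inv K a \<sigma>0 k \<sigma> \<longleftrightarrow> frame best_vars {} \<sigma>0 \<sigma> \<and>
     vr \<sigma> v_rem = k \<and> vr \<sigma> v_i + k = n \<and> vr \<sigma> v_mask = 2 ^ vr \<sigma> v_i \<and> vr \<sigma> v_best \<le> Suc K \<and>
     (\<forall>M\<le>K. vr \<sigma> v_best \<le> M \<longleftrightarrow> (\<exists>v<vr \<sigma> v_i. bit a v \<and> ar \<sigma>0 a_val (a - 2 ^ v) \<le> M))"

lemma best_step:
  assumes base: "base \<sigma>0" and a: "a < N" "vr \<sigma>0 v_A = a" "vr \<sigma>0 v_compl = N - 1 - a"
    and inv: "best_inv K a \<sigma>0 (Suc k) \<sigma>"
  shows "ok best_step 41 (best_inv K a \<sigma>0 k) \<sigma>"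
proof -
  let ?i = "vr \<sigma> v_i"
  have fr: "\<forall>x. x \<notin> best_vars \<longrightarrow> vr \<sigma> x = vr \<sigma>0 x"
    "\<forall>a. a \<notin> {} \<longrightarrow> ar \<sigma> a = ar \<sigma>0 a" "inq \<sigma> = inq \<sigma>0" "outq \<sigma> = outq \<sigma>0"
    using inv by (simp_all add: best_inv_def frame_def)
  have i: "?i + Suc k = n" "vr \<sigma> v_rem = Suc k" "vr \<sigma> v_mask = 2 ^ ?i" "?i < n"
    using inv by (auto simp: best_inv_def)
  have best: "vr \<sigma> v_best \<le> Suc K"
    "\<And>M. M \<le> K \<Longrightarrow> vr \<sigma> v_best \<le> M \<longleftrightarrow> (\<exists>v<?i. bit a v \<and> ar \<sigma>0 a_val (a - 2 ^ v) \<le> M)"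
    using inv unfolding best_inv_def by blast+
  have vars: "vr \<sigma> v_A = a" "vr \<sigma> v_compl = N - 1 - a" "vr \<sigma> v_one = 1" "vr \<sigma> v_zero = 0"
    using base fr a by (simp_all add: base_def)
  define u where "u = Bit_Operations.and (2 ^ ?i) (N - 1 - a)"
  have u: "u = 0 \<longleftrightarrow> bit a ?i"
    using bit_compl[OF a(1)] i(4) by (simp add: u_def and_power_eq_0_iff)
  define x where "x = ar \<sigma>0 a_val (a - 2 ^ ?i)"
  have next_inv: "best_inv K a \<sigma>0 k \<tau>"
    if "frame best_vars {} \<sigma> \<tau>" "vr \<tau> v_i = Suc ?i" "vr \<tau> v_mask = 2 ^ Suc ?i" "vr \<tau> v_rem = k"
      "vr \<tau> v_best = (if bit a ?i then min (vr \<sigma> v_best) x else vr \<sigma> v_best)" for \<tau>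
  proof -
    have "frame best_vars {} \<sigma>0 \<tau>"
      by (rule frame_trans[OF _ that(1)]) (use inv in \<open>simp add: best_inv_def\<close>)
    moreover have "vr \<tau> v_best \<le> M \<longleftrightarrow> (\<exists>v<Suc ?i. bit a v \<and> ar \<sigma>0 a_val (a - 2 ^ v) \<le> M)"
      if "M \<le> K" for M
      using best(2)[OF that] \<open>vr \<tau> v_best = _\<close> by (auto simp: less_Suc_eq x_def min_le_iff_disj)
    ultimately show ?thesis
      unfolding best_inv_def using that i best(1) by (simp add: min_le_iff_disj)
  qed
  have bounds: "a - 2 ^ ?i < N" "2 ^ ?i + 2 ^ ?i < (2::nat) ^ w" "Suc ?i < 2 ^ w"
    using a(1) big n_less_N(2,4)[OF i(4)] by auto
  have "wp best_step (best_inv K a \<sigma>0 k) \<sigma>"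
  proof (cases "bit a ?i")
    case True
    have "best_inv K a \<sigma>0 k \<tau>"
      if "\<tau> = \<sigma>\<lparr>vr := (vr \<sigma>)(v_u := 0, v_t := vr \<sigma> v_best - x, v_best := vr \<sigma> v_best - (vr \<sigma> v_best - x),
        v_mask := 2 ^ ?i + 2 ^ ?i, v_i := Suc ?i, v_rem := k)\<rparr>" for \<tau>
      by (rule next_inv) (use that True in \<open>auto simp: frame_def mult_2 min_def\<close>)
    then show ?thesis
      using True u bounds fr by (simp add: best_step_def advance_def vars i u_def x_def)
  next
    case False
    have "best_inv K a \<sigma>0 k \<tau>"
      if "\<tau> = \<sigma>\<lparr>vr := (vr \<sigma>)(v_u := u, v_mask := 2 ^ ?i + 2 ^ ?i, v_i := Suc ?i, v_rem := k)\<rparr>" for \<tau>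
      by (rule next_inv) (use that False in \<open>auto simp: frame_def mult_2\<close>)
    then show ?thesis
      using False u bounds fr by (simp add: best_step_def advance_def vars i u_def)
  qed
  then show ?thesis
    by (rule ok_mono[OF ok_wp]) (simp_all add: best_step_def advance_def)
qed

lemma best:
  assumes base: "base \<sigma>" and K: "vr \<sigma> v_K = K" "K \<le> 2 * N"
    and a: "a < N" "vr \<sigma> v_A = a" "vr \<sigma> v_compl = N - 1 - a"
  shows "ok (best_init ;; While v_rem best_step) (23 + n * 42)
    (\<lambda>\<tau>. frame best_vars {} \<sigma> \<tau> \<and> vr \<tau> v_best \<le> Suc K \<and>
      (\<forall>M\<le>K. vr \<tau> v_best \<le> M \<longleftrightarrow> (\<exists>v. bit a v \<and> ar \<sigma> a_val (a - 2 ^ v) \<le> M))) \<sigma>"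
proof -
  define \<sigma>1 where
    "\<sigma>1 = \<sigma>\<lparr>vr := (vr \<sigma>)(v_best := Suc K, v_mask := 1, v_i := 0, v_rem := n)\<rparr>"
  have vars: "vr \<sigma> v_one = 1" "vr \<sigma> v_zero = 0" "vr \<sigma> v_n = n"
    using base by (simp_all add: base_def)
  have wp: "wp best_init (\<lambda>\<tau>. \<tau> = \<sigma>1) \<sigma>"
    using big K n_less_N(1) by (simp add: best_init_def \<sigma>1_def vars)
  have base1: "base \<sigma>1" and a1: "vr \<sigma>1 v_A = a" "vr \<sigma>1 v_compl = N - 1 - a"
    and fr1: "frame best_vars {} \<sigma> \<sigma>1"
    using base a by (simp_all add: base_def \<sigma>1_def frame_def)
  have inv: "best_inv K a \<sigma>1 n \<sigma>1"
    by (simp add: best_inv_def frame_def \<sigma>1_def)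
  have loop: "ok (While v_rem best_step) (3 + n * (41 + 1)) (best_inv K a \<sigma>1 0) \<sigma>1"
    using inv
  proof (rule ok_for)
    fix k \<tau>
    assume "best_inv K a \<sigma>1 (Suc k) \<tau>"
    then show "vr \<tau> v_rem > 0 \<and> ok best_step 41 (best_inv K a \<sigma>1 k) \<tau>"
      using best_step[OF base1 a(1) a1] by (simp add: best_inv_def)
  qed (simp add: best_inv_def)
  have "ok (best_init ;; While v_rem best_step) (cost best_init + (3 + n * (41 + 1))) (best_inv K a \<sigma>1 0) \<sigma>"
    by (rule ok_wp_seq[OF wp]) (use loop in simp)
  then show ?thesis
  proof (rule ok_mono)
    fix \<tau>
    assume *: "best_inv K a \<sigma>1 0 \<tau>"
    have bit: "v < n" if "bit a v" for v
      using a(1) that unfolding less_N_iff by blast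
    have "frame best_vars {} \<sigma> \<tau>"
      using fr1 by (rule frame_trans) (use * in \<open>simp add: best_inv_def\<close>)
    moreover have "\<forall>M\<le>K. vr \<tau> v_best \<le> M \<longleftrightarrow> (\<exists>v. bit a v \<and> ar \<sigma> a_val (a - 2 ^ v) \<le> M)"
    proof -
      have "\<forall>M\<le>K. vr \<tau> v_best \<le> M \<longleftrightarrow> (\<exists>v<n. bit a v \<and> ar \<sigma> a_val (a - 2 ^ v) \<le> M)"
        using * by (simp add: best_inv_def \<sigma>1_def)
      then show ?thesis
        using bit by blast
    qed
    moreover have "vr \<tau> v_best \<le> Suc K"
      using * by (simp add: best_inv_def)
    ultimately show "frame best_vars {} \<sigma> \<tau> \<and> vr \<tau> v_best \<le> Suc K \<and>
      (\<forall>M\<le>K. vr \<tau> v_best \<le> M \<longleftrightarrow> (\<exists>v. bit a v \<and> ar \<sigma> a_val (a - 2 ^ v) \<le> M))"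
      by (intro conjI)
  qed (simp add: best_init_def)
qed

text \<open>The stored value of a set is the least \<open>M\<close> with \<^const>\<open>reach\<close>, or \<open>K + 1\<close> if that exceeds \<open>K\<close>.\<close>

definition table :: "nat \<Rightarrow> nat \<Rightarrow> state \<Rightarrow> bool" where
  "table K a \<sigma> \<longleftrightarrow> (\<forall>b<a. ar \<sigma> a_val b \<le> Suc K \<and>
     (\<forall>M\<le>K. ar \<sigma> a_val b \<le> M \<longleftrightarrow> reach {..<n} E M (bits b)))"

abbreviation subset_vars :: "nat set" where
  "subset_vars \<equiv> {v_A, v_left, v_compl, v_mask, v_i, v_rem, v_len, v_nb, v_j, v_rem2, v_u, v_m, v_g,
     v_best, v_t}"

text \<open>The loop starts at the set encoded by 1, because the entry of the empty set is preset to
  0. In numerical order \<open>a - 2 ^ v\<close> precedes \<open>a\<close>, so the entries that a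
  step reads are already filled.\<close>

definition subset_inv :: "nat \<Rightarrow> state \<Rightarrow> nat \<Rightarrow> state \<Rightarrow> bool" where
  "subset_inv K \<sigma>0 k \<sigma> \<longleftrightarrow> frame subset_vars {a_val, a_mark, a_list} \<sigma>0 \<sigma> \<and>
     vr \<sigma> v_left = k \<and> vr \<sigma> v_A + k = N \<and> vr \<sigma> v_A \<ge> 1 \<and> (\<forall>u. ar \<sigma> a_mark u = 0) \<and>
     table K (vr \<sigma> v_A) \<sigma>"

lemma reach_bits_iff:
  assumes "0 < a" "a < N"
  shows "reach {..<n} E M (bits a) \<longleftrightarrow> cut_card {..<n} E (bits a) \<le> M \<and>
    (\<exists>v. bit a v \<and> reach {..<n} E M (bits (a - 2 ^ v)))"
proof -
  have "bits a \<noteq> {}"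
    using assms(1) bits_inject[of a 0] by simp
  moreover have "bits a \<subseteq> {..<n}"
    using assms(2) unfolding less_N_iff .
  ultimately have "reach {..<n} E M (bits a) \<longleftrightarrow> cut_card {..<n} E (bits a) \<le> M \<and>
    (\<exists>v\<in>bits a. reach {..<n} E M (bits a - {v}))"
    by (rule reach_iff)
  also have "(\<exists>v\<in>bits a. reach {..<n} E M (bits a - {v})) \<longleftrightarrow>
    (\<exists>v. bit a v \<and> reach {..<n} E M (bits (a - 2 ^ v)))"
    using bits_remove[of a] by (metis mem_Collect_eq)
  finally show ?thesis .
qed

lemma subset_step:
  assumes base: "base \<sigma>0" and K: "vr \<sigma>0 v_K = K" "1 \<le> K" "K \<le> 2 * N"
    and inv: "subset_inv K \<sigma>0 (Suc k) \<sigma>"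
  shows "ok subset_step (400 * (n * K)) (subset_inv K \<sigma>0 k) \<sigma>"
proof -
  define a where "a = vr \<sigma> v_A"
  let ?c = "cut_card {..<n} E (bits a)"
  let ?Y = "{a_val, a_mark, a_list}"
  have fr: "frame subset_vars ?Y \<sigma>0 \<sigma>" and left: "vr \<sigma> v_left = Suc k" and a: "a + Suc k = N" "1 \<le> a"
    and mark: "\<forall>u. ar \<sigma> a_mark u = 0" and table: "table K a \<sigma>"
    using inv by (simp_all add: subset_inv_def a_def)
  have "a < N"
    using a by simp
  have base': "base \<sigma>" "vr \<sigma> v_K = K"
    using base fr K by (simp_all add: base_def frame_def)
  define R1 where "R1 \<tau> \<longleftrightarrow> frame subset_vars {a_mark, a_list} \<sigma> \<tau> \<and> vr \<tau> v_compl = N - 1 - a \<and>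
      vr \<tau> v_A = a \<and> vr \<tau> v_left = Suc k \<and>
      (\<forall>u. ar \<tau> a_mark u = 0) \<and> vr \<tau> v_len = min (Suc K) ?c" for \<tau>
  define R2 where "R2 \<tau> \<longleftrightarrow> R1 \<tau> \<and> vr \<tau> v_best \<le> Suc K \<and>
    (\<forall>M\<le>K. vr \<tau> v_best \<le> M \<longleftrightarrow> (\<exists>v. bit a v \<and> ar \<sigma> a_val (a - 2 ^ v) \<le> M))" for \<tau>
  have 1: "ok count (300 * (n * K)) R1 \<sigma>"
  proof (rule ok_mono[OF count[OF base' K(2) a_def[symmetric] \<open>a < N\<close> mark]])
    fix \<tau>
    assume *: "frame (insert v_compl loop_vars) {a_mark, a_list} \<sigma> \<tau> \<and> vr \<tau> v_compl = N - 1 - a \<and>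
      (\<forall>u. ar \<tau> a_mark u = 0) \<and> vr \<tau> v_len = min (Suc K) ?c"
    then have "frame subset_vars {a_mark, a_list} \<sigma> \<tau>"
      by (elim conjE) (rule frame_mono[of "insert v_compl loop_vars" "{a_mark, a_list}"], auto)
    moreover have "vr \<tau> v_A = a" "vr \<tau> v_left = Suc k"
      using * left by (simp_all add: frame_def a_def)
    ultimately show "R1 \<tau>"
      using * by (simp add: R1_def)
  qed simp
  have 2: "ok (best_init ;; While v_rem best_step) (23 + n * 42) R2 \<tau>" if "R1 \<tau>" for \<tau>
  proof -
    have fr': "frame subset_vars {a_mark, a_list} \<sigma> \<tau>"
      using \<open>R1 \<tau>\<close> by (simp add: R1_def)
    have base1: "base \<tau>" "vr \<tau> v_K = K"
      using base' fr' by (simp_all add: base_def frame_def)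
    have val: "ar \<tau> a_val = ar \<sigma> a_val"
      using fr' by (simp add: frame_def)
    show ?thesis
    proof (rule ok_mono[OF best[OF base1 K(3) \<open>a < N\<close>]])
      fix \<upsilon>
      assume *: "frame best_vars {} \<tau> \<upsilon> \<and> vr \<upsilon> v_best \<le> Suc K \<and>
        (\<forall>M\<le>K. vr \<upsilon> v_best \<le> M \<longleftrightarrow> (\<exists>v. bit a v \<and> ar \<tau> a_val (a - 2 ^ v) \<le> M))"
      then have "frame subset_vars {a_mark, a_list} \<tau> \<upsilon>"
        by (elim conjE) (rule frame_mono[of best_vars "{}"], auto)
      then have "R1 \<upsilon>"
        unfolding R1_def using * \<open>R1 \<tau>\<close> frame_trans[OF fr'] by (simp add: R1_def frame_def)
      then show "R2 \<upsilon>"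
        unfolding R2_def using * unfolding val by (intro conjI) simp_all
    qed (use \<open>R1 \<tau>\<close> in \<open>simp_all add: R1_def\<close>)
  qed
  have 3: "ok record_value 25 (subset_inv K \<sigma>0 k) \<tau>" if "R2 \<tau>" for \<tau>
  proof -
    have r: "frame subset_vars {a_mark, a_list} \<sigma> \<tau>" "vr \<tau> v_A = a" "vr \<tau> v_left = Suc k"
        "\<forall>u. ar \<tau> a_mark u = 0" "vr \<tau> v_len = min (Suc K) ?c"
      and best: "vr \<tau> v_best \<le> Suc K"
        "\<And>M. M \<le> K \<Longrightarrow> vr \<tau> v_best \<le> M \<longleftrightarrow> (\<exists>v. bit a v \<and> ar \<sigma> a_val (a - 2 ^ v) \<le> M)"
      using \<open>R2 \<tau>\<close> unfolding R2_def R1_def by blast+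
    define x where "x = vr \<tau> v_best + (vr \<tau> v_len - vr \<tau> v_best)"
    have x: "x = max (vr \<tau> v_best) (min (Suc K) ?c)"
      using r(5) by (simp add: x_def)
    have one: "vr \<tau> v_one = 1"
      using r(1) base'(1) by (simp add: frame_def base_def)
    define \<upsilon> where "\<upsilon> = \<tau>\<lparr>ar := (ar \<tau>)(a_val := (ar \<tau> a_val)(a := x)),
      vr := (vr \<tau>)(v_t := vr \<tau> v_len - vr \<tau> v_best, v_best := x, v_A := Suc a, v_left := k)\<rparr>"
    have val: "ar \<upsilon> a_val b = (if b = a then x else ar \<sigma> a_val b)" for b
      using r(1) by (simp add: \<upsilon>_def frame_def)
    \<comment> \<open>Thresholds up to \<open>K\<close> do not see the truncation at
      \<open>K + 1\<close>, so the maximum meets \<open>M\<close> exactly if the cut and some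
      predecessor do.\<close>
    have step: "x \<le> M \<longleftrightarrow> reach {..<n} E M (bits a)" if "M \<le> K" for M
    proof -
      \<comment> \<open>This holds for every \<open>v\<close>: as \<open>a \<ge> 1\<close>,
        subtracting \<open>2 ^ v\<close> always yields a smaller index, which is already
        tabulated.\<close>
      have "ar \<sigma> a_val (a - 2 ^ v) \<le> M \<longleftrightarrow> reach {..<n} E M (bits (a - 2 ^ v))" for v
      proof -
        have "a - 2 ^ v < a"
          using a by simp
        then show ?thesis
          using table \<open>M \<le> K\<close> unfolding table_def by blast
      qed
      then show ?thesis
        using reach_bits_iff[of a M] a \<open>a < N\<close> best(2)[OF that] that by (auto simp: x)
    qed
    have "table K (Suc a) \<upsilon>"
      unfolding table_def
    proof (intro allI impI)
      fix b
      assume "b < Suc a"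
      then show "ar \<upsilon> a_val b \<le> Suc K \<and>
        (\<forall>M\<le>K. ar \<upsilon> a_val b \<le> M \<longleftrightarrow> reach {..<n} E M (bits b))"
        using step best(1) table unfolding table_def val by (cases "b = a") (auto simp: x)
    qed
    moreover have "frame subset_vars ?Y \<sigma>0 \<upsilon>"
      using fr r(1) by (simp add: frame_def \<upsilon>_def)
    ultimately have "subset_inv K \<sigma>0 k \<upsilon>"
      unfolding subset_inv_def using a r(4) by (simp add: \<upsilon>_def)
    moreover have "x < 2 ^ w" "Suc a < 2 ^ w"
      using x best(1) K big \<open>a < N\<close> by auto
    ultimately have "wp record_value (subset_inv K \<sigma>0 k) \<tau>"
      using r one \<open>a < N\<close> by (simp add: record_value_def \<upsilon>_def x_def)
    then show ?thesis
      by (rule ok_mono[OF ok_wp]) (simp_all add: record_value_def)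
  qed
  have "ok subset_step (300 * (n * K) + (23 + n * 42 + 25)) (subset_inv K \<sigma>0 k) \<sigma>"
    unfolding subset_step_def by (rule ok_seq[OF 1], rule ok_seq, erule 2, rule 3)
  moreover have "n \<le> n * K" "1 \<le> n * K"
    using K(2) n by auto
  then have "300 * (n * K) + (23 + n * 42 + 25) \<le> 400 * (n * K)"
    by linarith
  ultimately show ?thesis
    by (rule ok_mono)
qed

end

section \<open>Doubling the truncation bound\<close>

definition round_init :: com where
  "round_init =
    Prim (PUpd a_val v_zero v_zero) ;;
    Prim (PSet v_A 1) ;;
    Prim (PAdd v_left v_full v_zero)"

text \<open>\<open>v_go\<close> is positive exactly if the value of the full set was truncated. The
  threshold is doubled even after the last round, so the output phase compares with the saved
  \<open>v_W\<close>.\<close>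

definition round_end :: com where
  "round_end =
    Prim (PGet v_W a_val v_full) ;;
    Prim (PSub v_go v_W v_K) ;;
    Prim (PAdd v_K v_K v_K)"

definition search_round :: com where
  "search_round = round_init ;; While v_left subset_step ;; round_end"

definition search :: com where
  "search = Prim (PSet v_go 1) ;; While v_go search_round"

context alg
begin

abbreviation tables :: "nat set" where
  "tables \<equiv> {a_val, a_mark, a_list}"

abbreviation round_vars :: "nat set" where
  "round_vars \<equiv> insert v_W (insert v_go (insert v_K subset_vars))"

lemma search_round:
  assumes base: "base \<sigma>" and K: "vr \<sigma> v_K = K" "1 \<le> K" "K \<le> N" and mark: "\<forall>u. ar \<sigma> a_mark u = 0"
  shows "ok search_round (434 * (N * (n * K)))
    (\<lambda>\<tau>. frame round_vars tables \<sigma> \<tau> \<and> (\<forall>u. ar \<tau> a_mark u = 0) \<and> table K N \<tau> \<and>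
      vr \<tau> v_W = ar \<tau> a_val (N - 1) \<and> vr \<tau> v_go = vr \<tau> v_W - K \<and> vr \<tau> v_K = K + K) \<sigma>"
proof -
  define \<sigma>1 where "\<sigma>1 = \<sigma>\<lparr>ar := (ar \<sigma>)(a_val := (ar \<sigma> a_val)(0 := 0)),
    vr := (vr \<sigma>)(v_A := 1, v_left := N - 1)\<rparr>"
  have vars: "vr \<sigma> v_zero = 0" "vr \<sigma> v_full = N - 1"
    using base by (simp_all add: base_def)
  have N0: "0 < N"
    using n_less_N(1) by simp
  have wp: "wp round_init (\<lambda>\<tau>. \<tau> = \<sigma>1) \<sigma>"
    using big N0 by (simp add: round_init_def \<sigma>1_def vars)
  have base1: "base \<sigma>1" and K1: "vr \<sigma>1 v_K = K" "K \<le> 2 * N" and fr1: "frame round_vars tables \<sigma> \<sigma>1"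
    using base K by (simp_all add: base_def \<sigma>1_def frame_def)
  have "table K 1 \<sigma>1"
    by (simp add: table_def \<sigma>1_def reach_empty)
  then have inv: "subset_inv K \<sigma>1 (N - 1) \<sigma>1"
    using mark N0 by (simp add: subset_inv_def frame_def \<sigma>1_def)
  have loop: "ok (While v_left subset_step) (3 + (N - 1) * (400 * (n * K) + 1)) (subset_inv K \<sigma>1 0) \<sigma>1"
    using inv
  proof (rule ok_for)
    fix k \<tau>
    assume "subset_inv K \<sigma>1 (Suc k) \<tau>"
    then show "vr \<tau> v_left > 0 \<and> ok subset_step (400 * (n * K)) (subset_inv K \<sigma>1 k) \<tau>"
      using subset_step[OF base1 K1(1) K(2) K1(2)] by (simp add: subset_inv_def)
  qed (simp add: subset_inv_def)
  define Q where "Q \<tau> \<longleftrightarrow> frame round_vars tables \<sigma> \<tau> \<and> (\<forall>u. ar \<tau> a_mark u = 0) \<and> table K N \<tau> \<and>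
      vr \<tau> v_W = ar \<tau> a_val (N - 1) \<and> vr \<tau> v_go = vr \<tau> v_W - K \<and> vr \<tau> v_K = K + K" for \<tau>
  have fin: "ok round_end 15 Q \<tau>" if inv0: "subset_inv K \<sigma>1 0 \<tau>" for \<tau>
  proof -
    have fr: "frame subset_vars tables \<sigma>1 \<tau>" and mark': "\<forall>u. ar \<tau> a_mark u = 0" and tab: "table K N \<tau>"
      using inv0 by (auto simp: subset_inv_def)
    have vars': "vr \<tau> v_K = K" "vr \<tau> v_full = N - 1"
      using fr K1 base1 by (simp_all add: frame_def base_def)
    define \<upsilon> where "\<upsilon> = \<tau>\<lparr>vr := (vr \<tau>)(v_W := ar \<tau> a_val (N - 1),
      v_go := ar \<tau> a_val (N - 1) - K, v_K := K + K)\<rparr>"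
    have "frame round_vars tables \<sigma> \<upsilon>"
      using fr fr1 by (simp add: frame_def \<upsilon>_def)
    moreover have "table K N \<upsilon>"
      using tab by (simp add: table_def \<upsilon>_def)
    ultimately have "Q \<upsilon>"
      unfolding Q_def using mark' by (simp add: \<upsilon>_def)
    then have "wp round_end Q \<tau>"
      using vars' K(3) big N0 by (simp add: round_end_def \<upsilon>_def)
    then show ?thesis
      by (rule ok_mono[OF ok_wp]) (simp_all add: round_end_def)
  qed
  have "ok search_round (cost round_init + (3 + (N - 1) * (400 * (n * K) + 1) + 15)) Q \<sigma>"
    unfolding search_round_def by (rule ok_wp_seq[OF wp], rule ok_seq, use loop in simp, rule fin)
  moreover have "cost round_init + (3 + (N - 1) * (400 * (n * K) + 1) + 15) \<le> 434 * (N * (n * K))"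
  proof -
    define p where "p = n * K"
    have p: "1 \<le> p"
      using K(2) n by (simp add: p_def)
    then have "1 \<le> N * p"
      using N0 by (simp add: Suc_le_eq)
    \<comment> \<open>The constant 434 is 401 for the sets, the loop test included, plus 33 for
      setup, loop entry and closing.\<close>
    moreover have "(N - 1) * (400 * p + 1) \<le> N * (401 * p)"
      using p by (intro mult_le_mono) auto
    ultimately have "(N - 1) * (400 * p + 1) + 33 \<le> 434 * (N * p)"
      by linarith
    moreover have "cost round_init = 15"
      by (simp add: round_init_def)
    ultimately show ?thesis
      unfolding p_def[symmetric] by linarith
  qed
  ultimately show ?thesis
    by (rule ok_mono) (simp add: Q_def)
qed

section \<open>The number of doublings and the cost of the search\<close>

definition rounds :: nat where
  "rounds = (LEAST r. reach {..<n} E (2 ^ r) {..<n})"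

lemma reach_rounds: "reach {..<n} E (2 ^ rounds) {..<n}"
  unfolding rounds_def by (rule LeastI[of "\<lambda>r. reach {..<n} E (2 ^ r) {..<n}" n]) (use reach_max[of "{..<n}" E] in simp)

lemma not_reach_rounds: "r < rounds \<Longrightarrow> \<not> reach {..<n} E (2 ^ r) {..<n}"
  unfolding rounds_def by (rule not_less_Least)

lemma rounds_le: "rounds \<le> n"
  unfolding rounds_def by (rule Least_le) (use reach_max[of "{..<n}" E] in simp)

text \<open>The \<open>K\<close> of the last round is hidden behind a quantifier, since
  \<open>v_K\<close> has been doubled by then. The last conjunct ties the cost, measured by
  \<open>rounds\<close>, to the optimum.\<close>

definition searched :: "state \<Rightarrow> bool" where
  "searched \<sigma> \<longleftrightarrow> (\<exists>K. table K N \<sigma> \<and> vr \<sigma> v_W \<le> K) \<and> ar \<sigma> a_val (N - 1) \<le> vr \<sigma> v_W \<and>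
     (\<forall>M. reach {..<n} E M {..<n} \<longrightarrow> vr \<sigma> v_W \<le> M) \<and> 2 ^ rounds \<le> 2 * vr \<sigma> v_W"

text \<open>\<open>k\<close> counts down from \<open>rounds + 1\<close>: the first round has
  threshold 1 and the last one, entered with \<open>k = 1\<close>, has
  \<open>2 ^ rounds\<close>.\<close>

definition search_inv :: "state \<Rightarrow> nat \<Rightarrow> state \<Rightarrow> bool" where
  "search_inv \<sigma>0 k \<sigma> \<longleftrightarrow> frame round_vars tables \<sigma>0 \<sigma> \<and> (\<forall>u. ar \<sigma> a_mark u = 0) \<and>
     (if k = 0 then vr \<sigma> v_go = 0 \<and> searched \<sigma>
      else vr \<sigma> v_go > 0 \<and> vr \<sigma> v_K = 2 ^ (Suc rounds - k))"

lemma round_step: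
  assumes base: "base \<sigma>0" and inv: "search_inv \<sigma>0 (Suc k) \<sigma>" and k: "k \<le> rounds"
  shows "ok search_round (434 * (N * (n * 2 ^ (rounds - k)))) (search_inv \<sigma>0 k) \<sigma>"
proof -
  define K :: nat where "K = 2 ^ (rounds - k)"
  have fr: "frame round_vars tables \<sigma>0 \<sigma>" and mark: "\<forall>u. ar \<sigma> a_mark u = 0" and K: "vr \<sigma> v_K = K"
    using inv by (simp_all add: search_inv_def K_def)
  have "K \<le> 2 ^ n"
    unfolding K_def using rounds_le by (intro power_increasing) auto
  then have K': "1 \<le> K" "K \<le> N"
    by (simp_all add: K_def N)
  have base': "base \<sigma>"
    using base fr by (simp add: base_def frame_def)
  have N0: "N - 1 < N"
    using n_less_N(1) by simp
  have V: "bits (N - 1) = {..<n}"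
    by (simp only: N bits_full)
  show ?thesis
    unfolding K_def[symmetric]
  proof (rule ok_mono[OF search_round[OF base' K K' mark]])
    fix \<tau>
    assume *: "frame round_vars tables \<sigma> \<tau> \<and> (\<forall>u. ar \<tau> a_mark u = 0) \<and> table K N \<tau> \<and>
      vr \<tau> v_W = ar \<tau> a_val (N - 1) \<and> vr \<tau> v_go = vr \<tau> v_W - K \<and> vr \<tau> v_K = K + K"
    have W: "vr \<tau> v_W \<le> M \<longleftrightarrow> reach {..<n} E M {..<n}" if "M \<le> K" for M
    proof -
      have "table K N \<tau>" "vr \<tau> v_W = ar \<tau> a_val (N - 1)"
        using * by blast+
      then have "vr \<tau> v_W \<le> M \<longleftrightarrow> reach {..<n} E M (bits (N - 1))"
        using N0 that unfolding table_def by simp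
      then show ?thesis
        unfolding V .
    qed
    have fr': "frame round_vars tables \<sigma>0 \<tau>"
      using fr by (rule frame_trans) (use * in blast)
    show "search_inv \<sigma>0 k \<tau>"
    proof (cases "k = 0")
      case True
      then have WK: "vr \<tau> v_W \<le> K"
        using W[of K] reach_rounds by (simp add: K_def)
      then have reach: "reach {..<n} E (vr \<tau> v_W) {..<n}"
        using W by blast
      \<comment> \<open>Thresholds above \<open>K\<close> exceed \<open>W\<close> anyway; the table
        decides the others.\<close>
      have least: "vr \<tau> v_W \<le> M" if "reach {..<n} E M {..<n}" for M
        using W[of M] that WK by (cases "M \<le> K") auto
      \<comment> \<open>After a doubling, the previous power of two had failed and so lies below
        \<open>W\<close>; without one, \<open>W\<close> is positive because every cut has a
        union.\<close>
      have "2 ^ rounds \<le> 2 * vr \<tau> v_W"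
      proof (cases rounds)
        case 0
        have "0 \<in> {..<n}"
          using n by simp
        then have "{..<n} \<noteq> {}"
          by blast
        then have "cut_card {..<n} E {..<n} \<le> vr \<tau> v_W"
          using reach reach_iff[of "{..<n}" "{..<n}" E] by blast
        then show ?thesis
          using cut_card_pos[of "{..<n}" E "{..<n}"] 0 by simp
      next
        case (Suc r)
        then have "\<not> reach {..<n} E (2 ^ r) {..<n}"
          by (intro not_reach_rounds) simp
        then have "2 ^ r < vr \<tau> v_W"
          using reach reach_mono not_le by blast
        then show ?thesis
          using Suc by simp
      qed
      then have "searched \<tau>"
        unfolding searched_def using * WK least by (intro conjI exI[of _ K]) auto
      then show ?thesis
        unfolding search_inv_def using True * fr' WK by simp
    next
      case False
      then have "\<not> vr \<tau> v_W \<le> K"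
        using W[of K] not_reach_rounds[of "rounds - k"] k by (simp add: K_def)
      moreover have "K + K = 2 ^ (Suc rounds - k)"
        using k by (simp add: K_def Suc_diff_le)
      ultimately show ?thesis
        unfolding search_inv_def using False * fr' by simp
    qed
  qed simp
qed

lemma search:
  assumes base: "base \<sigma>" and K: "vr \<sigma> v_K = 1" and mark: "\<forall>u. ar \<sigma> a_mark u = 0"
  shows "ok search (878 * (n * N * 2 ^ rounds)) (\<lambda>\<tau>. frame round_vars tables \<sigma> \<tau> \<and> searched \<tau>) \<sigma>"
proof -
  define \<sigma>1 where "\<sigma>1 = \<sigma>\<lparr>vr := (vr \<sigma>)(v_go := 1)\<rparr>"
  have base1: "base \<sigma>1"
    using base by (simp add: base_def \<sigma>1_def)
  have inv: "search_inv \<sigma>1 (Suc rounds) \<sigma>1"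
    using K mark by (simp add: search_inv_def frame_def \<sigma>1_def)
  have wp: "wp (Prim (PSet v_go 1)) (\<lambda>\<tau>. \<tau> = \<sigma>1) \<sigma>"
    using big by (simp add: \<sigma>1_def)
  let ?T = "\<lambda>k. 434 * (N * (n * 2 ^ (rounds - k)))"
  have loop: "ok (While v_go search_round) (3 + (\<Sum>k<Suc rounds. ?T k + 1)) (search_inv \<sigma>1 0) \<sigma>1"
    using inv
  proof (rule ok_while)
    fix k \<tau>
    assume "search_inv \<sigma>1 (Suc k) \<tau>" "k < Suc rounds"
    then show "vr \<tau> v_go > 0 \<and> ok search_round (?T k) (search_inv \<sigma>1 k) \<tau>"
      using round_step[OF base1] by (simp add: search_inv_def)
  qed (simp add: search_inv_def)
  have "ok search (cost (Prim (PSet v_go 1)) + (3 + (\<Sum>k<Suc rounds. ?T k + 1))) (search_inv \<sigma>1 0) \<sigma>"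
    unfolding search_def by (rule ok_wp_seq[OF wp]) (use loop in simp)
  then show ?thesis
  proof (rule ok_mono)
    have p: "1 \<le> n * N"
      using n n_less_N(1) by simp
    \<comment> \<open>A round costs at most 435 units of \<open>n * N * 2 ^ (rounds - k)\<close>,
      one of them for the loop test. The powers sum to less than \<open>2 ^ Suc rounds\<close>,
      which gives 870, and 8 pays for the initial assignment and for entering and leaving the
      loop.\<close>
    have "(\<Sum>k<Suc rounds. ?T k + 1) \<le> (\<Sum>k<Suc rounds. 435 * (n * N) * 2 ^ (rounds - k))"
    proof (rule sum_mono)
      fix k
      have "1 * 1 \<le> n * N * 2 ^ (rounds - k)"
        using p by (intro mult_le_mono) auto
      then show "?T k + 1 \<le> 435 * (n * N) * 2 ^ (rounds - k)"
        by (simp add: algebra_simps)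
    qed
    also have "\<dots> = 435 * (n * N) * (\<Sum>k<Suc rounds. 2 ^ (rounds - k))"
      by (simp only: sum_distrib_left)
    also have "(\<Sum>k<Suc rounds. 2 ^ (rounds - k)) = (\<Sum>k<Suc rounds. 2 ^ k :: nat)"
      by (rule sum.reindex_bij_witness[of _ "\<lambda>k. rounds - k" "\<lambda>k. rounds - k"]) auto
    also have "\<dots> = 2 ^ Suc rounds - 1"
      using mask_eq_sum_exp_nat[of "Suc rounds"] by (simp add: lessThan_def)
    also have "435 * (n * N) * (2 ^ Suc rounds - 1) \<le> 435 * (n * N) * 2 ^ Suc rounds"
      by (intro mult_le_mono) auto
    finally have "(\<Sum>k<Suc rounds. ?T k + 1) \<le> 870 * (n * N * 2 ^ rounds)"
      by (simp add: algebra_simps)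
    moreover have "1 \<le> n * N * 2 ^ rounds"
      using p by (simp add: Suc_le_eq)
    ultimately have "8 + (\<Sum>k<Suc rounds. ?T k + 1) \<le> 878 * (n * N * 2 ^ rounds)"
      by linarith
    then show "cost (Prim (PSet v_go 1)) + (3 + (\<Sum>k<Suc rounds. ?T k + 1)) \<le> 878 * (n * N * 2 ^ rounds)"
      by (simp only: cost.simps)
  next
    fix \<tau>
    assume "search_inv \<sigma>1 0 \<tau>"
    then show "frame round_vars tables \<sigma> \<tau> \<and> searched \<tau>"
      by (simp add: search_inv_def frame_def \<sigma>1_def)
  qed
qed

end

section \<open>Input and output\<close>

definition row_init :: com where
  "row_init =
    Prim (PSet v_nb 0) ;;
    Prim (PSet v_mask 1) ;;
    Prim (PAdd v_rem2 v_n v_zero)"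

text \<open>\<open>1 - t\<close> turns the matrix entry around, as \<open>Unless\<close> acts on
  zero.\<close>

definition read_step :: com where
  "read_step =
    Prim (PIn v_t) ;;
    Prim (PSub v_u v_one v_t) ;;
    Unless v_u (Prim (POr v_nb v_nb v_mask)) ;;
    Prim (PAdd v_mask v_mask v_mask) ;;
    Prim (PSub v_rem2 v_rem2 v_one)"

definition row_end :: com where
  "row_end =
    Prim (PUpd a_nbhd v_i v_nb) ;;
    Prim (PAdd v_i v_i v_one) ;;
    Prim (PSub v_rem v_rem v_one)"

definition row :: com where
  "row = row_init ;; While v_rem2 read_step ;; row_end"

text \<open>\<open>v_zero\<close> is never assigned: it keeps the initial content of its register,
  and adding it serves as a copy operation throughout.\<close>

definition read_init :: com where
  "read_init =
    Prim (PIn v_n) ;;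
    Prim (PSet v_one 1) ;;
    Prim (PAdd v_rem v_n v_zero)"

definition read_end :: com where
  "read_end =
    Prim (PSub v_full v_mask v_one) ;;
    Prim (PSet v_K 1)"

definition read_graph :: com where
  "read_graph = read_init ;; While v_rem row ;; read_end"

context alg
begin

definition entry :: "nat \<Rightarrow> nat \<Rightarrow> nat" where
  "entry i j = (if {i, j} \<in> E then 1 else 0)"

lemma encode_graph_eq:
  "encode_graph n E = n # concat (map (\<lambda>i. map (entry i) [0..<n]) [0..<n])"
  by (simp add: encode_graph_def entry_def[abs_def])

text \<open>The frame is taken relative to \<open>\<sigma>0\<close> with the current input, because
  \<open>frame\<close> fixes both tapes.\<close>

definition read_inv :: "nat \<Rightarrow> nat list \<Rightarrow> state \<Rightarrow> nat \<Rightarrow> state \<Rightarrow> bool" where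
  "read_inv i xs \<sigma>0 k \<sigma> \<longleftrightarrow> frame {v_t, v_u, v_nb, v_mask, v_rem2} {} (\<sigma>0\<lparr>inq := inq \<sigma>\<rparr>) \<sigma> \<and>
     vr \<sigma> v_rem2 = k \<and> k \<le> n \<and> vr \<sigma> v_mask = 2 ^ (n - k) \<and>
     inq \<sigma> = map (entry i) [n - k..<n] @ xs \<and> bits (vr \<sigma> v_nb) = nbhd E i \<inter> {..<n - k}"

lemma read_step:
  assumes one: "vr \<sigma>0 v_one = 1" and inv: "read_inv i xs \<sigma>0 (Suc k) \<sigma>"
  shows "ok read_step 26 (read_inv i xs \<sigma>0 k) \<sigma>"
proof -
  define j where "j = n - Suc k"
  have k: "Suc k \<le> n"
    using inv unfolding read_inv_def by blast
  then have j: "n - k = Suc j" "j < n"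
    by (simp_all add: j_def)
  have fr: "\<forall>x. x \<notin> {v_t, v_u, v_nb, v_mask, v_rem2} \<longrightarrow> vr \<sigma> x = vr \<sigma>0 x" "ar \<sigma> = ar \<sigma>0" "outq \<sigma> = outq \<sigma>0"
    using inv by (simp_all add: read_inv_def frame_def fun_eq_iff)
  have s: "vr \<sigma> v_rem2 = Suc k" "k < n" "vr \<sigma> v_mask = 2 ^ j" "bits (vr \<sigma> v_nb) = nbhd E i \<inter> {..<j}"
    "inq \<sigma> = entry i j # (map (entry i) [Suc j..<n] @ xs)"
    using inv j(2) k by (simp_all add: read_inv_def j_def[symmetric] upt_conv_Cons)
  have one': "vr \<sigma> v_one = 1"
    using fr(1) one by simp
  define nb where "nb = (if {i, j} \<in> E then Bit_Operations.or (vr \<sigma> v_nb) (2 ^ j) else vr \<sigma> v_nb)"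
  have nb: "bits nb = nbhd E i \<inter> {..<Suc j}"
  proof (cases "{i, j} \<in> E")
    case True
    then have "nb = Bit_Operations.or (vr \<sigma> v_nb) (2 ^ j)" "j \<in> nbhd E i"
      by (simp_all add: nb_def nbhd_def)
    then show ?thesis
      by (simp only: bits_or bits_power s(4) lessThan_Suc) blast
  next
    case False
    then have "nb = vr \<sigma> v_nb" "j \<notin> nbhd E i"
      by (simp_all add: nb_def nbhd_def)
    then show ?thesis
      by (simp only: s(4) lessThan_Suc) blast
  qed
  have post: "read_inv i xs \<sigma>0 k (\<sigma>\<lparr>inq := map (entry i) [Suc j..<n] @ xs, vr := f\<rparr>)"
    if "f v_rem2 = k" "f v_mask = 2 ^ j + 2 ^ j" "f v_nb = nb"
      "\<forall>x. x \<notin> {v_t, v_u, v_nb, v_mask, v_rem2} \<longrightarrow> f x = vr \<sigma> x" for f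
    unfolding read_inv_def frame_def j(1) using fr s(2) nb that by (simp add: mult_2)
  have bounds: "2 ^ j + 2 ^ j < (2 :: nat) ^ w"
    using big n_less_N(2)[OF j(2)] by simp
  have "wp read_step (read_inv i xs \<sigma>0 k) \<sigma>"
  proof (cases "{i, j} \<in> E")
    case True
    then have "entry i j = 1" "nb = Bit_Operations.or (vr \<sigma> v_nb) (2 ^ j)"
      by (simp_all add: entry_def nb_def)
    then show ?thesis
      using big bounds s one' by (simp add: read_step_def post)
  next
    case False
    then have "entry i j = 0" "nb = vr \<sigma> v_nb"
      by (simp_all add: entry_def nb_def)
    then show ?thesis
      using big bounds s one' by (simp add: read_step_def post)
  qed
  then show ?thesis
    by (rule ok_mono[OF ok_wp]) (simp_all add: read_step_def)
qed

text \<open>After each row the mask has been doubled \<open>n\<close> times and equals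
  \<open>N\<close>. This is how \<open>N - 1\<close> becomes available to the program; before the
  first row it is not yet so.\<close>

definition row_inv :: "nat \<Rightarrow> state \<Rightarrow> bool" where
  "row_inv k \<sigma> \<longleftrightarrow> vr \<sigma> v_n = n \<and> vr \<sigma> v_one = 1 \<and> vr \<sigma> v_zero = 0 \<and> outq \<sigma> = [] \<and>
     (\<forall>u. ar \<sigma> a_mark u = 0) \<and> vr \<sigma> v_rem = k \<and> vr \<sigma> v_i + k = n \<and>
     (\<forall>i<vr \<sigma> v_i. bits (ar \<sigma> a_nbhd i) = nbhd E i) \<and>
     inq \<sigma> = concat (map (\<lambda>i. map (entry i) [0..<n]) [vr \<sigma> v_i..<n]) \<and>
     (k < n \<longrightarrow> vr \<sigma> v_mask = N)"

lemma row:
  assumes inv: "row_inv (Suc k) \<sigma>"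
  shows "ok row (33 + n * 27) (row_inv k) \<sigma>"
proof -
  define i where "i = vr \<sigma> v_i"
  have vars: "vr \<sigma> v_n = n" "vr \<sigma> v_one = 1" "vr \<sigma> v_zero = 0" "outq \<sigma> = []"
      "\<forall>u. ar \<sigma> a_mark u = 0" "vr \<sigma> v_rem = Suc k" "i + Suc k = n" "vr \<sigma> v_i = i"
    and rows: "\<And>i'. i' < i \<Longrightarrow> bits (ar \<sigma> a_nbhd i') = nbhd E i'"
    using inv unfolding row_inv_def i_def by blast+
  have i: "i < n"
    using vars(7) by simp
  let ?xs = "concat (map (\<lambda>i. map (entry i) [0..<n]) [Suc i..<n])"
  have inq: "inq \<sigma> = map (entry i) [0..<n] @ ?xs"
    using inv i by (simp add: row_inv_def i_def[symmetric] upt_conv_Cons)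
  define \<sigma>1 where "\<sigma>1 = \<sigma>\<lparr>vr := (vr \<sigma>)(v_nb := 0, v_mask := 1, v_rem2 := n)\<rparr>"
  have wp: "wp row_init (\<lambda>\<tau>. \<tau> = \<sigma>1) \<sigma>"
    using big n_less_N(1) vars by (simp add: row_init_def \<sigma>1_def)
  have one: "vr \<sigma>1 v_one = 1"
    using vars by (simp add: \<sigma>1_def)
  have start: "read_inv i ?xs \<sigma>1 n \<sigma>1"
    using inq by (simp add: read_inv_def frame_def \<sigma>1_def)
  have loop: "ok (While v_rem2 read_step) (3 + n * (26 + 1)) (read_inv i ?xs \<sigma>1 0) \<sigma>1"
    using start
  proof (rule ok_for)
    fix k \<tau>
    assume "read_inv i ?xs \<sigma>1 (Suc k) \<tau>"
    then show "vr \<tau> v_rem2 > 0 \<and> ok read_step 26 (read_inv i ?xs \<sigma>1 k) \<tau>"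
      using read_step[OF one] by (simp add: read_inv_def)
  qed (simp add: read_inv_def)
  have fin: "ok row_end 15 (row_inv k) \<tau>" if inv0: "read_inv i ?xs \<sigma>1 0 \<tau>" for \<tau>
  proof -
    have fr: "\<forall>x. x \<notin> {v_t, v_u, v_nb, v_mask, v_rem2} \<longrightarrow> vr \<tau> x = vr \<sigma>1 x" "ar \<tau> = ar \<sigma>" "outq \<tau> = []"
      using inv0 vars(4) by (simp_all add: read_inv_def frame_def \<sigma>1_def fun_eq_iff)
    have m: "vr \<tau> v_mask = N" "inq \<tau> = ?xs"
      using inv0 by (simp_all add: read_inv_def N)
    have "bits (vr \<tau> v_nb) = nbhd E i \<inter> {..<n}"
      using inv0 by (simp add: read_inv_def)
    then have nb: "bits (vr \<tau> v_nb) = nbhd E i"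
      using nbhd_subset[of i] by blast
    define \<upsilon> where "\<upsilon> = \<tau>\<lparr>ar := (ar \<tau>)(a_nbhd := (ar \<tau> a_nbhd)(i := vr \<tau> v_nb)),
      vr := (vr \<tau>)(v_i := Suc i, v_rem := k)\<rparr>"
    have "bits (ar \<upsilon> a_nbhd i') = nbhd E i'" if "i' < Suc i" for i'
    proof (cases "i' = i")
      case True
      have "ar \<upsilon> a_nbhd i = vr \<tau> v_nb"
        by (simp add: \<upsilon>_def)
      then show ?thesis
        unfolding True using nb by (simp only:)
    next
      case False
      then have "ar \<upsilon> a_nbhd i' = ar \<sigma> a_nbhd i'"
        using fr(2) by (simp add: \<upsilon>_def)
      then show ?thesis
        using rows[of i'] that False by simp
    qed
    moreover have "vr \<upsilon> v_i = Suc i"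
      by (simp add: \<upsilon>_def)
    ultimately have "\<forall>i'<vr \<upsilon> v_i. bits (ar \<upsilon> a_nbhd i') = nbhd E i'"
      by (simp only:) blast
    then have "row_inv k \<upsilon>"
      unfolding row_inv_def using fr m vars by (simp add: \<upsilon>_def \<sigma>1_def)
    moreover have "vr \<tau> v_i = i" "vr \<tau> v_rem = Suc k" "vr \<tau> v_one = 1"
      using fr(1) vars by (simp_all add: \<sigma>1_def)
    ultimately have "wp row_end (row_inv k) \<tau>"
      using i n_less_N(4)[OF i] big by (simp add: row_end_def \<upsilon>_def)
    then show ?thesis
      by (rule ok_mono[OF ok_wp]) (simp_all add: row_end_def)
  qed
  have "ok row (cost row_init + (3 + n * (26 + 1) + 15)) (row_inv k) \<sigma>"
    unfolding row_def by (rule ok_wp_seq[OF wp], rule ok_seq, use loop in simp, rule fin)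
  then show ?thesis
    by (rule ok_mono) (simp_all add: row_init_def)
qed

lemma read_graph:
  "ok read_graph (28 + n * (34 + n * 27))
     (\<lambda>\<tau>. base \<tau> \<and> vr \<tau> v_K = 1 \<and> (\<forall>u. ar \<tau> a_mark u = 0) \<and> outq \<tau> = [])
     \<lparr>vr = \<lambda>_. 0, ar = \<lambda>_ _. 0, inq = encode_graph n E, outq = []\<rparr>"
    (is "ok _ _ ?Q ?\<sigma>")
proof -
  have n_small: "n < 2 ^ w"
    using big n_less_N(1) by simp
  have wp: "wp read_init (row_inv n) ?\<sigma>"
    using n_small big by (simp add: read_init_def row_inv_def encode_graph_eq)
  have loop: "ok (While v_rem row) (3 + n * (33 + n * 27 + 1)) (row_inv 0) \<sigma>" if "row_inv n \<sigma>" for \<sigma>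
    using that
  proof (rule ok_for)
    fix k \<tau>
    assume "row_inv (Suc k) \<tau>"
    then show "vr \<tau> v_rem > 0 \<and> ok row (33 + n * 27) (row_inv k) \<tau>"
      using row by (simp add: row_inv_def)
  qed (simp add: row_inv_def)
  have fin: "ok read_end 10 ?Q \<tau>" if inv0: "row_inv 0 \<tau>" for \<tau>
  proof -
    \<comment> \<open>Here \<open>n \<ge> 1\<close> enters: at least one row has been read.\<close>
    have "vr \<tau> v_mask = N"
      using inv0 n by (simp add: row_inv_def)
    moreover have "\<forall>i<n. bits (ar \<tau> a_nbhd i) = nbhd E i"
      using inv0 by (simp add: row_inv_def)
    ultimately have "wp read_end ?Q \<tau>"
      using inv0 big by (simp add: read_end_def row_inv_def base_def)
    then show ?thesis
      by (rule ok_mono[OF ok_wp]) (simp_all add: read_end_def)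
  qed
  have "ok read_graph (cost read_init + (3 + n * (33 + n * 27 + 1) + 10)) ?Q ?\<sigma>"
    unfolding read_graph_def by (rule ok_wp_seq[OF wp], rule ok_seq, erule loop, rule fin)
  then show ?thesis
    by (rule ok_mono) (simp_all add: read_init_def)
qed

end

section \<open>Descending an optimal chain and printing it\<close>

definition scan_init :: com where
  "scan_init =
    Prim (PSub v_compl v_full v_A) ;;
    Prim (PSet v_mask 1) ;;
    Prim (PSet v_i 0) ;;
    Prim (PAdd v_rem v_n v_zero)"

text \<open>A later suitable vertex overwrites an earlier one. The label is the index plus one, as
  required by the encoding of leaves.\<close>

definition scan_step :: com where
  "scan_step =
    Prim (PAnd v_u v_mask v_compl) ;;
    Unless v_u
      (Prim (PSub v_t v_A v_mask) ;;
       Prim (PGet v_t a_val v_t) ;;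
       Prim (PSub v_t v_t v_W) ;;
       Unless v_t
         (Prim (PAdd v_label v_i v_one) ;;
          Prim (PAdd v_bit v_mask v_zero))) ;;
    advance"

text \<open>\<open>v_out\<close> is decremented first, so that \<open>1 - out\<close> vanishes for
  all vertices but the last; exactly those are preceded by the marker of an internal node.\<close>

definition print_vertex :: com where
  "print_vertex =
    Prim (PSub v_out v_out v_one) ;;
    Prim (PSub v_u v_one v_out) ;;
    Unless v_u (Prim (POut v_zero)) ;;
    Prim (POut v_label) ;;
    Prim (PSub v_A v_A v_bit)"

definition output_step :: com where
  "output_step = (scan_init ;; While v_rem scan_step) ;; print_vertex"

definition output_init :: com where
  "output_init =
    Prim (PAdd v_A v_full v_zero) ;;
    Prim (PAdd v_out v_n v_zero)"

definition main :: com where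
  "main = read_graph ;; search ;; output_init ;; While v_out output_step"

context alg
begin

abbreviation scan_vars :: "nat set" where
  "scan_vars \<equiv> {v_u, v_t, v_mask, v_i, v_rem, v_label, v_bit}"

text \<open>Until the first hit, label and bit may be left over from an earlier scan, hence the
  implication.\<close>

definition scan_inv :: "nat \<Rightarrow> state \<Rightarrow> nat \<Rightarrow> state \<Rightarrow> bool" where
  "scan_inv a \<sigma>0 k \<sigma> \<longleftrightarrow> frame scan_vars {} \<sigma>0 \<sigma> \<and>
     vr \<sigma> v_rem = k \<and> vr \<sigma> v_i + k = n \<and> vr \<sigma> v_mask = 2 ^ vr \<sigma> v_i \<and>
     ((\<exists>v<vr \<sigma> v_i. bit a v \<and> ar \<sigma>0 a_val (a - 2 ^ v) \<le> vr \<sigma>0 v_W) \<longrightarrow>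
      (\<exists>v. bit a v \<and> ar \<sigma>0 a_val (a - 2 ^ v) \<le> vr \<sigma>0 v_W \<and> vr \<sigma> v_label = Suc v \<and> vr \<sigma> v_bit = 2 ^ v))"

lemma scan_step:
  assumes base: "base \<sigma>0" and a: "a < N" "vr \<sigma>0 v_A = a" "vr \<sigma>0 v_compl = N - 1 - a"
    and inv: "scan_inv a \<sigma>0 (Suc k) \<sigma>"
  shows "ok scan_step 47 (scan_inv a \<sigma>0 k) \<sigma>"
proof -
  let ?i = "vr \<sigma> v_i"
  let ?good = "\<lambda>v. bit a v \<and> ar \<sigma>0 a_val (a - 2 ^ v) \<le> vr \<sigma>0 v_W"
  have fr: "\<forall>x. x \<notin> scan_vars \<longrightarrow> vr \<sigma> x = vr \<sigma>0 x"
    "\<forall>a. a \<notin> {} \<longrightarrow> ar \<sigma> a = ar \<sigma>0 a" "inq \<sigma> = inq \<sigma>0" "outq \<sigma> = outq \<sigma>0"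
    using inv by (simp_all add: scan_inv_def frame_def)
  have i: "?i + Suc k = n" "vr \<sigma> v_rem = Suc k" "vr \<sigma> v_mask = 2 ^ ?i"
    using inv by (simp_all add: scan_inv_def)
  then have "?i < n"
    by simp
  have found: "(\<exists>v<?i. ?good v) \<longrightarrow> (\<exists>v. ?good v \<and> vr \<sigma> v_label = Suc v \<and> vr \<sigma> v_bit = 2 ^ v)"
    using inv unfolding scan_inv_def by blast
  have vars: "vr \<sigma> v_A = a" "vr \<sigma> v_compl = N - 1 - a" "vr \<sigma> v_one = 1" "vr \<sigma> v_zero = 0"
      "vr \<sigma> v_W = vr \<sigma>0 v_W"
    using base fr a by (simp_all add: base_def)
  define u where "u = Bit_Operations.and (2 ^ ?i) (N - 1 - a)"
  have u: "u = 0 \<longleftrightarrow> bit a ?i"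
    using bit_compl[OF a(1)] \<open>?i < n\<close> by (simp add: u_def and_power_eq_0_iff)
  have next_inv: "scan_inv a \<sigma>0 k (\<sigma>\<lparr>vr := f\<rparr>)"
    if f: "f v_i = Suc ?i" "f v_mask = 2 ^ ?i + 2 ^ ?i" "f v_rem = k" "\<forall>x. x \<notin> scan_vars \<longrightarrow> f x = vr \<sigma> x"
      and g: "(?good ?i \<and> f v_label = Suc ?i \<and> f v_bit = 2 ^ ?i) \<or>
        (\<not> ?good ?i \<and> f v_label = vr \<sigma> v_label \<and> f v_bit = vr \<sigma> v_bit)" for f
  proof -
    have "frame scan_vars {} \<sigma>0 (\<sigma>\<lparr>vr := f\<rparr>)"
      using f fr by (simp add: frame_def)
    moreover have "(\<exists>v. ?good v \<and> f v_label = Suc v \<and> f v_bit = 2 ^ v)" if ex: "\<exists>v<Suc ?i. ?good v"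
    proof (cases "?good ?i")
      case True
      then show ?thesis
        using g by blast
    next
      case False
      then have "\<exists>v<?i. ?good v"
        using ex less_Suc_eq by metis
      then obtain v where v: "?good v" "vr \<sigma> v_label = Suc v" "vr \<sigma> v_bit = 2 ^ v"
        using found by blast
      have "f v_label = vr \<sigma> v_label" "f v_bit = vr \<sigma> v_bit"
        using g False by blast+
      then show ?thesis
        using v by (intro exI[of _ v]) simp
    qed
    ultimately show ?thesis
      unfolding scan_inv_def using f i(1) by (simp add: mult_2)
  qed
  have bounds: "a - 2 ^ ?i < N" "2 ^ ?i + 2 ^ ?i < (2::nat) ^ w" "2 ^ ?i < (2::nat) ^ w" "Suc ?i < 2 ^ w"
    using a(1) big n_less_N(2,4)[OF \<open>?i < n\<close>] by linarith+
  have val: "ar \<sigma> a_val = ar \<sigma>0 a_val"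
    using fr(2) by simp
  have "wp scan_step (scan_inv a \<sigma>0 k) \<sigma>"
  proof (cases "bit a ?i")
    case True
    show ?thesis
    proof (cases "ar \<sigma>0 a_val (a - 2 ^ ?i) \<le> vr \<sigma>0 v_W")
      case le: True
      then show ?thesis
        using True u bounds val by (simp add: scan_step_def advance_def vars i u_def next_inv)
    next
      case False
      then show ?thesis
        using True u bounds val by (simp add: scan_step_def advance_def vars i u_def next_inv)
    qed
  next
    case False
    then show ?thesis
      using u bounds by (simp add: scan_step_def advance_def vars i u_def next_inv)
  qed
  then show ?thesis
    by (rule ok_mono[OF ok_wp]) (simp_all add: scan_step_def advance_def)
qed

lemma scan:
  assumes base: "base \<sigma>" and a: "vr \<sigma> v_A = a" "a < N"
    and good: "\<exists>v. bit a v \<and> ar \<sigma> a_val (a - 2 ^ v) \<le> vr \<sigma> v_W"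
  shows "ok (scan_init ;; While v_rem scan_step) (23 + n * 48)
    (\<lambda>\<tau>. frame (insert v_compl scan_vars) {} \<sigma> \<tau> \<and>
      (\<exists>v. bit a v \<and> ar \<sigma> a_val (a - 2 ^ v) \<le> vr \<sigma> v_W \<and> vr \<tau> v_label = Suc v \<and> vr \<tau> v_bit = 2 ^ v)) \<sigma>"
proof -
  define \<sigma>1 where
    "\<sigma>1 = \<sigma>\<lparr>vr := (vr \<sigma>)(v_compl := N - 1 - a, v_mask := 1, v_i := 0, v_rem := n)\<rparr>"
  have vars: "vr \<sigma> v_full = N - 1" "vr \<sigma> v_zero = 0" "vr \<sigma> v_n = n"
    using base by (simp_all add: base_def)
  have wp: "wp scan_init (\<lambda>\<tau>. \<tau> = \<sigma>1) \<sigma>"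
    using big n_less_N(1) a by (simp add: scan_init_def \<sigma>1_def vars)
  have base1: "base \<sigma>1" and a1: "vr \<sigma>1 v_A = a" "vr \<sigma>1 v_compl = N - 1 - a"
    and fr1: "frame (insert v_compl scan_vars) {} \<sigma> \<sigma>1"
    using base a by (simp_all add: base_def \<sigma>1_def frame_def)
  have W1: "vr \<sigma>1 v_W = vr \<sigma> v_W" "ar \<sigma>1 = ar \<sigma>"
    by (simp_all add: \<sigma>1_def)
  have start: "scan_inv a \<sigma>1 n \<sigma>1"
    by (simp add: scan_inv_def frame_def \<sigma>1_def)
  have loop: "ok (While v_rem scan_step) (3 + n * (47 + 1)) (scan_inv a \<sigma>1 0) \<sigma>1"
    using start
  proof (rule ok_for)
    fix k \<tau>
    assume "scan_inv a \<sigma>1 (Suc k) \<tau>"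
    then show "vr \<tau> v_rem > 0 \<and> ok scan_step 47 (scan_inv a \<sigma>1 k) \<tau>"
      using scan_step[OF base1 a(2) a1] by (simp add: scan_inv_def)
  qed (simp add: scan_inv_def)
  have "ok (scan_init ;; While v_rem scan_step) (cost scan_init + (3 + n * (47 + 1))) (scan_inv a \<sigma>1 0) \<sigma>"
    by (rule ok_wp_seq[OF wp]) (use loop in simp)
  then show ?thesis
  proof (rule ok_mono)
    fix \<tau>
    assume *: "scan_inv a \<sigma>1 0 \<tau>"
    then have "frame scan_vars {} \<sigma>1 \<tau>" and "vr \<tau> v_i = n"
      by (simp_all add: scan_inv_def)
    then have "frame (insert v_compl scan_vars) {} \<sigma> \<tau>"
      using fr1 by (simp add: frame_def)
    moreover have "\<exists>v<n. bit a v \<and> ar \<sigma> a_val (a - 2 ^ v) \<le> vr \<sigma> v_W"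
      using good a(2) unfolding less_N_iff by blast
    ultimately show "frame (insert v_compl scan_vars) {} \<sigma> \<tau> \<and>
      (\<exists>v. bit a v \<and> ar \<sigma> a_val (a - 2 ^ v) \<le> vr \<sigma> v_W \<and> vr \<tau> v_label = Suc v \<and> vr \<tau> v_bit = 2 ^ v)"
      using * \<open>vr \<tau> v_i = n\<close> unfolding scan_inv_def W1 by simp
  qed (simp add: scan_init_def)
qed

text \<open>The chain is descended from the full set, and \<open>vs\<close> lists the vertices
  removed so far, from the root of the caterpillar on. The output has two forms because the last
  vertex carries no marker.\<close>

definition output_inv :: "nat \<Rightarrow> state \<Rightarrow> bool" where
  "output_inv k \<sigma> \<longleftrightarrow> base \<sigma> \<and> searched \<sigma> \<and> vr \<sigma> v_out = k \<and> vr \<sigma> v_A < N \<and>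
     ar \<sigma> a_val (vr \<sigma> v_A) \<le> vr \<sigma> v_W \<and>
     (\<exists>vs. distinct vs \<and> set vs = {..<n} - bits (vr \<sigma> v_A) \<and> length vs + k = n \<and>
       (\<forall>j<length vs. cut_card {..<n} E ({..<n} - set (take j vs)) \<le> vr \<sigma> v_W) \<and>
       outq \<sigma> = (if k = 0 then encode_dtree (caterpillar vs) else concat (map (\<lambda>u. [0, Suc u]) vs)))"

text \<open>By the recursion, a value of at most \<open>W\<close> means a cut of at most
  \<open>W\<close> and a vertex whose removal leaves a value of at most \<open>W\<close>; the
  descent never has to backtrack.\<close>

lemma output_step:
  assumes inv: "output_inv (Suc k) \<sigma>"
  shows "ok output_step (49 + n * 48) (output_inv k) \<sigma>"
proof -
  define a where "a = vr \<sigma> v_A"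
  define W where "W = vr \<sigma> v_W"
  obtain vs where vs: "distinct vs" "set vs = {..<n} - bits a" "length vs + Suc k = n"
    "\<And>j. j < length vs \<Longrightarrow> cut_card {..<n} E ({..<n} - set (take j vs)) \<le> W"
    "outq \<sigma> = concat (map (\<lambda>u. [0, Suc u]) vs)"
    using inv unfolding output_inv_def a_def W_def by auto
  have base: "base \<sigma>" and srch: "searched \<sigma>" and "vr \<sigma> v_out = Suc k" "a < N" "ar \<sigma> a_val a \<le> W"
    using inv by (simp_all add: output_inv_def a_def W_def)
  obtain K where K: "table K N \<sigma>" "W \<le> K"
    using srch by (auto simp: searched_def W_def)
  have val: "ar \<sigma> a_val b \<le> W \<longleftrightarrow> reach {..<n} E W (bits b)" if "b < N" for b
    using K that unfolding table_def by blast
  have sub: "bits a \<subseteq> {..<n}"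
    using \<open>a < N\<close> unfolding less_N_iff .
  \<comment> \<open>\<open>k + 1\<close> vertices are still to be printed, so the recursion for
    nonempty sets applies.\<close>
  have "a \<noteq> 0"
  proof
    assume "a = 0"
    then have "set vs = {..<n}"
      using vs(2) by simp
    then show False
      using distinct_card[OF vs(1)] vs(3) by simp
  qed
  then have cut: "cut_card {..<n} E (bits a) \<le> W"
    and "\<exists>v. bit a v \<and> reach {..<n} E W (bits (a - 2 ^ v))"
    using reach_bits_iff[of a W] val[OF \<open>a < N\<close>] \<open>ar \<sigma> a_val a \<le> W\<close> \<open>a < N\<close> by simp_all
  moreover have less: "a - 2 ^ v < N" for v
    using \<open>a < N\<close> by simp
  ultimately have good: "\<exists>v. bit a v \<and> ar \<sigma> a_val (a - 2 ^ v) \<le> vr \<sigma> v_W"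
    using val W_def by blast
  define R where "R \<tau> \<longleftrightarrow> frame (insert v_compl scan_vars) {} \<sigma> \<tau> \<and>
      (\<exists>v. bit a v \<and> ar \<sigma> a_val (a - 2 ^ v) \<le> W \<and> vr \<tau> v_label = Suc v \<and> vr \<tau> v_bit = 2 ^ v)" for \<tau>
  have 1: "ok (scan_init ;; While v_rem scan_step) (23 + n * 48) R \<sigma>"
    using scan[OF base a_def[symmetric] \<open>a < N\<close> good] unfolding R_def W_def .
  have 2: "ok print_vertex 26 (output_inv k) \<tau>" if "R \<tau>" for \<tau>
  proof -
    obtain v where v: "bit a v" "ar \<sigma> a_val (a - 2 ^ v) \<le> W" "vr \<tau> v_label = Suc v" "vr \<tau> v_bit = 2 ^ v"
      and fr: "frame (insert v_compl scan_vars) {} \<sigma> \<tau>"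
      using \<open>R \<tau>\<close> unfolding R_def by blast
    have vars: "vr \<tau> v_out = Suc k" "vr \<tau> v_one = 1" "vr \<tau> v_zero = 0" "vr \<tau> v_A = a"
      "ar \<tau> = ar \<sigma>" "outq \<tau> = outq \<sigma>"
      using fr base \<open>vr \<sigma> v_out = Suc k\<close> by (simp_all add: frame_def base_def a_def fun_eq_iff)
    let ?ws = "vs @ [v]"
    have "v \<in> bits a"
      using v(1) by simp
    then have ws: "distinct ?ws" "set ?ws = {..<n} - bits (a - 2 ^ v)" "length ?ws + k = n"
      using vs(1-3) sub unfolding bits_remove[OF v(1)] by auto
    have cuts: "cut_card {..<n} E ({..<n} - set (take j ?ws)) \<le> W" if "j < length ?ws" for j
    proof (cases "j < length vs")
      case True
      then show ?thesis
        using vs(4) by simp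
    next
      case False
      then have "j = length vs"
        using that by simp
      moreover have "{..<n} - set vs = bits a"
        unfolding vs(2) using sub by blast
      ultimately show ?thesis
        using cut by simp
    qed
    have post: "output_inv k (\<tau>\<lparr>outq := ys, vr := f\<rparr>)"
      if f: "f v_A = a - 2 ^ v" "f v_out = k"
        "\<forall>x. x \<notin> insert v_A (insert v_out (insert v_compl scan_vars)) \<longrightarrow> f x = vr \<sigma> x"
        and ys: "ys = (if k = 0 then encode_dtree (caterpillar ?ws) else concat (map (\<lambda>u. [0, Suc u]) ?ws))" for f ys
    proof -
      let ?\<upsilon> = "\<tau>\<lparr>outq := ys, vr := f\<rparr>"
      have W': "vr ?\<upsilon> v_W = W" "ar ?\<upsilon> = ar \<sigma>" "vr ?\<upsilon> v_A = a - 2 ^ v" "outq ?\<upsilon> = ys" "vr ?\<upsilon> v_out = k"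
        using f vars by (simp_all add: W_def)
      have "base ?\<upsilon>"
        using base f(3) vars by (simp add: base_def)
      moreover have "searched ?\<upsilon>"
        using srch W' unfolding searched_def W_def table_def by simp
      ultimately show ?thesis
        unfolding output_inv_def W' using less v(2) ws cuts ys by (intro conjI exI[of _ ?ws]) auto
    qed
    have "wp print_vertex (output_inv k) \<tau>"
    proof (cases "k = 0")
      case True
      then show ?thesis
        using v vars fr by (simp add: print_vertex_def post[unfolded True] encode_caterpillar vs(5) frame_def)
    next
      case False
      then show ?thesis
        using v vars fr by (simp add: print_vertex_def post vs(5) frame_def)
    qed
    then show ?thesis
      by (rule ok_mono[OF ok_wp]) (simp_all add: print_vertex_def)
  qed
  have "ok output_step (23 + n * 48 + 26) (output_inv k) \<sigma>"
    unfolding output_step_def by (rule ok_seq[OF 1 2])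
  then show ?thesis
    by (rule ok_mono) simp_all
qed

lemma searched_cong: "ar \<tau> = ar \<sigma> \<Longrightarrow> vr \<tau> v_W = vr \<sigma> v_W \<Longrightarrow> searched \<sigma> \<Longrightarrow> searched \<tau>"
  by (simp add: searched_def table_def)

text \<open>The bound on \<open>rounds\<close> belongs to the postcondition because it is obtained
  through \<open>W\<close>, which is a value of the final state.\<close>

definition solution :: "state \<Rightarrow> bool" where
  "solution \<sigma> \<longleftrightarrow> (\<exists>vs. outq \<sigma> = encode_dtree (caterpillar vs) \<and>
     linear_decomposition {..<n} (caterpillar vs) \<and>
     boolwidth {..<n} E (caterpillar vs) = lbw {..<n} E) \<and>
     real (2 ^ rounds) \<le> 2 * 2 powr lbw {..<n} E"

text \<open>Complements of prefixes of \<open>vs\<close> are the sets of its suffixes, that is, the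
  spine of the caterpillar, whose cuts were bounded on the way down.\<close>

lemma output_inv_solution:
  assumes "output_inv 0 \<sigma>"
  shows "solution \<sigma>"
proof -
  define W where "W = vr \<sigma> v_W"
  obtain vs where vs: "distinct vs" "set vs \<subseteq> {..<n}" "length vs = n"
    "\<And>j. j < length vs \<Longrightarrow> cut_card {..<n} E ({..<n} - set (take j vs)) \<le> W"
    "outq \<sigma> = encode_dtree (caterpillar vs)"
    using assms unfolding output_inv_def W_def by auto
  have V: "set vs = {..<n}"
    using vs(2,3) distinct_card[OF vs(1)] by (intro card_subset_eq) auto
  have srch: "searched \<sigma>"
    using assms by (simp add: output_inv_def)
  have cuts: "cut_card {..<n} E (set (drop j vs)) \<le> W" if "j < length vs" for j
  proof -
    have "{..<n} - set (take j vs) = set (drop j vs)"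
      using set_take_disj_set_drop_if_distinct[OF vs(1), of j j] V
        set_append[of "take j vs" "drop j vs"] by auto
    then show ?thesis
      using vs(4)[OF that] by simp
  qed
  have least: "W \<le> M" if "reach {..<n} E M {..<n}" for M
    using srch that by (simp add: searched_def W_def)
  have ne: "{..<n} \<noteq> {}"
    using V vs(3) n by auto
  note opt = caterpillar_optimal[OF finite_lessThan ne vs(1) V cuts least]
  have "2 ^ rounds \<le> 2 * W"
    using srch by (simp add: searched_def W_def)
  then have "real (2 ^ rounds) \<le> real (2 * W)"
    using of_nat_mono by blast
  then show ?thesis
    unfolding solution_def using opt vs(5) by auto
qed

lemma main:
  "ok main (28 + n * (34 + n * 27) + (878 * (n * N * 2 ^ rounds) + (10 + (3 + n * (49 + n * 48 + 1)))))
     solution \<lparr>vr = \<lambda>_. 0, ar = \<lambda>_ _. 0, inq = encode_graph n E, outq = []\<rparr>"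
proof -
  have out: "ok (output_init ;; While v_out output_step) (10 + (3 + n * (49 + n * 48 + 1))) solution \<tau>"
    if "base \<tau>" "searched \<tau>" "outq \<tau> = []" for \<tau>
  proof -
    define \<upsilon> where "\<upsilon> = \<tau>\<lparr>vr := (vr \<tau>)(v_A := N - 1, v_out := n)\<rparr>"
    have vars: "vr \<tau> v_full = N - 1" "vr \<tau> v_zero = 0" "vr \<tau> v_n = n"
      using that(1) by (simp_all add: base_def)
    have less: "N - 1 < N" "n < N"
      using n_less_N(1) by simp_all
    have wp: "wp output_init (\<lambda>\<sigma>. \<sigma> = \<upsilon>) \<tau>"
      using big less by (simp add: output_init_def \<upsilon>_def vars)
    have srch: "searched \<upsilon>"
      by (rule searched_cong[OF _ _ that(2)]) (simp_all add: \<upsilon>_def)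
    have "base \<upsilon>"
      using that(1) by (simp add: base_def \<upsilon>_def)
    moreover have "set [] = {..<n} - bits (N - 1)"
      unfolding N bits_full by simp
    moreover have "ar \<upsilon> a_val (N - 1) \<le> vr \<upsilon> v_W"
      using srch by (simp add: searched_def)
    moreover have "vr \<upsilon> v_A = N - 1" "vr \<upsilon> v_out = n" "outq \<upsilon> = []"
      using that(3) by (simp_all add: \<upsilon>_def)
    ultimately have start: "output_inv n \<upsilon>"
      unfolding output_inv_def using srch less n by (intro conjI exI[of _ "[]"]) auto
    have "ok (While v_out output_step) (3 + n * (49 + n * 48 + 1)) (output_inv 0) \<upsilon>"
      using start
    proof (rule ok_for)
      fix k \<sigma>
      assume "output_inv (Suc k) \<sigma>"
      then show "vr \<sigma> v_out > 0 \<and> ok output_step (49 + n * 48) (output_inv k) \<sigma>"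
        using output_step by (simp add: output_inv_def)
    qed (simp add: output_inv_def)
    then have "ok (While v_out output_step) (3 + n * (49 + n * 48 + 1)) solution \<upsilon>"
      by (rule ok_mono) (use output_inv_solution in simp_all)
    then have "ok (output_init ;; While v_out output_step)
        (cost output_init + (3 + n * (49 + n * 48 + 1))) solution \<tau>"
      by (intro ok_wp_seq[OF wp]) simp
    then show ?thesis
      by (simp add: output_init_def)
  qed
  have srch: "ok search (878 * (n * N * 2 ^ rounds)) (\<lambda>\<tau>. base \<tau> \<and> searched \<tau> \<and> outq \<tau> = []) \<sigma>"
    if "base \<sigma> \<and> vr \<sigma> v_K = 1 \<and> (\<forall>u. ar \<sigma> a_mark u = 0) \<and> outq \<sigma> = []" for \<sigma>
  proof -
    have s: "base \<sigma>" "vr \<sigma> v_K = 1" "\<forall>u. ar \<sigma> a_mark u = 0" "outq \<sigma> = []"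
      using that by blast+
    show ?thesis
    proof (rule ok_mono[OF search[OF s(1-3)]])
      fix \<tau>
      assume *: "frame round_vars tables \<sigma> \<tau> \<and> searched \<tau>"
      then have "base \<tau>" "outq \<tau> = []"
        using s(1,4) by (simp_all add: frame_def base_def)
      then show "base \<tau> \<and> searched \<tau> \<and> outq \<tau> = []"
        using * by blast
    qed simp
  qed
  show ?thesis
    unfolding main_def by (rule ok_seq[OF read_graph], rule ok_seq, erule srch, rule out) auto
qed

text \<open>Input and output are quadratic in \<open>n\<close>, the search is a multiple of
  \<open>n * N * 2 ^ rounds\<close>, and all of it is absorbed by \<open>X\<close>. The constant is
  \<open>41 + 84 + 75 + 2 * 878\<close>, rounded up.\<close>

lemma main_computes:
  "\<exists>t T. computes_within (compile 0 main) w (30 + 4 * N) T (encode_graph n E) (encode_dtree t) \<and>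
     linear_decomposition {..<n} t \<and> boolwidth {..<n} E t = lbw {..<n} E \<and>
     real T \<le> 2000 * (real n ^ 3 * (2 ^ n * 2 powr lbw {..<n} E))"
proof -
  have "wf_com main"
    by (simp add: main_def read_graph_def read_init_def row_def row_init_def read_step_def row_end_def
        read_end_def search_def search_round_def round_init_def subset_step_def count_def count_init_def
        vertex_step_def vertex_init_def merge_step_def advance_def unmark_init_def unmark_step_def
        best_init_def best_step_def record_value_def round_end_def output_init_def output_step_def
        scan_init_def scan_step_def print_vertex_def)
  from ok_computes_within[OF main this] obtain T \<tau> where
    T: "T \<le> 28 + n * (34 + n * 27) + (878 * (n * N * 2 ^ rounds) + (10 + (3 + n * (49 + n * 48 + 1))))"
    and comp: "computes_within (compile 0 main) w (30 + 4 * N) T (encode_graph n E) (outq \<tau>)"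
    and "solution \<tau>"
    by blast
  then obtain vs where vs: "outq \<tau> = encode_dtree (caterpillar vs)"
     "linear_decomposition {..<n} (caterpillar vs)"
     "boolwidth {..<n} E (caterpillar vs) = lbw {..<n} E"
    and r: "real (2 ^ rounds) \<le> 2 * 2 powr lbw {..<n} E"
    by (auto simp: solution_def)
  define R where "R = 2 powr lbw {..<n} E"
  define X where "X = real n ^ 3 * (2 ^ n * R)"
  have "real (2 ^ rounds) \<le> 2 * R"
    using r by (simp add: R_def)
  \<comment> \<open>The bound on \<open>rounds\<close> yields only \<open>R \<ge> 1/2\<close>; the
    factor \<open>2 ^ n \<ge> 2\<close> makes up for it below.\<close>
  have R: "1 \<le> 2 * R"
    using \<open>real (2 ^ rounds) \<le> 2 * R\<close> one_le_power[of "2 :: nat" rounds] by linarith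
  have n1: "1 \<le> real n"
    using n by simp
  have "(2::real) * 1 \<le> 2 ^ n * (2 * R)"
  proof (rule mult_mono)
    show "(2::real) \<le> 2 ^ n"
      using power_increasing[of 1 n "2::real"] n by simp
  qed (use R in auto)
  then have R1: "1 \<le> 2 ^ n * R"
    by simp
  have n3: "real n * 1 \<le> real n * real n ^ 2" "real n ^ 2 * 1 \<le> real n ^ 2 * real n"
    using n1 by (intro mult_left_mono; simp)+
  have pows: "1 \<le> X" "real n \<le> X" "real n ^ 2 \<le> X"
  proof -
    have "real n ^ 3 * 1 \<le> X"
      unfolding X_def by (rule mult_left_mono[OF R1]) simp
    moreover have "real n ^ 2 \<le> real n ^ 3" "real n \<le> real n ^ 3"
      using n3 by (simp_all add: power3_eq_cube power2_eq_square)
    ultimately show "1 \<le> X" "real n \<le> X" "real n ^ 2 \<le> X"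
      using n1 by linarith+
  qed
  have "real n * (2 ^ n * real (2 ^ rounds)) \<le> real n * (2 ^ n * (2 * R))"
    using \<open>real (2 ^ rounds) \<le> 2 * R\<close> by (intro mult_left_mono) auto
  also have "\<dots> \<le> real n ^ 3 * (2 ^ n * (2 * R))"
  proof (rule mult_right_mono)
    show "real n \<le> real n ^ 3"
      using n3(1) by (simp add: power3_eq_cube power2_eq_square)
  qed (simp add: R_def)
  also have "\<dots> = 2 * X"
    by (simp add: X_def)
  finally have main_term: "real (n * N * 2 ^ rounds) \<le> 2 * X"
    by (simp add: N mult.assoc)
  have "real T \<le> real (28 + n * (34 + n * 27) + (878 * (n * N * 2 ^ rounds) + (10 + (3 + n * (49 + n * 48 + 1)))))"
    using T by (rule of_nat_mono)
  also have "\<dots> = 41 + 84 * real n + 75 * real n ^ 2 + 878 * real (n * N * 2 ^ rounds)"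
    by (simp add: algebra_simps power2_eq_square)
  also have "\<dots> \<le> 2000 * X"
    using pows main_term by linarith
  finally have "real T \<le> 2000 * X" .
  then show ?thesis
    using comp vs unfolding X_def R_def by metis
qed

end

text \<open>Cells are indexed by all vertex sets, so words need a length linear in \<open>n\<close>.
  For \<open>n \<ge> 1\<close> the memory has at most \<open>32 * 2 ^ n\<close> registers, and
  \<open>5 + n \<le> 10 * n\<close>.\<close>

lemma alg_instance:
  assumes "n \<ge> 1" "simple_graph {..<n} E"
  shows "alg n (2 ^ n) (10 * n) E"
proof
  have "(2::nat) ^ 1 \<le> 2 ^ n"
    using assms(1) by (intro power_increasing) auto
  then have "30 + 4 * 2 ^ n \<le> 2 ^ 5 * (2::nat) ^ n"
    by simp
  also have "\<dots> = 2 ^ (5 + n)"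
    by (simp only: power_add)
  also have "\<dots> \<le> 2 ^ (10 * n)"
    using assms(1) by (intro power_increasing) auto
  finally show "30 + 4 * 2 ^ n \<le> (2::nat) ^ (10 * n)" .
qed (use assms in auto)

theorem theorem5:
  shows "\<exists>(P :: program) (b :: nat) (c :: real) (d :: real).
    \<forall>(n :: nat) (E :: nat set set). n \<ge> 1 \<longrightarrow> simple_graph {..<n} E \<longrightarrow>
      (\<exists>(t :: nat dtree) (T :: nat) (s :: nat).
        computes_within P (b * n) s T (encode_graph n E) (encode_dtree t) \<and>
        linear_decomposition {..<n} t \<and>
        boolwidth {..<n} E t = lbw {..<n} E \<and>
        real T \<le> c * (real n ^ 3 * 2 powr (real n + lbw {..<n} E)) \<and>
        real (s * (b * n)) \<le> d * (real n * 2 ^ n))"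
proof (rule exI[of _ "compile 0 main"], rule exI[of _ 10], rule exI[of _ 2000], rule exI[of _ 340],
    intro allI impI)
  fix n :: nat and E :: "nat set set"
  assume "n \<ge> 1" "simple_graph {..<n} E"
  then interpret alg n "2 ^ n" "10 * n" E
    by (rule alg_instance)
  obtain t T where *: "computes_within (compile 0 main) (10 * n) (30 + 4 * 2 ^ n) T (encode_graph n E) (encode_dtree t)"
     "linear_decomposition {..<n} t" "boolwidth {..<n} E t = lbw {..<n} E"
     "real T \<le> 2000 * (real n ^ 3 * (2 ^ n * 2 powr lbw {..<n} E))"
    using main_computes by blast
  \<comment> \<open>The space constant: at most \<open>34 * 2 ^ n\<close> registers of
    \<open>10 * n\<close> bits each give 340.\<close>
  have "(30 + 4 * 2 ^ n) * (10 * real n) \<le> (34 * 2 ^ n) * (10 * real n)"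
    by (intro mult_right_mono) auto
  then have "real ((30 + 4 * 2 ^ n) * (10 * n)) \<le> 340 * (real n * 2 ^ n)"
    by (simp add: algebra_simps)
  moreover have "real T \<le> 2000 * (real n ^ 3 * 2 powr (real n + lbw {..<n} E))"
    using *(4) by (simp add: powr_add powr_realpow)
  ultimately show "\<exists>(t :: nat dtree) (T :: nat) (s :: nat).
        computes_within (compile 0 main) (10 * n) s T (encode_graph n E) (encode_dtree t) \<and>
        linear_decomposition {..<n} t \<and>
        boolwidth {..<n} E t = lbw {..<n} E \<and>
        real T \<le> 2000 * (real n ^ 3 * 2 powr (real n + lbw {..<n} E)) \<and>
        real (s * (10 * n)) \<le> 340 * (real n * 2 ^ n)"
    using * by blast
qed

end
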